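(* Let $M^2$ be a Riemannian manifold (of dimension 2) of sign-preserving curvature, and let $TM^2$ be its tangent bundle endowed with the Sasaki metric. Suppose that $\tilde F^2\subset TM^2$ is a (2-dimensional) totally geodesic submanifold having non-transversal intersection with the fibers. Then locally $\tilde F^2$ is a cylinder-type surface based on a geodesic $\gamma$ in $M^2$ with elements generated by a parallel unit vector field along $\gamma$.
   Context: Sign-preserving curvature means that the Gaussian curvature is either everywhere positive or everywhere negative on $M^2$. The fibers are the tangent spaces $T_qM^2=\pi^{-1}(q)\subset TM^2$, $q\in M^2$, where $\pi:TM\to M$ denotes the bundle projection of the tangent bundle of a Riemannian manifold $(M,g)$. Let $\nabla$ be the Levi-Civita connection of $(M,g)$. The Sasaki metric on $TM$ is $\langle\langle \tilde X,\tilde Y\rangle\rangle=\langle \pi_*\tilde X,\pi_*\tilde Y\rangle+\langle \mathcal K\tilde X,\mathcal K\tilde Y\rangle$, where $\langle\cdot,\cdot\rangle=g$ and $\mathcal K:TTM\to TM$ is the connection map; in induced local coordinates $(x^i,\xi^i)$ on $TM$, for $\tilde X=\tilde X^i\frac{\partial}{\partial x^i}+\tilde X^{n+i}\frac{\partial}{\partial \xi^i}$ at the point $(q,\xi)$ (with $n=\dim M$, $\partial_i=\partial/\partial x^i$ the coordinate frame on $M$, and $\Gamma^i_{jk}$ the Christoffel symbols of $g$), one has $\pi_*\tilde X=\tilde X^i\partial_i$ and $\mathcal K\tilde X=(\tilde X^{n+i}+\Gamma^i_{jk}(q)\xi^j\tilde X^k)\partial_i$. A cylinder-type surface based on a geodesic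 $\gamma(s)$ with elements generated by a parallel unit vector field $e(s)$ along $\gamma$ is the surface formed by the points $(\gamma(s),\,t\,e(s))\in TM$, where $s$ is the arc-length parameter of $\gamma$, $t$ is a real parameter, $\nabla_{\gamma'}e=0$ and $|e|=1$.
   Formalization: It is additionally assumed that no nonempty open piece of the submanifold lies in a single fiber; a fiber itself is totally geodesic and nowhere transversal to the fibers, but is not a cylinder over a geodesic. *)

theory Defs
  imports "HOL-Analysis.Analysis"
begin

section \<open>Smooth maps between normed spaces\<close>

text \<open>Used only for open \<open>S\<close>: all iterated directional derivatives exist (in the Frechet sense)
  and are continuous.\<close>

primrec Ck_on :: "nat \<Rightarrow> 'a::real_normed_vector set \<Rightarrow> ('a \<Rightarrow> 'b::real_normed_vector) \<Rightarrow> bool"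
where
  "Ck_on 0 S f \<longleftrightarrow> continuous_on S f"
| "Ck_on (Suc k) S f \<longleftrightarrow>
     (\<forall>x\<in>S. f differentiable (at x)) \<and> (\<forall>v. Ck_on k S (\<lambda>x. frechet_derivative f (at x) v))"

definition smooth_on :: "'a::real_normed_vector set \<Rightarrow> ('a \<Rightarrow> 'b::real_normed_vector) \<Rightarrow> bool"
  where "smooth_on S f \<longleftrightarrow> (\<forall>k. Ck_on k S f)"


section \<open>Smooth manifolds\<close>

text \<open>A manifold modelled on the Euclidean space \<open>'e\<close> is given by an atlas.  A chart is a domain
  together with a map, whose values off the domain are irrelevant.  The underlying point set is
  the union of the chart domains, and the topology is the one determined by the atlas.\<close>

type_synonym ('a, 'e) chart = "'a set \<times> ('a \<Rightarrow> 'e)"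

abbreviation cdom :: "('a, 'e) chart \<Rightarrow> 'a set" where "cdom \<equiv> fst"
abbreviation cmap :: "('a, 'e) chart \<Rightarrow> 'a \<Rightarrow> 'e" where "cmap \<equiv> snd"

definition crange :: "('a, 'e) chart \<Rightarrow> 'e set"
  where "crange c = cmap c ` cdom c"

definition cinv :: "('a, 'e) chart \<Rightarrow> 'e \<Rightarrow> 'a"
  where "cinv c = inv_into (cdom c) (cmap c)"

definition points :: "('a, 'e) chart set \<Rightarrow> 'a set"
  where "points A = (\<Union>c\<in>A. cdom c)"

definition chart_at :: "('a, 'e) chart set \<Rightarrow> 'a \<Rightarrow> ('a, 'e) chart \<Rightarrow> bool"
  where "chart_at A q c \<longleftrightarrow> c \<in> A \<and> q \<in> cdom c"

definition atlas_open :: "('a, 'e::euclidean_space) chart set \<Rightarrow> 'a set \<Rightarrow> bool"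
  where "atlas_open A W \<longleftrightarrow> W \<subseteq> points A \<and> (\<forall>c\<in>A. open {x \<in> crange c. cinv c x \<in> W})"

definition atlas_topology :: "('a, 'e::euclidean_space) chart set \<Rightarrow> 'a topology"
  where "atlas_topology A = topology (atlas_open A)"

lemma istopology_atlas_open: "istopology (atlas_open A)"
  unfolding istopology_def
proof (intro conjI allI impI)
  fix S T assume S: "atlas_open A S" and T: "atlas_open A T"
  have "{x \<in> crange c. cinv c x \<in> S \<inter> T} =
      {x \<in> crange c. cinv c x \<in> S} \<inter> {x \<in> crange c. cinv c x \<in> T}" for c :: "('a, 'b) chart"
    by auto
  then show "atlas_open A (S \<inter> T)"
    using S T by (auto simp: atlas_open_def)
next
  fix \<K> assume K: "\<forall>K\<in>\<K>. atlas_open A K"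
  have "{x \<in> crange c. cinv c x \<in> \<Union>\<K>} = (\<Union>K\<in>\<K>. {x \<in> crange c. cinv c x \<in> K})"
    for c :: "('a, 'b) chart"
    by auto
  then show "atlas_open A (\<Union>\<K>)"
    using K by (auto simp: atlas_open_def)
qed

lemma openin_atlas_topology: "openin (atlas_topology A) = atlas_open A"
  by (simp add: atlas_topology_def istopology_atlas_open)

definition smooth_manifold :: "('a, 'e::euclidean_space) chart set \<Rightarrow> bool"
  where "smooth_manifold A \<longleftrightarrow>
    (\<forall>c\<in>A. inj_on (cmap c) (cdom c) \<and> open (crange c)) \<and>
    (\<forall>c\<in>A. \<forall>c'\<in>A. open (cmap c ` (cdom c \<inter> cdom c')) \<and>
        smooth_on (cmap c ` (cdom c \<inter> cdom c')) (cmap c' \<circ> cinv c)) \<and>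
    Hausdorff_space (atlas_topology A) \<and>
    second_countable (atlas_topology A)"


section \<open>Tangent vectors\<close>

text \<open>A tangent vector at \<open>q\<close> is the family of its component vectors in all the charts around
  \<open>q\<close>, subject to the contravariant transformation law, and 0 by convention at the other charts.
  Vector space operations are componentwise.\<close>

type_synonym ('a, 'e) tvec = "('a, 'e) chart \<Rightarrow> 'e"

definition tangent_vectors :: "('a, 'e::euclidean_space) chart set \<Rightarrow> 'a \<Rightarrow> ('a, 'e) tvec set"
  where "tangent_vectors A q = {v.
    (\<forall>c. \<not> chart_at A q c \<longrightarrow> v c = 0) \<and>
    (\<forall>c c'. chart_at A q c \<longrightarrow> chart_at A q c' \<longrightarrow>
       v c' = frechet_derivative (cmap c' \<circ> cinv c) (at (cmap c q)) (v c))}"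

text \<open>The tangent vector at \<open>q\<close> whose component vector in the chart \<open>c\<close> is \<open>u\<close>.\<close>

definition tvec_of ::
  "('a, 'e::euclidean_space) chart set \<Rightarrow> ('a, 'e) chart \<Rightarrow> 'a \<Rightarrow> 'e \<Rightarrow> ('a, 'e) tvec"
  where "tvec_of A c q u = (\<lambda>c'. if chart_at A q c'
    then frechet_derivative (cmap c' \<circ> cinv c) (at (cmap c q)) u else 0)"

definition tvec_add :: "('a, 'e::euclidean_space) tvec \<Rightarrow> ('a, 'e) tvec \<Rightarrow> ('a, 'e) tvec"
  where "tvec_add v w = (\<lambda>c. v c + w c)"

definition tvec_scale :: "real \<Rightarrow> ('a, 'e::euclidean_space) tvec \<Rightarrow> ('a, 'e) tvec"
  where "tvec_scale t v = (\<lambda>c. t *\<^sub>R v c)"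

definition tvec_zero :: "('a, 'e::euclidean_space) tvec"
  where "tvec_zero = (\<lambda>c. 0)"


section \<open>Riemannian metrics\<close>

type_synonym ('a, 'e) metric = "'a \<Rightarrow> ('a, 'e) tvec \<Rightarrow> ('a, 'e) tvec \<Rightarrow> real"

text \<open>The coordinate expression \<open>g\<^sub>i\<^sub>j(x) u\<^sup>i v\<^sup>j\<close> of a metric in the chart \<open>c\<close>.\<close>

definition coord_metric ::
  "('a, 'e::euclidean_space) chart set \<Rightarrow> ('a, 'e) metric \<Rightarrow> ('a, 'e) chart \<Rightarrow> 'e \<Rightarrow> 'e \<Rightarrow> 'e \<Rightarrow> real"
  where "coord_metric A g c x u v =
    g (cinv c x) (tvec_of A c (cinv c x) u) (tvec_of A c (cinv c x) v)"

definition riemannian_metric ::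
  "('a, 'e::euclidean_space) chart set \<Rightarrow> ('a, 'e) metric \<Rightarrow> bool"
  where "riemannian_metric A g \<longleftrightarrow> (\<forall>c\<in>A.
    (\<forall>x\<in>crange c. bilinear (coord_metric A g c x) \<and>
       (\<forall>u v. coord_metric A g c x u v = coord_metric A g c x v u) \<and>
       (\<forall>u. u \<noteq> 0 \<longrightarrow> coord_metric A g c x u u > 0)) \<and>
    (\<forall>u v. smooth_on (crange c) (\<lambda>x. coord_metric A g c x u v)))"


section \<open>Levi-Civita connection and curvature in coordinates\<close>

text \<open>For constant fields \<open>u\<close>, \<open>v\<close> in coordinates this is \<open>\<nabla>\<^sub>u v\<close>, given by the Koszul formula;
  its components are \<open>\<Gamma>\<^sup>i\<^sub>j\<^sub>k u\<^sup>j v\<^sup>k\<close>.\<close>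

definition christoffel ::
  "('e::euclidean_space \<Rightarrow> 'e \<Rightarrow> 'e \<Rightarrow> real) \<Rightarrow> 'e \<Rightarrow> 'e \<Rightarrow> 'e \<Rightarrow> 'e"
  where "christoffel G x u v = (THE z. \<forall>w. G x z w =
    (frechet_derivative (\<lambda>y. G y v w) (at x) u +
     frechet_derivative (\<lambda>y. G y u w) (at x) v -
     frechet_derivative (\<lambda>y. G y u v) (at x) w) / 2)"

text \<open>\<open>R(u,v)w = \<nabla>\<^sub>u\<nabla>\<^sub>v w - \<nabla>\<^sub>v\<nabla>\<^sub>u w\<close> for constant fields in coordinates.\<close>

definition curvature_tensor ::
  "('e::euclidean_space \<Rightarrow> 'e \<Rightarrow> 'e \<Rightarrow> real) \<Rightarrow> 'e \<Rightarrow> 'e \<Rightarrow> 'e \<Rightarrow> 'e \<Rightarrow> 'e"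
  where "curvature_tensor G x u v w =
    frechet_derivative (\<lambda>y. christoffel G y v w) (at x) u
    - frechet_derivative (\<lambda>y. christoffel G y u w) (at x) v
    + christoffel G x u (christoffel G x v w)
    - christoffel G x v (christoffel G x u w)"

definition sectional_curvature ::
  "('e::euclidean_space \<Rightarrow> 'e \<Rightarrow> 'e \<Rightarrow> real) \<Rightarrow> 'e \<Rightarrow> 'e \<Rightarrow> 'e \<Rightarrow> real"
  where "sectional_curvature G x u v =
    G x (curvature_tensor G x u v v) u / (G x u u * G x v v - (G x u v)\<^sup>2)"

definition gauss_curvature :: "(real^2 \<Rightarrow> real^2 \<Rightarrow> real^2 \<Rightarrow> real) \<Rightarrow> real^2 \<Rightarrow> real"
  where "gauss_curvature G x = sectional_curvature G x (axis 1 1) (axis 2 1)"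

text \<open>The Gaussian curvature at a point does not depend on the chart used to compute it.\<close>

definition sign_preserving_curvature ::
  "('a, real^2) chart set \<Rightarrow> ('a, real^2) metric \<Rightarrow> bool"
  where "sign_preserving_curvature A g \<longleftrightarrow>
    (\<forall>c\<in>A. \<forall>x\<in>crange c. gauss_curvature (coord_metric A g c) x > 0) \<or>
    (\<forall>c\<in>A. \<forall>x\<in>crange c. gauss_curvature (coord_metric A g c) x < 0)"


section \<open>Submanifolds\<close>

text \<open>\<open>f\<close> is, in the coordinates of the chart \<open>c\<close>, a regular parametrization over \<open>U\<close> of a relatively
  open piece of \<open>F\<close>.  The dimension of \<open>F\<close> is that of the type \<open>'m\<close>.\<close>

definition local_param :: "('a, 'e::euclidean_space) chart set \<Rightarrow> 'a set \<Rightarrow> ('a, 'e) chart \<Rightarrow>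
    ('m::euclidean_space \<Rightarrow> 'e) \<Rightarrow> 'm set \<Rightarrow> bool"
  where "local_param A F c f U \<longleftrightarrow>
    c \<in> A \<and> open U \<and> smooth_on U f \<and> f ` U \<subseteq> crange c \<and>
    (\<forall>u\<in>U. inj (frechet_derivative f (at u))) \<and>
    (\<exists>h. homeomorphism U (f ` U) f h) \<and>
    (\<exists>W. openin (atlas_topology A) W \<and> F \<inter> W = cinv c ` f ` U)"

definition submanifold ::
  "'m::euclidean_space itself \<Rightarrow> ('a, 'e::euclidean_space) chart set \<Rightarrow> 'a set \<Rightarrow> bool"
  where "submanifold (_ :: 'm itself) A F \<longleftrightarrow> F \<subseteq> points A \<and>
    (\<forall>p\<in>F. \<exists>c f (U :: 'm set). local_param A F c f U \<and> p \<in> cinv c ` f ` U)"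

definition tangent_space ::
  "'m::euclidean_space itself \<Rightarrow> ('a, 'e::euclidean_space) chart set \<Rightarrow> 'a set \<Rightarrow> 'a \<Rightarrow> ('a, 'e) tvec set"
  where "tangent_space (_ :: 'm itself) A F p =
    {tvec_of A c p (frechet_derivative f (at u) a) | c f (U :: 'm set) u a.
       local_param A F c f U \<and> u \<in> U \<and> cinv c (f u) = p}"

definition transversal_at :: "'m::euclidean_space itself \<Rightarrow> 'n::euclidean_space itself \<Rightarrow>
    ('a, 'e::euclidean_space) chart set \<Rightarrow> 'a set \<Rightarrow> 'a set \<Rightarrow> 'a \<Rightarrow> bool"
  where "transversal_at m n A F N p \<longleftrightarrow>
    {tvec_add v w | v w. v \<in> tangent_space m A F p \<and> w \<in> tangent_space n A N p}
      = tangent_vectors A p"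

text \<open>With \<open>f\<close> a local parametrization, \<open>D\<^sub>b D\<^sub>a f + \<Gamma>(D\<^sub>a f, D\<^sub>b f)\<close> is the covariant derivative of the
  coordinate field \<open>D\<^sub>a f\<close> of \<open>F\<close> in the direction \<open>D\<^sub>b f\<close>.  The second fundamental form is its normal
  part; it vanishes iff the covariant derivative is tangent to \<open>F\<close>.\<close>

definition totally_geodesic :: "'m::euclidean_space itself \<Rightarrow>
    ('a, 'e::euclidean_space) chart set \<Rightarrow> ('a, 'e) metric \<Rightarrow> 'a set \<Rightarrow> bool"
  where "totally_geodesic (m :: 'm itself) A g F \<longleftrightarrow> submanifold m A F \<and>
    (\<forall>c f (U :: 'm set). local_param A F c f U \<longrightarrow> (\<forall>u\<in>U. \<forall>a b.
       frechet_derivative (\<lambda>y. frechet_derivative f (at y) a) (at u) b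
       + christoffel (coord_metric A g c) (f u)
           (frechet_derivative f (at u) a) (frechet_derivative f (at u) b)
       \<in> range (frechet_derivative f (at u))))"


section \<open>Curves and vector fields along them\<close>

definition smooth_curve ::
  "('a, 'e::euclidean_space) chart set \<Rightarrow> real set \<Rightarrow> (real \<Rightarrow> 'a) \<Rightarrow> bool"
  where "smooth_curve A I \<gamma> \<longleftrightarrow> \<gamma> ` I \<subseteq> points A \<and>
    (\<forall>c\<in>A. open {s \<in> I. \<gamma> s \<in> cdom c} \<and> smooth_on {s \<in> I. \<gamma> s \<in> cdom c} (cmap c \<circ> \<gamma>))"

definition velocity ::
  "('a, 'e::euclidean_space) chart set \<Rightarrow> (real \<Rightarrow> 'a) \<Rightarrow> real \<Rightarrow> ('a, 'e) tvec"
  where "velocity A \<gamma> s = (\<lambda>c. if chart_at A (\<gamma> s) c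
    then vector_derivative (cmap c \<circ> \<gamma>) (at s) else 0)"

definition smooth_field_along :: "('a, 'e::euclidean_space) chart set \<Rightarrow> real set \<Rightarrow>
    (real \<Rightarrow> 'a) \<Rightarrow> (real \<Rightarrow> ('a, 'e) tvec) \<Rightarrow> bool"
  where "smooth_field_along A I \<gamma> X \<longleftrightarrow>
    (\<forall>s\<in>I. X s \<in> tangent_vectors A (\<gamma> s)) \<and>
    (\<forall>c\<in>A. smooth_on {s \<in> I. \<gamma> s \<in> cdom c} (\<lambda>s. X s c))"

definition cov_deriv_along :: "('a, 'e::euclidean_space) chart set \<Rightarrow> ('a, 'e) metric \<Rightarrow>
    (real \<Rightarrow> 'a) \<Rightarrow> (real \<Rightarrow> ('a, 'e) tvec) \<Rightarrow> real \<Rightarrow> ('a, 'e) tvec"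
  where "cov_deriv_along A g \<gamma> X s = (\<lambda>c. if chart_at A (\<gamma> s) c
    then vector_derivative (\<lambda>r. X r c) (at s)
      + christoffel (coord_metric A g c) (cmap c (\<gamma> s)) (velocity A \<gamma> s c) (X s c)
    else 0)"

definition unit_speed_geodesic :: "('a, 'e::euclidean_space) chart set \<Rightarrow> ('a, 'e) metric \<Rightarrow>
    real set \<Rightarrow> (real \<Rightarrow> 'a) \<Rightarrow> bool"
  where "unit_speed_geodesic A g I \<gamma> \<longleftrightarrow> smooth_curve A I \<gamma> \<and>
    (\<forall>s\<in>I. g (\<gamma> s) (velocity A \<gamma> s) (velocity A \<gamma> s) = 1 \<and>
       cov_deriv_along A g \<gamma> (velocity A \<gamma>) s = tvec_zero)"

definition parallel_unit_field :: "('a, 'e::euclidean_space) chart set \<Rightarrow> ('a, 'e) metric \<Rightarrow>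
    real set \<Rightarrow> (real \<Rightarrow> 'a) \<Rightarrow> (real \<Rightarrow> ('a, 'e) tvec) \<Rightarrow> bool"
  where "parallel_unit_field A g I \<gamma> e \<longleftrightarrow> smooth_field_along A I \<gamma> e \<and>
    (\<forall>s\<in>I. g (\<gamma> s) (e s) (e s) = 1 \<and> cov_deriv_along A g \<gamma> e s = tvec_zero)"


section \<open>The tangent bundle and the Sasaki metric\<close>

type_synonym ('a, 'e) tb = "'a \<times> ('a, 'e) tvec"

definition induced_chart :: "('a, 'e::euclidean_space) chart set \<Rightarrow> ('a, 'e) chart \<Rightarrow>
    (('a, 'e) tb, 'e \<times> 'e) chart"
  where "induced_chart A c =
    (Sigma (cdom c) (tangent_vectors A), \<lambda>(q, \<xi>). (cmap c q, \<xi> c))"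

definition tangent_bundle :: "('a, 'e::euclidean_space) chart set \<Rightarrow>
    (('a, 'e) tb, 'e \<times> 'e) chart set"
  where "tangent_bundle A = induced_chart A ` A"

definition fiber :: "('a, 'e::euclidean_space) chart set \<Rightarrow> 'a \<Rightarrow> ('a, 'e) tb set"
  where "fiber A q = {q} \<times> tangent_vectors A q"

definition proj_push :: "('a, 'e::euclidean_space) chart set \<Rightarrow> ('a, 'e) tb \<Rightarrow>
    (('a, 'e) tb, 'e \<times> 'e) tvec \<Rightarrow> ('a, 'e) tvec"
  where "proj_push A p X = (\<lambda>c. if chart_at A (fst p) c then fst (X (induced_chart A c)) else 0)"

definition connection_map :: "('a, 'e::euclidean_space) chart set \<Rightarrow> ('a, 'e) metric \<Rightarrow>
    ('a, 'e) tb \<Rightarrow> (('a, 'e) tb, 'e \<times> 'e) tvec \<Rightarrow> ('a, 'e) tvec"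
  where "connection_map A g p X = (\<lambda>c. if chart_at A (fst p) c
    then snd (X (induced_chart A c))
      + christoffel (coord_metric A g c) (cmap c (fst p)) (snd p c) (fst (X (induced_chart A c)))
    else 0)"

definition sasaki :: "('a, 'e::euclidean_space) chart set \<Rightarrow> ('a, 'e) metric \<Rightarrow>
    (('a, 'e) tb, 'e \<times> 'e) metric"
  where "sasaki A g p X Y =
    g (fst p) (proj_push A p X) (proj_push A p Y)
    + g (fst p) (connection_map A g p X) (connection_map A g p Y)"

text \<open>Every point of \<open>F\<close> is a point of non-transversal intersection with the fiber through it.\<close>

definition nontransversal_to_fibers ::
  "'m::euclidean_space itself \<Rightarrow> ('a, 'e::euclidean_space) chart set \<Rightarrow> ('a, 'e) tb set \<Rightarrow> bool"
  where "nontransversal_to_fibers m A F \<longleftrightarrow>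
    (\<forall>p\<in>F. \<not> transversal_at m TYPE('e) (tangent_bundle A) F (fiber A (fst p)) p)"

definition cylinder_type_surface :: "(real \<Rightarrow> 'a) \<Rightarrow> (real \<Rightarrow> ('a, 'e::euclidean_space) tvec) \<Rightarrow>
    real set \<Rightarrow> real set \<Rightarrow> ('a, 'e) tb set"
  where "cylinder_type_surface \<gamma> e I J = {(\<gamma> s, tvec_scale t (e s)) | s t. s \<in> I \<and> t \<in> J}"

end

theory Submission
  imports Defs
begin

text \<open>
  Write a point of the tangent bundle as \<open>(x, \<xi>)\<close>. A tangent vector has a horizontal part \<open>u\<close>, its
  projection to the base, and a vertical part \<open>\<alpha> + \<Gamma>(\<xi>, u)\<close>. Non-transversality means that the projection
  has rank at most one on every tangent plane of the surface, so every tangent plane contains a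
  vertical vector \<open>(0, v)\<close>.

  At a point where the rank is one, take a second tangent vector with projection \<open>u \<noteq> 0\<close> and
  differentiate the field \<open>(0, v)\<close> covariantly along it. For the Sasaki metric the horizontal part of the
  result is \<open>R(\<xi>, v)u / 2\<close> (\<open>christoffel_sas_vertical\<close>). It is orthogonal to \<open>u\<close>; being the
  projection of a tangent vector of a totally geodesic surface, it is also a multiple of \<open>u\<close>. Hence it vanishes, and
  in dimension two nonzero curvature forces \<open>\<xi>\<close> and \<open>v\<close> to be parallel (\<open>fiber_direction\<close>). The remaining
  vertical part says that the direction \<open>e\<close> of \<open>v\<close> is parallel along the surface (\<open>v_parallel\<close>,
  \<open>e_parallel\<close>). As \<open>\<xi>\<close> is a multiple of \<open>e\<close>, its covariant derivative is one as well, so the tangent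
  plane is spanned by a vertical and a horizontal vector (\<open>horizontal_vector\<close>). Covariant derivatives of
  horizontal fields project to covariant derivatives on the base (\<open>christoffel_sas_horizontal\<close>), so
  the projected curves are geodesics up to parametrization (\<open>pregeodesic\<close>).

  Having a horizontal direction passes to limits of tangent planes. Points of rank one are dense, as no
  open piece of the surface lies in a fiber; therefore rank zero, where the tangent plane is
  vertical, does not occur (\<open>projection_nonzero\<close>).

  Finally, the projection and \<open>e\<close> are constant along the curves tangent to the kernel of the projection
  (\<open>level_curves\<close>), hence functions of the arc length \<open>s\<close> of one projected curve, while \<open>\<xi> = t e\<close>. The
  pair \<open>(s, t)\<close> maps a neighbourhood onto an open set, which contains a rectangle, and over the
  rectangle the surface is the cylinder (\<open>cylinder\<close>).

  These arguments take place in one chart. The passage from and to the manifold rests on the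
  transformation law of the Christoffel symbols (\<open>christoffel_change\<close>), which makes the Sasaki metric and the
  covariant derivative along a curve computable in any chart (\<open>coord_sasaki\<close>,
  \<open>cov_deriv_along_chart\<close>).
\<close>


section \<open>Calculus of smooth maps\<close>

lemma Ck_on_cong:
  assumes "open S" "\<And>x. x \<in> S \<Longrightarrow> f x = g x" "Ck_on k S f"
  shows "Ck_on k S g"
  using assms(2,3)
proof (induction k arbitrary: f g)
  case 0
  then show ?case by (simp cong: continuous_on_cong)
next
  case (Suc k)
  have d: "(g has_derivative frechet_derivative f (at x)) (at x)" if "x \<in> S" for x
    by (rule has_derivative_transform_within_open[OF _ assms(1) that Suc.prems(1)])
      (use Suc.prems(2) that frechet_derivative_works in auto)
  have "frechet_derivative f (at x) = frechet_derivative g (at x)" if "x \<in> S" for x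
    by (rule frechet_derivative_at[OF d[OF that]])
  then have "Ck_on k S (\<lambda>x. frechet_derivative g (at x) v)" for v
    using Suc.prems(2) by (rule_tac Suc.IH[of "\<lambda>x. frechet_derivative f (at x) v"]) auto
  then show ?case using d by (auto simp: differentiable_def)
qed

lemma Ck_on_Suc_intro:
  assumes "open S" "\<And>x. x \<in> S \<Longrightarrow> (f has_derivative f' x) (at x)"
    and "\<And>v. Ck_on k S (\<lambda>x. f' x v)"
  shows "Ck_on (Suc k) S f"
proof -
  have "f' x = frechet_derivative f (at x)" if "x \<in> S" for x
    using assms(2)[OF that] by (rule frechet_derivative_at)
  then have "Ck_on k S (\<lambda>x. frechet_derivative f (at x) v)" for v
    by (rule_tac Ck_on_cong[OF assms(1) _ assms(3)[of v]]) simp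
  moreover have "\<forall>x\<in>S. f differentiable (at x)"
    using assms(2) unfolding differentiable_def by blast
  ultimately show ?thesis by simp
qed

lemma Ck_on_has_derivative:
  "Ck_on (Suc k) S f \<Longrightarrow> x \<in> S \<Longrightarrow> (f has_derivative frechet_derivative f (at x)) (at x)"
  using frechet_derivative_works by auto

lemma Ck_on_frechet: "Ck_on (Suc k) S f \<Longrightarrow> Ck_on k S (\<lambda>x. frechet_derivative f (at x) v)"
  by simp

lemma Ck_on_Suc_imp: "Ck_on (Suc k) S f \<Longrightarrow> Ck_on k S f"
proof (induction k arbitrary: f)
  case 0
  then show ?case
    by (auto intro!: continuous_at_imp_continuous_on differentiable_imp_continuous_within)
next
  case (Suc k)
  have "Ck_on k S (\<lambda>x. frechet_derivative f (at x) v)" for v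
    by (intro Suc.IH Ck_on_frechet[OF Suc.prems])
  then show ?case using Suc.prems by simp
qed

lemma Ck_on_imp_continuous: "Ck_on k S f \<Longrightarrow> continuous_on S f"
proof (induction k)
  case (Suc k)
  then show ?case using Ck_on_Suc_imp by blast
qed simp

lemma Ck_on_subset: "Ck_on k S f \<Longrightarrow> T \<subseteq> S \<Longrightarrow> Ck_on k T f"
  by (induction k arbitrary: f) (auto intro: continuous_on_subset)

lemma Ck_on_const: "open S \<Longrightarrow> Ck_on k S (\<lambda>x. c)"
  by (induction k arbitrary: c) auto

lemma Ck_on_linear:
  assumes "open S" "bounded_linear L" shows "Ck_on k S L"
proof (cases k)
  case 0
  then show ?thesis by (simp add: assms linear_continuous_on)
next
  case (Suc l)
  show ?thesis unfolding Suc
    by (rule Ck_on_Suc_intro[OF assms(1) bounded_linear_imp_has_derivative[OF assms(2)]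
          Ck_on_const[OF assms(1)]])
qed

lemma Ck_on_bounded_linear:
  assumes "open S" "bounded_linear L"
  shows "Ck_on k S f \<Longrightarrow> Ck_on k S (\<lambda>x. L (f x))"
proof (induction k arbitrary: f)
  case 0
  then show ?case by (auto intro: bounded_linear.continuous_on[OF assms(2)])
next
  case (Suc k)
  show ?case
    by (rule Ck_on_Suc_intro[OF assms(1) bounded_linear.has_derivative[OF assms(2)
          Ck_on_has_derivative[OF Suc.prems]]])
      (assumption, rule Suc.IH, rule Ck_on_frechet[OF Suc.prems])
qed

lemma Ck_on_add:
  assumes "open S"
  shows "Ck_on k S f \<Longrightarrow> Ck_on k S g \<Longrightarrow> Ck_on k S (\<lambda>x. f x + g x)"
proof (induction k arbitrary: f g)
  case 0
  then show ?case by (auto intro: continuous_on_add)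
next
  case (Suc k)
  show ?case
    by (rule Ck_on_Suc_intro[OF assms has_derivative_add[OF
          Ck_on_has_derivative[OF Suc.prems(1)] Ck_on_has_derivative[OF Suc.prems(2)]]])
      (assumption, assumption, intro Suc.IH Ck_on_frechet[OF Suc.prems(1)] Ck_on_frechet[OF Suc.prems(2)])
qed

lemma Ck_on_bilinear:
  assumes "open S" "bounded_bilinear mul"
  shows "Ck_on k S f \<Longrightarrow> Ck_on k S g \<Longrightarrow> Ck_on k S (\<lambda>x. mul (f x) (g x))"
proof (induction k arbitrary: f g)
  case 0
  then show ?case by (auto intro: bounded_bilinear.continuous_on[OF assms(2)])
next
  case (Suc k)
  show ?case
    by (rule Ck_on_Suc_intro[OF assms(1) bounded_bilinear.FDERIV[OF assms(2)
          Ck_on_has_derivative[OF Suc.prems(1)] Ck_on_has_derivative[OF Suc.prems(2)]]])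
      (assumption, assumption, intro Ck_on_add[OF assms(1)] Suc.IH Ck_on_frechet[OF Suc.prems(1)]
        Ck_on_frechet[OF Suc.prems(2)] Ck_on_Suc_imp[OF Suc.prems(1)] Ck_on_Suc_imp[OF Suc.prems(2)])
qed

lemma Ck_on_sum:
  assumes "open S" "\<And>i. i \<in> I \<Longrightarrow> Ck_on k S (f i)"
  shows "Ck_on k S (\<lambda>x. \<Sum>i\<in>I. f i x)"
  using assms(2)
  by (induction I rule: infinite_finite_induct)
    (auto intro: Ck_on_const Ck_on_add assms(1))

lemma linear_sum_Basis:
  fixes L :: "'a::euclidean_space \<Rightarrow> 'b::real_vector"
  assumes "linear L" shows "L v = (\<Sum>i\<in>Basis. (v \<bullet> i) *\<^sub>R L i)"
proof -
  have "L v = L (\<Sum>i\<in>Basis. (v \<bullet> i) *\<^sub>R i)" by (simp add: euclidean_representation)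
  then show ?thesis using assms by (simp add: linear_sum linear_cmul)
qed

lemma Ck_on_compose:
  fixes f :: "'a::real_normed_vector \<Rightarrow> 'b::euclidean_space"
  assumes "open S" "open T" "f ` S \<subseteq> T"
  shows "Ck_on k T g \<Longrightarrow> Ck_on k S f \<Longrightarrow> Ck_on k S (\<lambda>x. g (f x))"
proof (induction k arbitrary: g)
  case 0
  then show ?case using assms by (auto intro: continuous_on_compose2)
next
  case (Suc k)
  have d: "((\<lambda>x. g (f x)) has_derivative
      (\<lambda>v. \<Sum>i\<in>Basis. (frechet_derivative f (at x) v \<bullet> i) *\<^sub>R frechet_derivative g (at (f x)) i)) (at x)"
    if "x \<in> S" for x
  proof -
    have g: "(g has_derivative frechet_derivative g (at (f x))) (at (f x))"
      by (rule Ck_on_has_derivative[OF Suc.prems(1)]) (use that assms in auto)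
    show ?thesis
      unfolding linear_sum_Basis[OF has_derivative_linear[OF g], symmetric]
      by (rule has_derivative_compose[OF Ck_on_has_derivative[OF Suc.prems(2) that] g])
  qed
  have "Ck_on k S (\<lambda>x. frechet_derivative f (at x) v \<bullet> i)" for v i
    by (intro Ck_on_bounded_linear[OF assms(1) bounded_linear_inner_left] Ck_on_frechet[OF Suc.prems(2)])
  moreover have "Ck_on k S (\<lambda>x. frechet_derivative g (at (f x)) i)" for i
    by (intro Suc.IH Ck_on_Suc_imp[OF Suc.prems(2)] Ck_on_frechet[OF Suc.prems(1)])
  ultimately show ?case
    by (intro Ck_on_Suc_intro[OF assms(1) d] Ck_on_sum[OF assms(1)]
        Ck_on_bilinear[OF assms(1) bounded_bilinear_scaleR])
qed

lemma Ck_on_inverse: "Ck_on k {x::real. x \<noteq> 0} inverse"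
proof -
  have o: "open {x::real. x \<noteq> 0}" by (rule open_Collect_neq) (auto intro: continuous_intros)
  show ?thesis
  proof (induction k)
    case 0
    then show ?case by (auto intro: continuous_intros)
  next
    case (Suc k)
    show ?case
      by (rule Ck_on_Suc_intro[OF o has_derivative_inverse' ])
        (auto intro!: Ck_on_bilinear[OF o bounded_bilinear_mult] Ck_on_const[OF o] Suc
          Ck_on_bounded_linear[OF o bounded_linear_minus[OF bounded_linear_ident]])
  qed
qed

lemma Ck_on_sqrt: "Ck_on k {0<..} sqrt"
proof (induction k)
  case 0
  then show ?case by (auto intro: continuous_intros)
next
  case (Suc k)
  have d: "(sqrt has_derivative (\<lambda>v. v * inverse (2 * sqrt x))) (at x)" if "x \<in> {0<..}" for x
    using DERIV_real_sqrt[of x] that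
    by (auto simp: has_field_derivative_def divide_simps mult.commute[of "inverse _"]
       elim!: back_subst[of "\<lambda>z. (sqrt has_derivative z) (at x)"])
  have "Ck_on k {0<..} (\<lambda>x. inverse (2 * sqrt x))"
    by (rule Ck_on_compose[OF _ _ _ Ck_on_inverse])
      (auto intro!: open_Collect_neq continuous_intros Ck_on_bilinear[OF _ bounded_bilinear_mult]
        Ck_on_const Suc)
  then show ?case
    by (intro Ck_on_Suc_intro[OF _ d] Ck_on_bilinear[OF _ bounded_bilinear_mult]) (auto intro: Ck_on_const)
qed

text \<open>Differentiating \<open>f (g s) = s\<close> gives \<open>g' = 1 / f' \<circ> g\<close>, so each order of smoothness of \<open>g\<close>
  yields the next one.\<close>

lemma Ck_on_inverse_function:
  fixes f g :: "real \<Rightarrow> real"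
  assumes S: "open S" and T: "open T" and gT: "g ` T \<subseteq> S" and cont: "continuous_on T g"
    and f: "\<And>x. x \<in> S \<Longrightarrow> (f has_real_derivative f' x) (at x)" "\<And>x. x \<in> S \<Longrightarrow> f' x \<noteq> 0"
    and f': "\<And>k. Ck_on k S f'"
    and inv: "\<And>s. s \<in> T \<Longrightarrow> f (g s) = s"
  shows "\<And>s. s \<in> T \<Longrightarrow> (g has_real_derivative inverse (f' (g s))) (at s)" "Ck_on k T g"
proof -
  have d: "(g has_real_derivative inverse (f' (g s))) (at s)" if s: "s \<in> T" for s
  proof -
    obtain \<epsilon> where e: "\<epsilon> > 0" "{s-\<epsilon><..<s+\<epsilon>} \<subseteq> T"
      using openE[OF T s] by (metis ball_eq_greaterThanLessThan)
    show ?thesis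
      proof (rule DERIV_inverse_function[where f = f and D = "f' (g s)" and a = "s-\<epsilon>" and b = "s+\<epsilon>"])
      show "f (g y) = y" if "s - \<epsilon> < y" "y < s + \<epsilon>" for y
        using e that by (intro inv) auto
      show "isCont g s" using cont T s by (simp add: continuous_on_eq_continuous_at)
    qed (use e s f gT in auto)
  qed
  then show "\<And>s. s \<in> T \<Longrightarrow> (g has_real_derivative inverse (f' (g s))) (at s)" .
  show "Ck_on k T g"
  proof (induction k)
    case 0
    then show ?case using cont by simp
  next
    case (Suc k)
    have "Ck_on k T (\<lambda>s. f' (g s))"
      by (rule Ck_on_compose[OF T S gT f' Suc])
    then have "Ck_on k T (\<lambda>s. inverse (f' (g s)))"
      by (rule Ck_on_compose[OF T _ _ Ck_on_inverse, rotated -1])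
        (use f gT in \<open>auto intro!: open_Collect_neq continuous_intros\<close>)
    then show ?case
      by (intro Ck_on_Suc_intro[OF T d[unfolded has_field_derivative_def] ]
          Ck_on_bilinear[OF T bounded_bilinear_mult] Ck_on_const[OF T])
  qed
qed

lemma smooth_on_cong:
  "open S \<Longrightarrow> (\<And>x. x \<in> S \<Longrightarrow> f x = g x) \<Longrightarrow> smooth_on S f \<Longrightarrow> smooth_on S g"
  using Ck_on_cong[of S f g] by (auto simp: smooth_on_def)

lemma smooth_on_subset: "smooth_on S f \<Longrightarrow> T \<subseteq> S \<Longrightarrow> smooth_on T f"
  by (auto simp: smooth_on_def intro: Ck_on_subset)

lemma smooth_on_frechet:
  "smooth_on S f \<Longrightarrow> smooth_on S (\<lambda>x. frechet_derivative f (at x) v)"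
  by (metis Ck_on.simps(2) smooth_on_def)

lemma smooth_on_differentiable: "smooth_on S f \<Longrightarrow> x \<in> S \<Longrightarrow> f differentiable (at x)"
  by (metis Ck_on.simps(2) smooth_on_def)

lemma smooth_on_has_derivative:
  "smooth_on S f \<Longrightarrow> x \<in> S \<Longrightarrow> (f has_derivative frechet_derivative f (at x)) (at x)"
  using smooth_on_differentiable frechet_derivative_works by blast

lemma smooth_on_continuous: "smooth_on S f \<Longrightarrow> continuous_on S f"
  using Ck_on_imp_continuous smooth_on_def by blast

lemma smooth_on_const: "open S \<Longrightarrow> smooth_on S (\<lambda>x. c)"
  by (auto simp: smooth_on_def intro: Ck_on_const)

lemma smooth_on_linear: "open S \<Longrightarrow> bounded_linear L \<Longrightarrow> smooth_on S L"
  by (auto simp: smooth_on_def intro: Ck_on_linear)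

lemma smooth_on_bounded_linear:
  "open S \<Longrightarrow> bounded_linear L \<Longrightarrow> smooth_on S f \<Longrightarrow> smooth_on S (\<lambda>x. L (f x))"
  by (auto simp: smooth_on_def intro: Ck_on_bounded_linear)

lemma smooth_on_add:
  "open S \<Longrightarrow> smooth_on S f \<Longrightarrow> smooth_on S g \<Longrightarrow> smooth_on S (\<lambda>x. f x + g x)"
  by (auto simp: smooth_on_def intro: Ck_on_add)

lemma smooth_on_sum:
  "open S \<Longrightarrow> (\<And>i. i \<in> I \<Longrightarrow> smooth_on S (f i)) \<Longrightarrow> smooth_on S (\<lambda>x. \<Sum>i\<in>I. f i x)"
  by (auto simp: smooth_on_def intro: Ck_on_sum)

lemma smooth_on_bilinear:
  "open S \<Longrightarrow> bounded_bilinear mul \<Longrightarrow> smooth_on S f \<Longrightarrow> smooth_on S g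
    \<Longrightarrow> smooth_on S (\<lambda>x. mul (f x) (g x))"
  by (auto simp: smooth_on_def intro: Ck_on_bilinear)

lemmas smooth_on_mult = smooth_on_bilinear[OF _ bounded_bilinear_mult]
lemmas smooth_on_scaleR = smooth_on_bilinear[OF _ bounded_bilinear_scaleR]

lemma smooth_on_minus:
  assumes "open S" "smooth_on S f" "smooth_on S g" shows "smooth_on S (\<lambda>x. f x - g x)"
  using smooth_on_add[OF assms(1,2) smooth_on_bounded_linear[OF assms(1)
        bounded_linear_minus[OF bounded_linear_ident] assms(3)]] by simp

lemma smooth_on_compose:
  fixes f :: "'a::real_normed_vector \<Rightarrow> 'b::euclidean_space"
  shows "open S \<Longrightarrow> open T \<Longrightarrow> f ` S \<subseteq> T \<Longrightarrow> smooth_on T g \<Longrightarrow> smooth_on S f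
    \<Longrightarrow> smooth_on S (\<lambda>x. g (f x))"
  by (auto simp: smooth_on_def intro: Ck_on_compose)

lemma smooth_on_inverse:
  fixes f :: "'a::real_normed_vector \<Rightarrow> real"
  assumes "open S" "smooth_on S f" "\<And>x. x \<in> S \<Longrightarrow> f x \<noteq> 0"
  shows "smooth_on S (\<lambda>x. inverse (f x))"
  by (rule smooth_on_compose[of S "{x. x \<noteq> 0}"])
    (use assms in \<open>auto simp: smooth_on_def Ck_on_inverse intro!: open_Collect_neq continuous_intros\<close>)

lemma smooth_on_sqrt:
  fixes f :: "'a::real_normed_vector \<Rightarrow> real"
  assumes "open S" "smooth_on S f" "\<And>x. x \<in> S \<Longrightarrow> f x > 0"
  shows "smooth_on S (\<lambda>x. sqrt (f x))"
  by (rule smooth_on_compose[of S "{0<..}"])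
    (use assms in \<open>auto simp: smooth_on_def Ck_on_sqrt\<close>)

text \<open>Maps \<open>L y v\<close> that are linear in \<open>v\<close> are determined by their values at a basis, so that
  (partial) smoothness in \<open>y\<close> for constant \<open>v\<close> is enough to differentiate in both variables.\<close>

lemma has_derivative_linear_family:
  fixes L :: "'a::real_normed_vector \<Rightarrow> 'e::euclidean_space \<Rightarrow> 'b::real_normed_vector"
    and p :: "'c::real_normed_vector \<Rightarrow> 'a"
  assumes S: "open S" "p z \<in> S" and lin: "\<And>y. y \<in> S \<Longrightarrow> linear (L y)"
    and d: "\<And>b. (\<lambda>y. L y b) differentiable (at (p z))"
    and p: "(p has_derivative p') (at z)" and w: "(w has_derivative w') (at z)"
  shows "((\<lambda>z. L (p z) (w z)) has_derivative
    (\<lambda>h. frechet_derivative (\<lambda>y. L y (w z)) (at (p z)) (p' h) + L (p z) (w' h))) (at z)"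
proof -
  let ?D = "\<lambda>b. frechet_derivative (\<lambda>y. L y b) (at (p z))"
  have db: "((\<lambda>y. L y b) has_derivative ?D b) (at (p z))" for b
    using d frechet_derivative_works by blast
  have "((\<lambda>y. \<Sum>i\<in>Basis. (w z \<bullet> i) *\<^sub>R L y i) has_derivative
      (\<lambda>h. \<Sum>i\<in>Basis. (w z \<bullet> i) *\<^sub>R ?D i h)) (at (p z))"
    by (intro has_derivative_sum has_derivative_scaleR_right db)
  then have "((\<lambda>y. L y (w z)) has_derivative (\<lambda>h. \<Sum>i\<in>Basis. (w z \<bullet> i) *\<^sub>R ?D i h)) (at (p z))"
    by (rule has_derivative_transform_within_open[OF _ S])
      (rule linear_sum_Basis[OF lin, symmetric])
  from frechet_derivative_at[OF this]
  have Dw: "?D (w z) h = (\<Sum>i\<in>Basis. (w z \<bullet> i) *\<^sub>R ?D i h)" for h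
    by (rule fun_cong[OF sym])
  have c: "((\<lambda>z. L (p z) i) has_derivative (\<lambda>h. ?D i (p' h))) (at z)" for i
    by (rule has_derivative_compose[OF p db])
  have s: "((\<lambda>z. \<Sum>i\<in>Basis. (w z \<bullet> i) *\<^sub>R L (p z) i) has_derivative
    (\<lambda>h. \<Sum>i\<in>Basis. (w z \<bullet> i) *\<^sub>R ?D i (p' h) + (w' h \<bullet> i) *\<^sub>R L (p z) i)) (at z)"
    by (intro has_derivative_sum has_derivative_scaleR c has_derivative_inner_left w)
  have pS: "\<exists>U. open U \<and> z \<in> U \<and> (\<forall>y\<in>U. p y \<in> S)"
  proof -
    have "isCont p z" using has_derivative_continuous[OF p] by simp
    then have "eventually (\<lambda>y. p y \<in> S) (nhds z)"
      using S unfolding isCont_def tendsto_at_iff_tendsto_nhds by (rule_tac topological_tendstoD)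
    then show ?thesis by (auto simp: eventually_nhds)
  qed
  then obtain U where U: "open U" "z \<in> U" "\<And>y. y \<in> U \<Longrightarrow> p y \<in> S" by blast
  have s2: "((\<lambda>z. L (p z) (w z)) has_derivative
    (\<lambda>h. \<Sum>i\<in>Basis. (w z \<bullet> i) *\<^sub>R ?D i (p' h) + (w' h \<bullet> i) *\<^sub>R L (p z) i)) (at z)"
    by (rule has_derivative_transform_within_open[OF s U(1,2)])
      (rule linear_sum_Basis[OF lin[OF U(3)], symmetric])
  have Lw: "(\<Sum>i\<in>Basis. (w' h \<bullet> i) *\<^sub>R L (p z) i) = L (p z) (w' h)" for h
    by (rule linear_sum_Basis[OF lin[OF S(2)], symmetric])
  show ?thesis using s2 unfolding Dw sum.distrib Lw .
qed

lemma has_derivative_bilinear_family: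
  fixes B :: "'a::real_normed_vector \<Rightarrow> 'e::euclidean_space \<Rightarrow> 'f::euclidean_space \<Rightarrow> 'b::real_normed_vector"
    and p :: "'c::real_normed_vector \<Rightarrow> 'a"
  assumes S: "open S" "p z \<in> S" and lin: "\<And>y. y \<in> S \<Longrightarrow> bilinear (B y)"
    and d: "\<And>a b. (\<lambda>y. B y a b) differentiable (at (p z))"
    and p: "(p has_derivative p') (at z)" and v: "(v has_derivative v') (at z)"
    and w: "(w has_derivative w') (at z)"
  shows "((\<lambda>z. B (p z) (v z) (w z)) has_derivative
    (\<lambda>h. frechet_derivative (\<lambda>y. B y (v z) (w z)) (at (p z)) (p' h)
       + B (p z) (v' h) (w z) + B (p z) (v z) (w' h))) (at z)"
proof -
  have l1: "linear (B y a)" and l2: "linear (\<lambda>a. B y a b)" if "y \<in> S" for y a b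
    using lin[OF that] by (auto simp: bilinear_def)
  define q where "q = (\<lambda>z. (p z, v z))"
  define L where "L = (\<lambda>(y, a) b. B y a b)"
  define q' where "q' = (\<lambda>h. (p' h, v' h))"
  have q: "(q has_derivative q') (at z)"
    unfolding q_def q'_def by (intro has_derivative_Pair p v)
  have dq: "((\<lambda>y. L y b) has_derivative
      (\<lambda>h. frechet_derivative (\<lambda>y. B y (v z) b) (at (p z)) (fst h) + B (p z) (snd h) b)) (at (q z))" for b
  proof -
    have "((\<lambda>y. B (fst y) (snd y) b) has_derivative
      (\<lambda>h. frechet_derivative (\<lambda>y. B y (snd (q z)) b) (at (fst (q z))) (fst h)
        + B (fst (q z)) (snd h) b)) (at (q z))"
    proof (rule has_derivative_linear_family[of S fst "q z" "\<lambda>y a. B y a b" fst snd snd])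
      show "fst (q z) \<in> S" using S by (simp add: q_def)
      show "(\<lambda>y. B y a b) differentiable at (fst (q z))" for a using d by (simp add: q_def)
    qed (rule S l2 bounded_linear_imp_has_derivative bounded_linear_fst bounded_linear_snd | assumption)+
    then show ?thesis by (simp add: L_def q_def case_prod_unfold)
  qed
  have "((\<lambda>z. L (q z) (w z)) has_derivative
      (\<lambda>h. frechet_derivative (\<lambda>y. L y (w z)) (at (q z)) (q' h) + L (q z) (w' h))) (at z)"
  proof (rule has_derivative_linear_family[of "S \<times> UNIV"])
    show "linear (L y)" if "y \<in> S \<times> UNIV" for y using that l1 by (auto simp: L_def)
    show "(\<lambda>y. L y b) differentiable at (q z)" for b using dq unfolding differentiable_def by blast
    show "q z \<in> S \<times> UNIV" using S by (simp add: q_def)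
  qed (use S in \<open>simp add: open_Times\<close>, rule q, rule w)
  then show ?thesis
    unfolding frechet_derivative_at[OF dq, symmetric] by (simp add: L_def q_def q'_def)
qed

lemma smooth_on_linear_family:
  fixes L :: "'a::euclidean_space \<Rightarrow> 'e::euclidean_space \<Rightarrow> 'b::real_normed_vector"
    and p :: "'c::real_normed_vector \<Rightarrow> 'a"
  assumes S: "open S" "p ` U \<subseteq> S" "open U" and lin: "\<And>y. y \<in> S \<Longrightarrow> linear (L y)"
    and d: "\<And>b. smooth_on S (\<lambda>y. L y b)"
    and p: "smooth_on U p" and w: "smooth_on U w"
  shows "smooth_on U (\<lambda>z. L (p z) (w z))"
proof (rule smooth_on_cong[OF S(3)])
  show "smooth_on U (\<lambda>z. \<Sum>i\<in>Basis. (w z \<bullet> i) *\<^sub>R L (p z) i)"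
    by (intro smooth_on_sum smooth_on_scaleR S smooth_on_bounded_linear[OF S(3) bounded_linear_inner_left]
        w smooth_on_compose[OF S(3,1,2) d p])
  show "(\<Sum>i\<in>Basis. (w z \<bullet> i) *\<^sub>R L (p z) i) = L (p z) (w z)" if "z \<in> U" for z
    by (rule linear_sum_Basis[symmetric, OF lin]) (use that S in auto)
qed

lemma smooth_on_bilinear_family:
  fixes B :: "'a::euclidean_space \<Rightarrow> 'e::euclidean_space \<Rightarrow> 'f::euclidean_space \<Rightarrow> 'b::real_normed_vector"
    and p :: "'c::real_normed_vector \<Rightarrow> 'a"
  assumes S: "open S" "p ` U \<subseteq> S" "open U" and lin: "\<And>y. y \<in> S \<Longrightarrow> bilinear (B y)"
    and d: "\<And>a b. smooth_on S (\<lambda>y. B y a b)"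
    and p: "smooth_on U p" and v: "smooth_on U v" and w: "smooth_on U w"
  shows "smooth_on U (\<lambda>z. B (p z) (v z) (w z))"
proof (rule smooth_on_cong[OF S(3)])
  have l1: "linear (B y a)" and l2: "linear (\<lambda>a. B y a b)" if "y \<in> S" for y a b
    using lin[OF that] by (auto simp: bilinear_def)
  show "smooth_on U (\<lambda>z. \<Sum>i\<in>Basis. (v z \<bullet> i) *\<^sub>R B (p z) i (w z))"
    by (intro smooth_on_sum smooth_on_scaleR S smooth_on_bounded_linear[OF S(3) bounded_linear_inner_left]
        v smooth_on_linear_family[OF S, of "\<lambda>y. B y i" for i] l1 d p w)
  show "(\<Sum>i\<in>Basis. (v z \<bullet> i) *\<^sub>R B (p z) i (w z)) = B (p z) (v z) (w z)" if "z \<in> U" for z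
    by (rule linear_sum_Basis[symmetric, OF l2]) (use that S in auto)
qed


section \<open>Symmetry of second derivatives\<close>

lemma linear_frechet_family:
  fixes L :: "'a::real_normed_vector \<Rightarrow> 'e::real_vector \<Rightarrow> 'b::real_normed_vector"
  assumes S: "open S" "x \<in> S" and lin: "\<And>y. y \<in> S \<Longrightarrow> linear (L y)"
    and d: "\<And>b. (\<lambda>y. L y b) differentiable (at x)"
  shows "linear (\<lambda>b. frechet_derivative (\<lambda>y. L y b) (at x) h)"
proof (rule linearI)
  have der: "((\<lambda>y. L y b) has_derivative frechet_derivative (\<lambda>y. L y b) (at x)) (at x)" for b
    using d frechet_derivative_works by blast
  fix b c r
  have "((\<lambda>y. L y (b + c)) has_derivative
      (\<lambda>h. frechet_derivative (\<lambda>y. L y b) (at x) h + frechet_derivative (\<lambda>y. L y c) (at x) h)) (at x)"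
    by (rule has_derivative_transform_within_open[OF has_derivative_add[OF der der] S])
      (simp add: linear_add[OF lin])
  from fun_cong[OF frechet_derivative_at[OF this], of h]
  show "frechet_derivative (\<lambda>y. L y (b + c)) (at x) h =
    frechet_derivative (\<lambda>y. L y b) (at x) h + frechet_derivative (\<lambda>y. L y c) (at x) h" by simp
  have "((\<lambda>y. L y (r *\<^sub>R b)) has_derivative (\<lambda>h. r *\<^sub>R frechet_derivative (\<lambda>y. L y b) (at x) h)) (at x)"
    by (rule has_derivative_transform_within_open[OF has_derivative_scaleR_right[OF der] S])
      (simp add: linear_cmul[OF lin])
  from fun_cong[OF frechet_derivative_at[OF this], of h]
  show "frechet_derivative (\<lambda>y. L y (r *\<^sub>R b)) (at x) h = r *\<^sub>R frechet_derivative (\<lambda>y. L y b) (at x) h"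
    by simp
qed

text \<open>The second difference on the left is symmetric in \<open>u\<close> and \<open>v\<close>, so it computes both mixed
  derivatives in the limit \<open>s \<rightarrow> 0\<close>.\<close>

lemma second_difference_mean_value:
  fixes f :: "'a::real_normed_vector \<Rightarrow> real"
  assumes f: "smooth_on S f" and s: "s > 0"
    and sub: "\<And>a b. 0 \<le> a \<Longrightarrow> a \<le> s \<Longrightarrow> 0 \<le> b \<Longrightarrow> b \<le> s \<Longrightarrow> x + a *\<^sub>R u + b *\<^sub>R v \<in> S"
  obtains a b where "0 < a" "a < s" "0 < b" "b < s"
    "f (x + s *\<^sub>R u + s *\<^sub>R v) - f (x + s *\<^sub>R u) - f (x + s *\<^sub>R v) + f x =
     s^2 * frechet_derivative (\<lambda>y. frechet_derivative f (at y) u) (at (x + a *\<^sub>R u + b *\<^sub>R v)) v"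
proof -
  have du: "((\<lambda>a. h (x + a *\<^sub>R u + b *\<^sub>R v)) has_real_derivative
      frechet_derivative h (at (x + a *\<^sub>R u + b *\<^sub>R v)) u) (at a)"
    and dv: "((\<lambda>b. h (x + a *\<^sub>R u + b *\<^sub>R v)) has_real_derivative
      frechet_derivative h (at (x + a *\<^sub>R u + b *\<^sub>R v)) v) (at b)"
    if "0 \<le> a" "a \<le> s" "0 \<le> b" "b \<le> s" "smooth_on S h" for a b and h :: "'a \<Rightarrow> real"
  proof -
    let ?p = "x + a *\<^sub>R u + b *\<^sub>R v"
    have h: "(h has_derivative frechet_derivative h (at ?p)) (at ?p)"
      using smooth_on_has_derivative[OF that(5)] sub that by blast
    note sc = linear_cmul[OF has_derivative_linear[OF h]]
    have "((\<lambda>a. x + a *\<^sub>R u + b *\<^sub>R v) has_derivative (\<lambda>r. r *\<^sub>R u)) (at a)"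
      by (auto intro!: derivative_eq_intros)
    from has_derivative_compose[OF this h]
    show "((\<lambda>a. h (x + a *\<^sub>R u + b *\<^sub>R v)) has_real_derivative frechet_derivative h (at ?p) u) (at a)"
      by (simp add: has_field_derivative_def sc mult_commute_abs)
    have "((\<lambda>b. x + a *\<^sub>R u + b *\<^sub>R v) has_derivative (\<lambda>r. r *\<^sub>R v)) (at b)"
      by (auto intro!: derivative_eq_intros)
    from has_derivative_compose[OF this h]
    show "((\<lambda>b. h (x + a *\<^sub>R u + b *\<^sub>R v)) has_real_derivative frechet_derivative h (at ?p) v) (at b)"
      by (simp add: has_field_derivative_def sc mult_commute_abs)
  qed
  let ?\<phi> = "\<lambda>a. f (x + a *\<^sub>R u + s *\<^sub>R v) - f (x + a *\<^sub>R u + 0 *\<^sub>R v)"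
  let ?fu = "\<lambda>y. frechet_derivative f (at y) u"
  have "\<exists>a>0. a < s \<and> ?\<phi> s - ?\<phi> 0 =
      (s - 0) * (?fu (x + a *\<^sub>R u + s *\<^sub>R v) - ?fu (x + a *\<^sub>R u + 0 *\<^sub>R v))"
    using s f by (intro MVT2 DERIV_diff du) auto
  then obtain a where a: "0 < a" "a < s"
    and A: "?\<phi> s - ?\<phi> 0 = s * (?fu (x + a *\<^sub>R u + s *\<^sub>R v) - ?fu (x + a *\<^sub>R u + 0 *\<^sub>R v))"
    by auto
  have "\<exists>b>0. b < s \<and> ?fu (x + a *\<^sub>R u + s *\<^sub>R v) - ?fu (x + a *\<^sub>R u + 0 *\<^sub>R v) =
      (s - 0) * frechet_derivative ?fu (at (x + a *\<^sub>R u + b *\<^sub>R v)) v"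
    using s a f by (intro MVT2 dv smooth_on_frechet) auto
  then obtain b where "0 < b" "b < s"
    and "?fu (x + a *\<^sub>R u + s *\<^sub>R v) - ?fu (x + a *\<^sub>R u + 0 *\<^sub>R v) =
      s * frechet_derivative ?fu (at (x + a *\<^sub>R u + b *\<^sub>R v)) v"
    by auto
  with a A that[of a b] show ?thesis
    by (simp add: power2_eq_square algebra_simps)
qed

lemma frechet_derivative_commute_real:
  fixes f :: "'a::real_normed_vector \<Rightarrow> real"
  assumes S: "open S" "x \<in> S" and f: "smooth_on S f"
  shows "frechet_derivative (\<lambda>y. frechet_derivative f (at y) u) (at x) v =
    frechet_derivative (\<lambda>y. frechet_derivative f (at y) v) (at x) u"
proof -
  let ?uv = "\<lambda>x. frechet_derivative (\<lambda>y. frechet_derivative f (at y) u) (at x) v"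
  let ?vu = "\<lambda>x. frechet_derivative (\<lambda>y. frechet_derivative f (at y) v) (at x) u"
  have c: "continuous_on S ?uv" "continuous_on S ?vu"
    by (intro smooth_on_continuous smooth_on_frechet f)+
  have "\<bar>?uv x - ?vu x\<bar> < e" if e: "e > 0" for e
  proof -
    obtain d1 where d1: "d1 > 0" "\<And>y. y \<in> S \<Longrightarrow> dist y x < d1 \<Longrightarrow> dist (?uv y) (?uv x) < e/2"
      using c(1) S(2) e unfolding continuous_on_iff by (meson half_gt_zero)
    obtain d2 where d2: "d2 > 0" "\<And>y. y \<in> S \<Longrightarrow> dist y x < d2 \<Longrightarrow> dist (?vu y) (?vu x) < e/2"
      using c(2) S(2) e unfolding continuous_on_iff by (meson half_gt_zero)
    obtain d3 where d3: "d3 > 0" "ball x d3 \<subseteq> S" using S openE by blast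
    define d where "d = min d1 (min d2 d3)"
    define s where "s = d / (2 * (norm u + norm v + 1))"
    have d: "d > 0" using d1 d2 d3 by (simp add: d_def)
    have pos: "norm u + norm v + 1 > 0" by (smt (verit) norm_ge_zero)
    then have s: "s > 0" using d by (simp add: s_def)
    have near: "dist (x + a *\<^sub>R u + b *\<^sub>R v) x < d"
      if "0 \<le> a" "a \<le> s" "0 \<le> b" "b \<le> s" for a b
    proof -
      have "norm (a *\<^sub>R u + b *\<^sub>R v) \<le> a * norm u + b * norm v"
        using norm_triangle_ineq[of "a *\<^sub>R u" "b *\<^sub>R v"] that by simp
      also have "\<dots> \<le> s * norm u + s * norm v"
        using that by (intro add_mono mult_right_mono) auto
      also have "\<dots> \<le> s * (norm u + norm v + 1)" using s by (simp add: algebra_simps)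
      also have "\<dots> = d / 2" using pos unfolding s_def by (simp add: field_simps)
      finally show ?thesis using d by (simp add: dist_norm add.assoc)
    qed
    have sub: "x + a *\<^sub>R u + b *\<^sub>R v \<in> S" if "0 \<le> a" "a \<le> s" "0 \<le> b" "b \<le> s" for a b
      using near[OF that] d3(2) by (auto simp: d_def dist_commute)
    obtain a b where ab: "0 < a" "a < s" "0 < b" "b < s"
      "f (x + s *\<^sub>R u + s *\<^sub>R v) - f (x + s *\<^sub>R u) - f (x + s *\<^sub>R v) + f x = s^2 * ?uv (x + a *\<^sub>R u + b *\<^sub>R v)"
      by (rule second_difference_mean_value[OF f s, of x u v]) (use sub in blast)+
    have sub': "x + a *\<^sub>R v + b *\<^sub>R u \<in> S" if "0 \<le> a" "a \<le> s" "0 \<le> b" "b \<le> s" for a b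
      using sub[of b a] that by (simp add: algebra_simps)
    obtain a' b' where ab': "0 < a'" "a' < s" "0 < b'" "b' < s"
      "f (x + s *\<^sub>R v + s *\<^sub>R u) - f (x + s *\<^sub>R v) - f (x + s *\<^sub>R u) + f x = s^2 * ?vu (x + a' *\<^sub>R v + b' *\<^sub>R u)"
      by (rule second_difference_mean_value[OF f s, of x v u]) (use sub' in blast)+
    have "s^2 * ?uv (x + a *\<^sub>R u + b *\<^sub>R v) = s^2 * ?vu (x + b' *\<^sub>R u + a' *\<^sub>R v)"
      using ab(5) ab'(5) by (simp add: algebra_simps)
    then have eq: "?uv (x + a *\<^sub>R u + b *\<^sub>R v) = ?vu (x + b' *\<^sub>R u + a' *\<^sub>R v)" using s by simp
    have "dist (?uv (x + a *\<^sub>R u + b *\<^sub>R v)) (?uv x) < e/2"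
      using near[of a b] ab by (intro d1(2) sub) (auto simp: d_def)
    moreover have "dist (?vu (x + b' *\<^sub>R u + a' *\<^sub>R v)) (?vu x) < e/2"
      using near[of b' a'] ab' by (intro d2(2) sub) (auto simp: d_def)
    ultimately show ?thesis using eq unfolding dist_real_def by linarith
  qed
  from this[of "\<bar>?uv x - ?vu x\<bar>"] show ?thesis by fastforce
qed

lemma frechet_derivative_inner_left:
  "f differentiable (at x) \<Longrightarrow>
    frechet_derivative (\<lambda>y. f y \<bullet> i) (at x) v = frechet_derivative f (at x) v \<bullet> i"
  using frechet_derivative_at[OF has_derivative_inner_left[of f "frechet_derivative f (at x)" "at x" i]]
  by (simp add: frechet_derivative_works) (metis)

lemma frechet_derivative_commute:
  fixes f :: "'a::real_normed_vector \<Rightarrow> 'b::euclidean_space"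
  assumes S: "open S" "x \<in> S" and f: "smooth_on S f"
  shows "frechet_derivative (\<lambda>y. frechet_derivative f (at y) u) (at x) v =
    frechet_derivative (\<lambda>y. frechet_derivative f (at y) v) (at x) u"
proof (rule euclidean_eqI)
  fix i :: 'b assume "i \<in> Basis"
  have e: "frechet_derivative (\<lambda>y. frechet_derivative f (at y) a) (at x) b \<bullet> i =
      frechet_derivative (\<lambda>y. frechet_derivative (\<lambda>y. f y \<bullet> i) (at y) a) (at x) b" for a b
  proof -
    have "((\<lambda>y. frechet_derivative f (at y) a \<bullet> i) has_derivative
        (\<lambda>b. frechet_derivative (\<lambda>y. frechet_derivative f (at y) a) (at x) b \<bullet> i)) (at x)"
      by (intro has_derivative_inner_left smooth_on_has_derivative[OF _ S(2)] smooth_on_frechet f)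
    then have "((\<lambda>y. frechet_derivative (\<lambda>y. f y \<bullet> i) (at y) a) has_derivative
        (\<lambda>b. frechet_derivative (\<lambda>y. frechet_derivative f (at y) a) (at x) b \<bullet> i)) (at x)"
      by (rule has_derivative_transform_within_open[OF _ S])
        (simp add: frechet_derivative_inner_left smooth_on_differentiable[OF f])
    from frechet_derivative_at[OF this] show ?thesis by (rule fun_cong)
  qed
  show "frechet_derivative (\<lambda>y. frechet_derivative f (at y) u) (at x) v \<bullet> i =
    frechet_derivative (\<lambda>y. frechet_derivative f (at y) v) (at x) u \<bullet> i"
    unfolding e
    by (rule frechet_derivative_commute_real[OF S smooth_on_bounded_linear[OF S(1) bounded_linear_inner_left f]])
qed


section \<open>Metrics in coordinates\<close>

lemma posdef_representation:
  fixes B :: "'e::euclidean_space \<Rightarrow> 'e \<Rightarrow> real"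
  assumes B: "bilinear B" and pos: "\<And>u. u \<noteq> 0 \<Longrightarrow> B u u > 0" and \<phi>: "linear \<phi>"
  shows "\<exists>!z. \<forall>w. B z w = \<phi> w"
proof -
  have l1: "linear (B z)" and l2: "linear (\<lambda>z. B z w)" for z w using B by (auto simp: bilinear_def)
  define T where "T = (\<lambda>z. \<Sum>i\<in>Basis. B z i *\<^sub>R i)"
  have T: "linear T" unfolding T_def
    by (rule linearI) (auto simp: linear_add[OF l2] linear_cmul[OF l2] sum.distrib scaleR_add_left scaleR_sum_right)
  have Ti: "T z \<bullet> i = B z i" if "i \<in> Basis" for z i
    unfolding T_def using that by (rule inner_sum_left_Basis)
  have "inj T"
  proof (subst linear_injective_0[OF T], intro allI impI)
    fix z assume "T z = 0"
    then have "B z i = 0" if "i \<in> Basis" for i using Ti[OF that, of z] by simp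
    then have "B z z = 0" by (subst linear_sum_Basis[OF l1]) simp
    then show "z = 0" using pos by force
  qed
  then have "surj T" using T linear_injective_imp_surjective by blast
  then obtain z where z: "T z = (\<Sum>i\<in>Basis. \<phi> i *\<^sub>R i)" by (metis surjD)
  have "B z i = \<phi> i" if "i \<in> Basis" for i
    using Ti[OF that, of z] inner_sum_left_Basis[OF that, of \<phi>] z by simp
  then have "B z w = \<phi> w" for w
    by (subst linear_sum_Basis[OF l1], subst linear_sum_Basis[OF \<phi>]) simp
  moreover have "z' = z" if "\<forall>w. B z' w = \<phi> w" for z'
  proof -
    have "B (z' - z) (z' - z) = 0"
      using that \<open>\<And>w. B z w = \<phi> w\<close> by (simp add: linear_diff[OF l2])
    then show ?thesis using pos[of "z' - z"] by force
  qed
  ultimately show ?thesis by blast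
qed

text \<open>The Koszul formula determines the vector, so the description in the definition is a proper one.\<close>

lemma christoffel_koszul:
  fixes G :: "'e::euclidean_space \<Rightarrow> 'e \<Rightarrow> 'e \<Rightarrow> real"
  assumes S: "open S" "x \<in> S" and bil: "\<And>y. y \<in> S \<Longrightarrow> bilinear (G y)"
    and pos: "\<And>u. u \<noteq> 0 \<Longrightarrow> G x u u > 0"
    and d: "\<And>a b. (\<lambda>y. G y a b) differentiable (at x)"
  shows "G x (christoffel G x u v) w =
    (frechet_derivative (\<lambda>y. G y v w) (at x) u + frechet_derivative (\<lambda>y. G y u w) (at x) v -
     frechet_derivative (\<lambda>y. G y u v) (at x) w) / 2"
proof -
  have der: "((\<lambda>y. G y a b) has_derivative frechet_derivative (\<lambda>y. G y a b) (at x)) (at x)" for a b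
    using d frechet_derivative_works by blast
  have l1: "linear (G y a)" if "y \<in> S" for y a using bil[OF that] by (auto simp: bilinear_def)
  have lin: "linear (\<lambda>w. frechet_derivative (\<lambda>y. G y a w) (at x) b)" for a b
    by (rule linear_frechet_family[OF S l1 d])
  have "linear (\<lambda>w. (frechet_derivative (\<lambda>y. G y v w) (at x) u + frechet_derivative (\<lambda>y. G y u w) (at x) v -
     frechet_derivative (\<lambda>y. G y u v) (at x) w) / 2)" (is "linear ?\<phi>")
    using linear_add[OF lin] linear_cmul[OF lin] linear_add[OF has_derivative_linear[OF der]]
      linear_cmul[OF has_derivative_linear[OF der]]
    by (intro linearI) (auto simp: algebra_simps diff_divide_distrib add_divide_distrib)
  from theI'[OF posdef_representation[OF bil[OF S(2)] pos this]]
  show ?thesis unfolding christoffel_def by blast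
qed

locale metric_field =
  fixes D :: "'e::euclidean_space set" and G :: "'e \<Rightarrow> 'e \<Rightarrow> 'e \<Rightarrow> real"
  assumes open_D: "open D"
    and bil: "x \<in> D \<Longrightarrow> bilinear (G x)"
    and sym: "x \<in> D \<Longrightarrow> G x u v = G x v u"
    and pos: "x \<in> D \<Longrightarrow> u \<noteq> 0 \<Longrightarrow> G x u u > 0"
    and smooth: "smooth_on D (\<lambda>x. G x u v)"
begin

abbreviation \<Gamma> where "\<Gamma> \<equiv> christoffel G"

lemma lin1: "x \<in> D \<Longrightarrow> linear (G x u)" and lin2: "x \<in> D \<Longrightarrow> linear (\<lambda>u. G x u v)"
  using bil by (auto simp: bilinear_def)

lemma differentiable_G: "x \<in> D \<Longrightarrow> (\<lambda>y. G y u v) differentiable (at x)"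
  using smooth smooth_on_differentiable by blast

lemmas G_simps = linear_add[OF lin1] linear_cmul[OF lin1] linear_0[OF lin1] linear_diff[OF lin1]
  linear_neg[OF lin1] linear_add[OF lin2] linear_cmul[OF lin2] linear_0[OF lin2] linear_diff[OF lin2]
  linear_neg[OF lin2]

lemma G_eq_0: "x \<in> D \<Longrightarrow> G x u u = 0 \<longleftrightarrow> u = 0"
  using pos[of x u] by (force simp: G_simps)

lemma koszul:
  assumes "x \<in> D"
  shows "G x (\<Gamma> x u v) w =
    (frechet_derivative (\<lambda>y. G y v w) (at x) u + frechet_derivative (\<lambda>y. G y u w) (at x) v -
     frechet_derivative (\<lambda>y. G y u v) (at x) w) / 2"
  by (rule christoffel_koszul[OF open_D assms bil pos[OF assms] differentiable_G[OF assms]])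

lemma vector_eqI: "x \<in> D \<Longrightarrow> (\<And>w. G x a w = G x b w) \<Longrightarrow> a = b"
  using G_eq_0[of x "a - b"] by (simp add: G_simps)

lemma frechet_G_sym:
  "x \<in> D \<Longrightarrow> frechet_derivative (\<lambda>y. G y u v) (at x) w = frechet_derivative (\<lambda>y. G y v u) (at x) w"
  using frechet_derivative_transform_within_open[OF differentiable_G open_D, of x u v "\<lambda>y. G y v u"]
    sym by metis

lemma \<Gamma>_sym: "x \<in> D \<Longrightarrow> \<Gamma> x u v = \<Gamma> x v u"
  by (rule vector_eqI, assumption) (simp add: koszul frechet_G_sym[of x u v])

lemma compatible:
  assumes x: "x \<in> D"
  shows "frechet_derivative (\<lambda>y. G y v w) (at x) u = G x (\<Gamma> x u v) w + G x v (\<Gamma> x u w)"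
  using koszul[OF x, of u v w] koszul[OF x, of u w v] frechet_G_sym[OF x, of v w] sym[OF x]
    frechet_G_sym[OF x, of u w] frechet_G_sym[OF x, of u v]
  by (simp add: field_simps)

lemma bilinear_\<Gamma>:
  assumes x: "x \<in> D" shows "bilinear (\<Gamma> x)"
proof -
  have D: "linear (frechet_derivative (\<lambda>y. G y a b) (at x))" for a b
    by (rule has_derivative_linear[OF smooth_on_has_derivative[OF smooth x]])
  have L: "linear (\<lambda>b. frechet_derivative (\<lambda>y. G y a b) (at x) w)" for a w
    by (rule linear_frechet_family[OF open_D x lin1 differentiable_G[OF x]])
  have L': "linear (\<lambda>b. frechet_derivative (\<lambda>y. G y b a) (at x) w)" for a w
    unfolding frechet_G_sym[OF x, of _ a] by (rule L)
  have l: "linear (\<Gamma> x u)" for u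
    by (rule linearI; rule vector_eqI[OF x])
      (auto simp: G_simps x koszul linear_add[OF L] linear_cmul[OF L] linear_add[OF L'] linear_cmul[OF L']
        linear_add[OF D] linear_cmul[OF D] field_simps)
  then show ?thesis using \<Gamma>_sym[OF x] by (simp add: bilinear_def)
qed

lemma \<Gamma>_lin1: "x \<in> D \<Longrightarrow> linear (\<Gamma> x u)" and \<Gamma>_lin2: "x \<in> D \<Longrightarrow> linear (\<lambda>u. \<Gamma> x u v)"
  using bilinear_\<Gamma> by (auto simp: bilinear_def)

lemmas \<Gamma>_simps = linear_add[OF \<Gamma>_lin1] linear_cmul[OF \<Gamma>_lin1] linear_0[OF \<Gamma>_lin1] linear_diff[OF \<Gamma>_lin1]
  linear_neg[OF \<Gamma>_lin1] linear_add[OF \<Gamma>_lin2] linear_cmul[OF \<Gamma>_lin2] linear_0[OF \<Gamma>_lin2]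
  linear_diff[OF \<Gamma>_lin2] linear_neg[OF \<Gamma>_lin2]

text \<open>The product rule \<open>\<partial> \<langle>v, w\<rangle> = \<langle>\<nabla>v, w\<rangle> + \<langle>v, \<nabla>w\<rangle>\<close> for fields along a map \<open>p\<close>.\<close>

lemma has_derivative_G_along:
  fixes p v w :: "'c::real_normed_vector \<Rightarrow> 'e"
  assumes "p z \<in> D" "(p has_derivative p') (at z)" "(v has_derivative v') (at z)" "(w has_derivative w') (at z)"
  shows "((\<lambda>z. G (p z) (v z) (w z)) has_derivative
    (\<lambda>h. G (p z) (v' h + \<Gamma> (p z) (p' h) (v z)) (w z) + G (p z) (v z) (w' h + \<Gamma> (p z) (p' h) (w z)))) (at z)"
proof -
  have "frechet_derivative (\<lambda>y. G y (v z) (w z)) (at (p z)) (p' h) + G (p z) (v' h) (w z) + G (p z) (v z) (w' h)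
    = G (p z) (v' h + \<Gamma> (p z) (p' h) (v z)) (w z) + G (p z) (v z) (w' h + \<Gamma> (p z) (p' h) (w z))" for h
    unfolding compatible[OF assms(1)] G_simps[OF assms(1)] by simp
  then show ?thesis
    using has_derivative_bilinear_family[OF open_D assms(1) bil differentiable_G[OF assms(1)] assms(2-)]
    by simp
qed

text \<open>Differentiating \<open>\<langle>v, v\<rangle> = 1\<close> shows that the covariant derivative of a unit field is orthogonal to it.\<close>

lemma unit_field_parallel:
  fixes p v :: "'c::real_normed_vector \<Rightarrow> 'e"
  assumes S: "open S" "z \<in> S" and unit: "\<And>y. y \<in> S \<Longrightarrow> G (p y) (v y) (v y) = 1"
    and x: "p z \<in> D" and p: "(p has_derivative p') (at z)" and v: "(v has_derivative v') (at z)"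
    and r: "v' h + \<Gamma> (p z) (p' h) (v z) = r *\<^sub>R v z"
  shows "v' h + \<Gamma> (p z) (p' h) (v z) = 0"
proof -
  have "((\<lambda>z. G (p z) (v z) (v z)) has_derivative (\<lambda>h. 0)) (at z)"
    by (rule has_derivative_transform_within_open[OF has_derivative_const S]) (simp add: unit)
  from has_derivative_unique[OF has_derivative_G_along[OF x p v v] this]
  have "G (p z) (v' h + \<Gamma> (p z) (p' h) (v z)) (v z) + G (p z) (v z) (v' h + \<Gamma> (p z) (p' h) (v z)) = 0"
    by (rule fun_cong)
  then have "r = 0" unfolding r by (simp add: G_simps[OF x] unit[OF S(2)])
  then show ?thesis using r by simp
qed

end


section \<open>Metrics on surfaces\<close>

abbreviation e1 :: "real^2" where "e1 \<equiv> axis 1 1"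
abbreviation e2 :: "real^2" where "e2 \<equiv> axis 2 1"

definition area :: "real^2 \<Rightarrow> real^2 \<Rightarrow> real"
  where "area a b = a $ 1 * b $ 2 - a $ 2 * b $ 1"

lemma area_swap: "area a b = - area b a" by (simp add: area_def)

lemma vec2_expand: "v = v $ 1 *\<^sub>R e1 + v $ 2 *\<^sub>R e2" for v :: "real^2"
  by (simp add: vec_eq_iff forall_2 axis_def)

lemma alternating_bilinear_area:
  fixes B :: "real^2 \<Rightarrow> real^2 \<Rightarrow> real"
  assumes B: "bilinear B" and alt: "\<And>a. B a a = 0"
  shows "B a b = area a b * B e1 e2"
proof -
  note l = bilinear_ladd[OF B] bilinear_radd[OF B] bilinear_lmul[OF B] bilinear_rmul[OF B]
  have "B e2 e1 = - B e1 e2"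
  proof -
    have "B e1 e2 + B e2 e1 = (B e1 e1 + B e1 e2) + (B e2 e1 + B e2 e2)" by (simp add: alt)
    also have "\<dots> = B (e1 + e2) (e1 + e2)" by (simp only: l)
    finally show ?thesis using alt[of "e1 + e2"] by linarith
  qed
  then have "B (a$1 *\<^sub>R e1 + a$2 *\<^sub>R e2) (b$1 *\<^sub>R e1 + b$2 *\<^sub>R e2) = area a b * B e1 e2"
    by (simp add: l alt area_def algebra_simps)
  then show ?thesis using vec2_expand[of a] vec2_expand[of b] by simp
qed

lemma area_eq_0D:
  assumes "area a b = 0" "b \<noteq> 0"
  shows "a = ((a \<bullet> b) / (b \<bullet> b)) *\<^sub>R b"
proof -
  have e: "a $ 1 * b $ 2 = a $ 2 * b $ 1" using assms(1) by (simp add: area_def)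
  have ab: "a \<bullet> b = a$1 * b$1 + a$2 * b$2" "b \<bullet> b = b$1 * b$1 + b$2 * b$2"
    by (simp_all add: inner_vec_def sum_2)
  have "(b \<bullet> b) * a $ i = (a \<bullet> b) * b $ i" for i
    using e exhaust_2[of i] by (auto simp: ab algebra_simps)
  then have "(b \<bullet> b) *\<^sub>R a = (a \<bullet> b) *\<^sub>R b" by (simp add: vec_eq_iff)
  then have "a = (1 / (b \<bullet> b)) *\<^sub>R ((a \<bullet> b) *\<^sub>R b)"
    using assms(2) by (simp add: eq_vector_fraction_iff)
  then show ?thesis by simp
qed

locale surface_metric = metric_field D G for D :: "(real^2) set" and G
begin

lemma gram_pos: "x \<in> D \<Longrightarrow> G x e1 e1 * G x e2 e2 - (G x e1 e2)^2 > 0"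
proof -
  assume x: "x \<in> D"
  let ?w = "G x e2 e2 *\<^sub>R e1 - G x e1 e2 *\<^sub>R e2"
  have p: "G x e2 e2 > 0" by (rule pos[OF x]) (simp add: axis_eq_0_iff)
  have "?w $ 1 \<noteq> 0" using p by (simp add: axis_def)
  then have "?w \<noteq> 0" by (metis zero_index)
  then have "0 < G x ?w ?w" by (rule pos[OF x])
  also have "G x ?w ?w = G x e2 e2 * (G x e1 e1 * G x e2 e2 - (G x e1 e2)^2)"
    by (simp add: G_simps[OF x] sym[OF x, of e2 e1] power2_eq_square algebra_simps)
  finally show ?thesis using p by (simp add: zero_less_mult_iff)
qed

text \<open>Cramer's rule expresses the Christoffel symbols as rational functions of the metric and its
  derivatives.\<close>

lemma smooth_\<Gamma>: "smooth_on D (\<lambda>x. \<Gamma> x u v)"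
proof -
  have k: "smooth_on D (\<lambda>x. G x (\<Gamma> x u v) w)" for w
  proof (rule smooth_on_cong[OF open_D])
    show "smooth_on D (\<lambda>x. (1/2) * (frechet_derivative (\<lambda>y. G y v w) (at x) u +
      frechet_derivative (\<lambda>y. G y u w) (at x) v - frechet_derivative (\<lambda>y. G y u v) (at x) w))"
      by (intro smooth_on_mult smooth_on_const smooth_on_minus smooth_on_add smooth_on_frechet smooth open_D)
  qed (simp add: koszul)
  let ?d = "\<lambda>x. G x e1 e1 * G x e2 e2 - G x e1 e2 * G x e1 e2"
  let ?p = "\<lambda>x. G x (\<Gamma> x u v) e1" and ?q = "\<lambda>x. G x (\<Gamma> x u v) e2"
  have d0: "?d x \<noteq> 0" if "x \<in> D" for x using gram_pos[OF that] by (simp add: power2_eq_square)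
  show ?thesis
  proof (rule smooth_on_cong[OF open_D])
    show "smooth_on D (\<lambda>x. inverse (?d x) *\<^sub>R ((?p x * G x e2 e2 - ?q x * G x e1 e2) *\<^sub>R e1
        + (?q x * G x e1 e1 - ?p x * G x e1 e2) *\<^sub>R e2))"
      by (intro smooth_on_scaleR smooth_on_inverse smooth_on_minus smooth_on_add smooth_on_mult
          smooth k smooth_on_const open_D d0)
    fix x assume x: "x \<in> D"
    let ?z = "\<Gamma> x u v"
    have "?p x = G x (?z$1 *\<^sub>R e1 + ?z$2 *\<^sub>R e2) e1" "?q x = G x (?z$1 *\<^sub>R e1 + ?z$2 *\<^sub>R e2) e2"
      using vec2_expand[of ?z] by simp_all
    then have p: "?p x = ?z$1 * G x e1 e1 + ?z$2 * G x e1 e2" and q: "?q x = ?z$1 * G x e1 e2 + ?z$2 * G x e2 e2"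
      by (simp_all add: G_simps[OF x] sym[OF x, of e2 e1])
    have "(?p x * G x e2 e2 - ?q x * G x e1 e2) *\<^sub>R e1 + (?q x * G x e1 e1 - ?p x * G x e1 e2) *\<^sub>R e2
      = (?d x * ?z$1) *\<^sub>R e1 + (?d x * ?z$2) *\<^sub>R e2"
      unfolding p q by (simp add: algebra_simps)
    also have "\<dots> = ?d x *\<^sub>R (?z$1 *\<^sub>R e1 + ?z$2 *\<^sub>R e2)" by (simp add: scaleR_add_right)
    also have "\<dots> = ?d x *\<^sub>R ?z" using vec2_expand[of ?z] by simp
    finally show "inverse (?d x) *\<^sub>R ((?p x * G x e2 e2 - ?q x * G x e1 e2) *\<^sub>R e1
        + (?q x * G x e1 e1 - ?p x * G x e1 e2) *\<^sub>R e2) = ?z"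
      using d0[OF x] by simp
  qed
qed

lemma differentiable_\<Gamma>: "x \<in> D \<Longrightarrow> (\<lambda>y. \<Gamma> y u v) differentiable (at x)"
  using smooth_\<Gamma> smooth_on_differentiable by blast

abbreviation d\<Gamma> where "d\<Gamma> x h u v \<equiv> frechet_derivative (\<lambda>y. \<Gamma> y u v) (at x) h"
abbreviation R where "R \<equiv> curvature_tensor G"

lemma d\<Gamma>_sym: "x \<in> D \<Longrightarrow> d\<Gamma> x h u v = d\<Gamma> x h v u"
  using frechet_derivative_transform_within_open[OF differentiable_\<Gamma> open_D, of x u v "\<lambda>y. \<Gamma> y v u"]
    \<Gamma>_sym by metis

lemma d\<Gamma>_linear: "x \<in> D \<Longrightarrow> linear (\<lambda>h. d\<Gamma> x h u v)"
  using smooth_on_has_derivative[OF smooth_\<Gamma>] by (rule has_derivative_linear)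

lemma d\<Gamma>_lin1: "x \<in> D \<Longrightarrow> linear (\<lambda>v. d\<Gamma> x h u v)"
  using linear_frechet_family[OF open_D _ \<Gamma>_lin1 differentiable_\<Gamma>] by blast

lemma d\<Gamma>_lin2: "x \<in> D \<Longrightarrow> linear (\<lambda>u. d\<Gamma> x h u v)"
proof -
  assume x: "x \<in> D"
  have "(\<lambda>u. d\<Gamma> x h u v) = (\<lambda>u. d\<Gamma> x h v u)" by (rule ext) (rule d\<Gamma>_sym[OF x])
  then show ?thesis using d\<Gamma>_lin1[OF x] by simp
qed

lemmas d\<Gamma>_simps = linear_add[OF d\<Gamma>_linear] linear_cmul[OF d\<Gamma>_linear] linear_0[OF d\<Gamma>_linear]
  linear_add[OF d\<Gamma>_lin1] linear_cmul[OF d\<Gamma>_lin1] linear_0[OF d\<Gamma>_lin1]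
  linear_add[OF d\<Gamma>_lin2] linear_cmul[OF d\<Gamma>_lin2] linear_0[OF d\<Gamma>_lin2]

text \<open>Second derivatives of the function \<open>\<langle>w, w\<rangle>\<close> commute; by compatibility, their commutator is
  \<open>2 \<langle>R(a,b)w, w\<rangle>\<close>.\<close>

lemma curvature_skew:
  assumes x: "x \<in> D" shows "G x (R x a b w) w = 0"
proof -
  let ?f = "\<lambda>y. G y w w"
  have 2: "frechet_derivative (\<lambda>y. frechet_derivative ?f (at y) b) (at x) a =
     2 * (G x (d\<Gamma> x a b w + \<Gamma> x a (\<Gamma> x b w)) w + G x (\<Gamma> x b w) (\<Gamma> x a w))" for a b
  proof -
    have *: "((\<lambda>y. G y (\<Gamma> y b w) w) has_derivative
      (\<lambda>a. G x (d\<Gamma> x a b w + \<Gamma> x a (\<Gamma> x b w)) w + G x (\<Gamma> x b w) (0 + \<Gamma> x a w))) (at x)"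
      by (rule has_derivative_G_along[of "\<lambda>y. y"])
        (auto intro: x smooth_on_has_derivative[OF smooth_\<Gamma>])
    have "2 * G y (\<Gamma> y b w) w = frechet_derivative ?f (at y) b" if "y \<in> D" for y
      by (simp add: compatible[OF that] sym[OF that, of w])
    note has_derivative_transform_within_open[OF has_derivative_mult_right[OF *, of 2] open_D x this]
    then have "((\<lambda>y. frechet_derivative ?f (at y) b) has_derivative
      (\<lambda>a. 2 * (G x (d\<Gamma> x a b w + \<Gamma> x a (\<Gamma> x b w)) w + G x (\<Gamma> x b w) (0 + \<Gamma> x a w)))) (at x)"
      by simp
    from fun_cong[OF frechet_derivative_at[OF this], of a] show ?thesis by simp
  qed
  from frechet_derivative_commute[OF open_D x smooth, of w w a b]
  show ?thesis unfolding 2 curvature_tensor_def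
    by (simp add: G_simps[OF x] sym[OF x, of "\<Gamma> x b w" "\<Gamma> x a w"])
qed

text \<open>The curvature is alternating in each pair of arguments, so in dimension two it has a single
  component.\<close>

lemma curvature_area:
  assumes x: "x \<in> D"
  shows "G x (R x a b w) z = area a b * area w z * G x (R x e1 e2 e1) e2"
proof -
  note ss = curvature_tensor_def G_simps[OF x] \<Gamma>_simps[OF x] d\<Gamma>_simps[OF x]
  have B: "bilinear (\<lambda>a b. G x (R x a b w) z)" for w z
    unfolding bilinear_def by (intro conjI allI linearI) (simp_all add: ss algebra_simps)
  have C: "bilinear (\<lambda>w z. G x (R x a b w) z)" for a b
    unfolding bilinear_def by (intro conjI allI linearI) (simp_all add: ss algebra_simps)
  have "G x (R x a b w) z = area a b * G x (R x e1 e2 w) z"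
    by (rule alternating_bilinear_area[OF B]) (simp add: ss)
  also have "G x (R x e1 e2 w) z = area w z * G x (R x e1 e2 e1) e2"
    by (rule alternating_bilinear_area[OF C]) (simp add: curvature_skew[OF x])
  finally show ?thesis by simp
qed

lemma curvature_nondegenerate:
  assumes x: "x \<in> D" and K: "gauss_curvature G x \<noteq> 0" and "area a b \<noteq> 0" and "G x (R x a b w) z = 0"
  shows "area w z = 0"
proof -
  have "G x (R x e1 e2 e2) e1 = area e1 e2 * area e2 e1 * G x (R x e1 e2 e1) e2"
    by (rule curvature_area[OF x])
  then have "G x (R x e1 e2 e1) e2 \<noteq> 0"
    using K by (auto simp: gauss_curvature_def sectional_curvature_def)
  then show ?thesis using assms(3,4) curvature_area[OF x, of a b w z] by auto
qed


section \<open>The Sasaki metric in coordinates\<close>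

text \<open>The coordinate expression of the connection map.\<close>

definition vert :: "(real^2) \<times> (real^2) \<Rightarrow> (real^2) \<times> (real^2) \<Rightarrow> real^2"
  where "vert P X = snd X + \<Gamma> (fst P) (snd P) (fst X)"

definition sas :: "(real^2) \<times> (real^2) \<Rightarrow> (real^2) \<times> (real^2) \<Rightarrow> (real^2) \<times> (real^2) \<Rightarrow> real"
  where "sas P X Y = G (fst P) (fst X) (fst Y) + G (fst P) (vert P X) (vert P Y)"

lemma has_derivative_vert:
  assumes "fst P \<in> D"
  shows "((\<lambda>P. vert P X) has_derivative
    (\<lambda>h. d\<Gamma> (fst P) (fst h) (snd P) (fst X) + \<Gamma> (fst P) (snd h) (fst X))) (at P)"
proof -
  have "((\<lambda>P. snd X + \<Gamma> (fst P) (snd P) (fst X)) has_derivative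
    (\<lambda>h. 0 + (d\<Gamma> (fst P) (fst h) (snd P) (fst X) + \<Gamma> (fst P) (snd h) (fst X) + \<Gamma> (fst P) (snd P) 0))) (at P)"
    by (intro has_derivative_add has_derivative_const has_derivative_bilinear_family[where B = \<Gamma> and p = fst
          and v = snd, OF open_D assms bilinear_\<Gamma> differentiable_\<Gamma>[OF assms]])
      (auto intro!: derivative_eq_intros)
  then show ?thesis by (simp add: vert_def \<Gamma>_simps[OF assms])
qed

lemma has_derivative_sas:
  assumes x: "fst P \<in> D"
  shows "((\<lambda>P. sas P X Y) has_derivative (\<lambda>h.
      G (fst P) (\<Gamma> (fst P) (fst h) (fst X)) (fst Y) + G (fst P) (fst X) (\<Gamma> (fst P) (fst h) (fst Y))
      + (G (fst P) (d\<Gamma> (fst P) (fst h) (snd P) (fst X) + \<Gamma> (fst P) (snd h) (fst X)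
           + \<Gamma> (fst P) (fst h) (vert P X)) (vert P Y)
        + G (fst P) (vert P X) (d\<Gamma> (fst P) (fst h) (snd P) (fst Y) + \<Gamma> (fst P) (snd h) (fst Y)
           + \<Gamma> (fst P) (fst h) (vert P Y))))) (at P)"
proof -
  have f: "(fst has_derivative fst) (at P)" by (auto intro!: derivative_eq_intros)
  have "((\<lambda>P. G (fst P) (fst X) (fst Y)) has_derivative (\<lambda>h.
      G (fst P) (0 + \<Gamma> (fst P) (fst h) (fst X)) (fst Y)
      + G (fst P) (fst X) (0 + \<Gamma> (fst P) (fst h) (fst Y)))) (at P)"
    by (rule has_derivative_G_along[OF x f]) auto
  from has_derivative_add[OF this has_derivative_G_along[OF x f has_derivative_vert[OF x]
        has_derivative_vert[OF x]]]
  show ?thesis unfolding sas_def by simp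
qed

lemma sas_koszul:
  assumes x: "x \<in> D"
  shows "sas (x, \<xi>) (christoffel sas (x, \<xi>) X Y) W =
    (frechet_derivative (\<lambda>P. sas P Y W) (at (x, \<xi>)) X + frechet_derivative (\<lambda>P. sas P X W) (at (x, \<xi>)) Y -
     frechet_derivative (\<lambda>P. sas P X Y) (at (x, \<xi>)) W) / 2"
proof (rule christoffel_koszul)
  show "open (D \<times> (UNIV :: (real^2) set))" using open_D by (simp add: open_Times)
  show "(x, \<xi>) \<in> D \<times> UNIV" using x by simp
  show "bilinear (sas P)" if "P \<in> D \<times> UNIV" for P
  proof -
    have "fst P \<in> D" using that by auto
    then show ?thesis unfolding bilinear_def
      by (intro conjI allI linearI) (simp_all add: sas_def vert_def G_simps \<Gamma>_simps algebra_simps)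
  qed
  show "(\<lambda>P. sas P X Y) differentiable (at (x, \<xi>))" for X Y
    using has_derivative_sas[of "(x, \<xi>)"] x unfolding differentiable_def by fastforce
  fix U :: "(real^2) \<times> (real^2)" assume U: "U \<noteq> 0"
  have nn: "G x v v \<ge> 0" for v using pos[OF x, of v] G_eq_0[OF x, of v] by (cases "v = 0") auto
  show "sas (x, \<xi>) U U > 0"
  proof (cases "fst U = 0")
    case True
    then have "vert (x, \<xi>) U \<noteq> 0" using U by (simp add: vert_def \<Gamma>_simps[OF x] prod_eq_iff)
    then show ?thesis using pos[OF x] True by (simp add: sas_def G_simps[OF x])
  next
    case False
    then show ?thesis using pos[OF x False] nn by (simp add: sas_def add_pos_nonneg)
  qed
qed

lemmas frechet_sas = frechet_derivative_at[OF has_derivative_sas, symmetric]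

text \<open>The covariant derivative of a vertical coordinate field \<open>\<beta>\<close> in the direction \<open>(u, \<alpha>)\<close> has the
  vertical part \<open>\<Gamma>(u, \<beta>)\<close> and the horizontal part \<open>R(\<xi>, \<beta>)u / 2\<close>. The latter is described by its inner
  products with vectors \<open>w\<close>, the form in which the Koszul formula yields it.\<close>

lemma christoffel_sas_vertical:
  fixes \<xi> u \<alpha> \<beta> :: "real^2"
  assumes x: "x \<in> D"
  defines "Z \<equiv> christoffel sas (x, \<xi>) (u, \<alpha>) (0, \<beta>)"
  shows "vert (x, \<xi>) Z = \<Gamma> x u \<beta>" and "2 * G x (fst Z) w = G x (R x u w \<xi>) \<beta>"
proof -
  have x': "fst (x, \<xi>) \<in> D" using x by simp
  note ss = G_simps[OF x] \<Gamma>_simps[OF x] d\<Gamma>_simps[OF x]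
  note K = sas_koszul[OF x, of \<xi> "(u, \<alpha>)" "(0, \<beta>)", folded Z_def, unfolded frechet_sas[OF x']]
  show "vert (x, \<xi>) Z = \<Gamma> x u \<beta>"
  proof (rule vector_eqI[OF x])
    fix w
    show "G x (vert (x, \<xi>) Z) w = G x (\<Gamma> x u \<beta>) w"
      using K[of "(0, w)"]
      by (simp add: ss sas_def vert_def[of _ "(_, _)"] \<Gamma>_sym[OF x] sym[OF x])
  qed
  show "2 * G x (fst Z) w = G x (R x u w \<xi>) \<beta>"
    using K[of "(w, - \<Gamma> x \<xi> w)"]
    by (simp add: ss sas_def vert_def[of _ "(_, _)"] curvature_tensor_def
      \<Gamma>_sym[OF x] sym[OF x] d\<Gamma>_sym[OF x])
qed

text \<open>Along horizontal directions the projection of \<open>TM\<close> to \<open>M\<close> is a Riemannian submersion, so covariant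
  derivatives project to covariant derivatives.\<close>

lemma christoffel_sas_horizontal:
  assumes x: "x \<in> D" and h: "vert (x, \<xi>) X = 0"
  shows "fst (christoffel sas (x, \<xi>) X X) = \<Gamma> x (fst X) (fst X)" (is "fst ?Z = _")
proof (rule vector_eqI[OF x])
  fix w
  have x': "fst (x, \<xi>) \<in> D" using x by simp
  have "vert (x, \<xi>) (w, - \<Gamma> x \<xi> w) = 0" by (simp add: vert_def)
  then show "G x (fst ?Z) w = G x (\<Gamma> x (fst X) (fst X)) w"
    using sas_koszul[OF x, of \<xi> X X "(w, - \<Gamma> x \<xi> w)", unfolded frechet_sas[OF x']] h
    by (simp add: sas_def G_simps[OF x] \<Gamma>_simps[OF x] \<Gamma>_sym[OF x] sym[OF x] sas_def[of _ ?Z])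
qed

end


section \<open>Change of charts\<close>

lemma cinv_cmap: "inj_on (cmap c) (cdom c) \<Longrightarrow> q \<in> cdom c \<Longrightarrow> cinv c (cmap c q) = q"
  by (simp add: cinv_def)

lemma cmap_cinv: "x \<in> crange c \<Longrightarrow> cmap c (cinv c x) = x"
  and cinv_cdom: "x \<in> crange c \<Longrightarrow> cinv c x \<in> cdom c"
  by (auto simp: cinv_def crange_def f_inv_into_f inv_into_into)

lemma cmap_crange: "q \<in> cdom c \<Longrightarrow> cmap c q \<in> crange c"
  by (auto simp: crange_def)

abbreviation trans_deriv :: "('a, 'e::euclidean_space) chart \<Rightarrow> ('a, 'e) chart \<Rightarrow> 'a \<Rightarrow> 'e \<Rightarrow> 'e"
  where "trans_deriv c c' q \<equiv> frechet_derivative (cmap c' \<circ> cinv c) (at (cmap c q))"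

text \<open>Differentiable transitions suffice for tangent vectors and for the topology; a manifold and its
  tangent bundle share this structure.\<close>

locale diff_atlas =
  fixes B :: "('a, 'e::euclidean_space) chart set"
  assumes inj: "c \<in> B \<Longrightarrow> inj_on (cmap c) (cdom c)"
    and open_crange: "c \<in> B \<Longrightarrow> open (crange c)"
    and open_overlap: "c \<in> B \<Longrightarrow> c' \<in> B \<Longrightarrow> open (cmap c ` (cdom c \<inter> cdom c'))"
    and trans_differentiable: "c \<in> B \<Longrightarrow> c' \<in> B \<Longrightarrow> x \<in> cmap c ` (cdom c \<inter> cdom c')
      \<Longrightarrow> (cmap c' \<circ> cinv c) differentiable (at x)"
begin

lemma trans_has_derivative:
  "c \<in> B \<Longrightarrow> c' \<in> B \<Longrightarrow> q \<in> cdom c \<Longrightarrow> q \<in> cdom c' \<Longrightarrow>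
    ((cmap c' \<circ> cinv c) has_derivative trans_deriv c c' q) (at (cmap c q))"
  using trans_differentiable frechet_derivative_works by blast

lemma trans_deriv_linear:
  "c \<in> B \<Longrightarrow> c' \<in> B \<Longrightarrow> q \<in> cdom c \<Longrightarrow> q \<in> cdom c' \<Longrightarrow> linear (trans_deriv c c' q)"
  using trans_has_derivative has_derivative_linear by blast

lemma trans_deriv_cocycle:
  assumes c: "c \<in> B" "c' \<in> B" "c'' \<in> B" and q: "q \<in> cdom c" "q \<in> cdom c'" "q \<in> cdom c''"
  shows "trans_deriv c' c'' q (trans_deriv c c' q u) = trans_deriv c c'' q u"
proof -
  let ?O = "cmap c ` (cdom c \<inter> cdom c') \<inter> cmap c ` (cdom c \<inter> cdom c'')"
  have i: "cinv c (cmap c r) = r" if "r \<in> cdom c" for r by (rule cinv_cmap[OF inj[OF c(1)] that])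
  have i': "cinv c' (cmap c' r) = r" if "r \<in> cdom c'" for r by (rule cinv_cmap[OF inj[OF c(2)] that])
  have "((cmap c'' \<circ> cinv c') has_derivative trans_deriv c' c'' q) (at ((cmap c' \<circ> cinv c) (cmap c q)))"
    using trans_has_derivative[OF c(2,3) q(2,3)] by (simp add: i[OF q(1)])
  from has_derivative_compose[OF trans_has_derivative[OF c(1,2) q(1,2)] this]
  have "((\<lambda>x. (cmap c'' \<circ> cinv c') ((cmap c' \<circ> cinv c) x)) has_derivative
      (\<lambda>u. trans_deriv c' c'' q (trans_deriv c c' q u))) (at (cmap c q))" .
  then have "((cmap c'' \<circ> cinv c) has_derivative (\<lambda>u. trans_deriv c' c'' q (trans_deriv c c' q u))) (at (cmap c q))"
  proof (rule has_derivative_transform_within_open[where s = ?O])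
    show "open ?O" by (intro open_Int open_overlap c)
    show "cmap c q \<in> ?O" using q by auto
    show "(cmap c'' \<circ> cinv c') ((cmap c' \<circ> cinv c) x) = (cmap c'' \<circ> cinv c) x" if x: "x \<in> ?O" for x
    proof -
      obtain r r' where r: "x = cmap c r" "r \<in> cdom c" "r \<in> cdom c'"
        and r': "x = cmap c r'" "r' \<in> cdom c" using x by blast
      then show ?thesis using i i' by simp
    qed
  qed
  from fun_cong[OF frechet_derivative_at[OF this], of u] show ?thesis .
qed

lemma trans_deriv_self:
  assumes c: "c \<in> B" and q: "q \<in> cdom c" shows "trans_deriv c c q u = u"
proof -
  have "((\<lambda>x. x) has_derivative (\<lambda>x. x)) (at (cmap c q))" by simp
  then have "((cmap c \<circ> cinv c) has_derivative (\<lambda>x. x)) (at (cmap c q))"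
    by (rule has_derivative_transform_within_open[OF _ open_crange[OF c] cmap_crange[OF q]])
      (simp add: cmap_cinv)
  from fun_cong[OF frechet_derivative_at[OF this], of u] show ?thesis by simp
qed

lemma trans_deriv_inverse:
  assumes "c \<in> B" "c' \<in> B" "q \<in> cdom c" "q \<in> cdom c'"
  shows "trans_deriv c c' q (trans_deriv c' c q u) = u"
  using trans_deriv_cocycle[of c' c c' q u] trans_deriv_self[of c' q u] assms by simp

lemma tvec_of_self: "chart_at B q c \<Longrightarrow> tvec_of B c q u c = u"
  by (simp add: tvec_of_def trans_deriv_self chart_at_def)

lemma tvec_of_tangent: "chart_at B q c \<Longrightarrow> tvec_of B c q u \<in> tangent_vectors B q"
  unfolding tangent_vectors_def mem_Collect_eq
proof (intro conjI allI impI)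
  fix c' c'' assume "chart_at B q c" "chart_at B q c'" "chart_at B q c''"
  then show "tvec_of B c q u c'' = trans_deriv c' c'' q (tvec_of B c q u c')"
    by (simp add: tvec_of_def chart_at_def trans_deriv_cocycle)
qed (simp add: tvec_of_def)

lemma tangent_eq_tvec_of:
  "chart_at B q c \<Longrightarrow> v \<in> tangent_vectors B q \<Longrightarrow> v = tvec_of B c q (v c)"
proof (rule ext)
  fix c' assume "chart_at B q c" "v \<in> tangent_vectors B q"
  then have "\<not> chart_at B q c' \<Longrightarrow> v c' = 0" "chart_at B q c' \<Longrightarrow> v c' = trans_deriv c c' q (v c)"
    unfolding tangent_vectors_def by blast+
  then show "v c' = tvec_of B c q (v c) c'"
    unfolding tvec_of_def by (cases "chart_at B q c'") (simp_all only: if_True if_False not_False_eq_True)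
qed

lemma tvec_of_change:
  assumes "chart_at B q c" "chart_at B q c'"
  shows "tvec_of B c' q (trans_deriv c c' q u) = tvec_of B c q u"
  using assms by (intro ext) (simp add: tvec_of_def chart_at_def trans_deriv_cocycle)

lemma tvec_of_add: 
  "chart_at B q c \<Longrightarrow> tvec_add (tvec_of B c q u) (tvec_of B c q v) = tvec_of B c q (u + v)"
  by (rule ext) (auto simp: tvec_add_def tvec_of_def chart_at_def linear_add[OF trans_deriv_linear])

lemma tvec_of_scale:
  "chart_at B q c \<Longrightarrow> tvec_scale t (tvec_of B c q u) = tvec_of B c q (t *\<^sub>R u)"
  by (rule ext) (auto simp: tvec_scale_def tvec_of_def chart_at_def linear_cmul[OF trans_deriv_linear])

lemma tvec_of_zero: "chart_at B q c \<Longrightarrow> tvec_of B c q 0 = tvec_zero"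
  by (rule ext) (auto simp: tvec_zero_def tvec_of_def chart_at_def linear_0[OF trans_deriv_linear])

lemma tangent_vectors_add:
  assumes "v \<in> tangent_vectors B q" "w \<in> tangent_vectors B q"
  shows "tvec_add v w \<in> tangent_vectors B q"
  unfolding tangent_vectors_def mem_Collect_eq
proof (intro conjI allI impI)
  fix c assume "\<not> chart_at B q c"
  then have "v c = 0" "w c = 0" using assms unfolding tangent_vectors_def by blast+
  then show "tvec_add v w c = 0" by (simp add: tvec_add_def)
next
  fix c c' assume c: "chart_at B q c" "chart_at B q c'"
  then have "v c' = trans_deriv c c' q (v c)" "w c' = trans_deriv c c' q (w c)"
    using assms unfolding tangent_vectors_def by blast+
  moreover have "linear (trans_deriv c c' q)" using c trans_deriv_linear by (auto simp: chart_at_def)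
  ultimately show "tvec_add v w c' = trans_deriv c c' q (tvec_add v w c)"
    unfolding tvec_add_def by (simp only: linear_add)
qed

lemma coord_metric_change:
  assumes "c \<in> B" "c' \<in> B" "q \<in> cdom c" "q \<in> cdom c'"
  shows "coord_metric B g c' (cmap c' q) (trans_deriv c c' q u) (trans_deriv c c' q v) =
    coord_metric B g c (cmap c q) u v"
  using assms by (simp add: coord_metric_def cinv_cmap inj tvec_of_change chart_at_def)

lemma openin_cinv_image:
  assumes c: "c \<in> B" and Q: "open Q" "Q \<subseteq> crange c"
  shows "openin (atlas_topology B) (cinv c ` Q)"
  unfolding openin_atlas_topology atlas_open_def
proof (intro conjI ballI)
  have "cinv c ` Q \<subseteq> cdom c" using Q(2) cinv_cdom[of _ c] by blast
  then show "cinv c ` Q \<subseteq> points B" using c unfolding points_def by blast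
  fix c' assume c': "c' \<in> B"
  let ?U = "cmap c' ` (cdom c' \<inter> cdom c)"
  have "{x \<in> crange c'. cinv c' x \<in> cinv c ` Q} = ?U \<inter> (cmap c \<circ> cinv c') -` Q"
  proof (intro equalityI subsetI)
    fix x assume x: "x \<in> {x \<in> crange c'. cinv c' x \<in> cinv c ` Q}"
    then obtain y where y: "y \<in> Q" "cinv c' x = cinv c y" by auto
    have "cinv c' x \<in> cdom c'" "cmap c' (cinv c' x) = x" using x cinv_cdom[of x c'] cmap_cinv[of x c'] by blast+
    moreover have "cinv c' x \<in> cdom c" "cmap c (cinv c' x) \<in> Q"
      using y Q cinv_cdom[of y c] cmap_cinv[of y c] by auto
    ultimately show "x \<in> ?U \<inter> (cmap c \<circ> cinv c') -` Q" by (simp add: rev_image_eqI)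
  next
    fix x assume "x \<in> ?U \<inter> (cmap c \<circ> cinv c') -` Q"
    then obtain q where q: "q \<in> cdom c'" "q \<in> cdom c" "x = cmap c' q" "cmap c (cinv c' x) \<in> Q" by auto
    then have "cinv c' x = q" "q = cinv c (cmap c q)"
      using cinv_cmap[OF inj[OF c] q(2)] cinv_cmap[OF inj[OF c'] q(1)] by simp_all
    then show "x \<in> {x \<in> crange c'. cinv c' x \<in> cinv c ` Q}"
      using q cmap_crange[OF q(1)] by auto
  qed
  moreover have "continuous_on ?U (cmap c \<circ> cinv c')"
    by (intro continuous_at_imp_continuous_on ballI differentiable_imp_continuous_within
        trans_differentiable c c')
  ultimately show "open {x \<in> crange c'. cinv c' x \<in> cinv c ` Q}"
    using continuous_open_preimage[OF _ open_overlap[OF c' c] Q(1)] by simp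
qed

lemma openin_cdom: "c \<in> B \<Longrightarrow> openin (atlas_topology B) (cdom c)"
  using openin_cinv_image[OF _ open_crange, of c c] cinv_cmap[OF inj, of c]
  by (simp add: crange_def image_image)

text \<open>A parametrization is a homeomorphism onto its image, so open subsets of its domain also
  parametrize relatively open pieces.\<close>

lemma local_param_restrict:
  assumes f: "local_param B F c f U" and N: "open N" "N \<subseteq> U"
  shows "local_param B F c f N"
proof -
  obtain h where h: "homeomorphism U (f ` U) f h" using f by (auto simp: local_param_def)
  obtain W where W: "openin (atlas_topology B) W" "F \<inter> W = cinv c ` f ` U"
    using f by (auto simp: local_param_def)
  have c: "c \<in> B" "f ` U \<subseteq> crange c" using f by (auto simp: local_param_def)
  have "openin (top_of_set (f ` U)) (f ` N)"
    using homeomorphism_imp_open_map[OF h] N open_openin_trans[of U N] f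
    by (auto simp: local_param_def open_subset)
  then obtain Q where Q: "open Q" "f ` N = f ` U \<inter> Q" by (auto simp: openin_open)
  have "F \<inter> (W \<inter> cinv c ` (Q \<inter> crange c)) = cinv c ` f ` N"
  proof (intro equalityI subsetI)
    fix p assume "p \<in> F \<inter> (W \<inter> cinv c ` (Q \<inter> crange c))"
    then have "p \<in> cinv c ` f ` U" "p \<in> cinv c ` (Q \<inter> crange c)" using W by auto
    then obtain x y where "p = cinv c x" "x \<in> f ` U" "p = cinv c y" "y \<in> Q" "y \<in> crange c" by blast
    moreover from this have "x = y" using c cmap_cinv[of x c] cmap_cinv[of y c] by auto
    ultimately show "p \<in> cinv c ` f ` N" using Q by auto
  next
    fix p assume "p \<in> cinv c ` f ` N"
    then obtain x where "p = cinv c x" "x \<in> f ` N" by auto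
    then show "p \<in> F \<inter> (W \<inter> cinv c ` (Q \<inter> crange c))" using W Q c by blast
  qed
  moreover have "openin (atlas_topology B) (W \<inter> cinv c ` (Q \<inter> crange c))"
    using W Q by (intro openin_Int openin_cinv_image c open_Int open_crange) auto
  ultimately have "\<exists>W. openin (atlas_topology B) W \<and> F \<inter> W = cinv c ` f ` N" by blast
  moreover have "homeomorphism N (f ` N) f h"
    by (rule homeomorphism_of_subsets[OF h N(2) subset_refl]) (use N in auto)
  ultimately show ?thesis using f N unfolding local_param_def
    by (auto intro: smooth_on_subset)
qed

end

locale riemannian_manifold =
  fixes A :: "('a, 'e::euclidean_space) chart set" and g :: "('a, 'e) metric"
  assumes manifold: "smooth_manifold A" and metric: "riemannian_metric A g"
begin

sublocale diff_atlas A
proof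
  fix c c' assume "c \<in> A" "c' \<in> A"
  then show "open (cmap c ` (cdom c \<inter> cdom c'))"
    and "x \<in> cmap c ` (cdom c \<inter> cdom c') \<Longrightarrow> (cmap c' \<circ> cinv c) differentiable (at x)" for x
    using manifold smooth_on_differentiable unfolding smooth_manifold_def by blast+
qed (use manifold in \<open>auto simp: smooth_manifold_def\<close>)

lemma smooth_trans: "c \<in> A \<Longrightarrow> c' \<in> A \<Longrightarrow> smooth_on (cmap c ` (cdom c \<inter> cdom c')) (cmap c' \<circ> cinv c)"
  using manifold by (auto simp: smooth_manifold_def)

abbreviation cm where "cm \<equiv> coord_metric A g"

lemma metric_field: "c \<in> A \<Longrightarrow> metric_field (crange c) (cm c)"
  using metric open_crange by unfold_locales (auto simp: riemannian_metric_def)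

abbreviation hess :: "('a, 'e) chart \<Rightarrow> ('a, 'e) chart \<Rightarrow> 'a \<Rightarrow> 'e \<Rightarrow> 'e \<Rightarrow> 'e"
  where "hess c c' q u v \<equiv>
    frechet_derivative (\<lambda>y. frechet_derivative (cmap c' \<circ> cinv c) (at y) v) (at (cmap c q)) u"

text \<open>Differentiating \<open>\<langle>a, b\<rangle> = \<langle>D\<phi> a, D\<phi> b\<rangle>\<close> gives the product rule for the right-hand side \<open>E(u, v)\<close>, which is
  symmetric because second derivatives commute; these two properties determine the Christoffel symbols
  through the Koszul formula.\<close>

lemma christoffel_change:
  assumes c: "c \<in> A" "c' \<in> A" and q: "q \<in> cdom c" "q \<in> cdom c'"
  shows "trans_deriv c c' q (christoffel (cm c) (cmap c q) u v) =
    hess c c' q u v + christoffel (cm c') (cmap c' q) (trans_deriv c c' q u) (trans_deriv c c' q v)"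
proof -
  interpret M: metric_field "crange c" "cm c" by (rule metric_field[OF c(1)])
  interpret N: metric_field "crange c'" "cm c'" by (rule metric_field[OF c(2)])
  let ?O = "cmap c ` (cdom c \<inter> cdom c')" and ?\<phi> = "cmap c' \<circ> cinv c"
  let ?x = "cmap c q" and ?x' = "cmap c' q"
  let ?D = "\<lambda>y. frechet_derivative ?\<phi> (at y)"
  define E where "E = (\<lambda>u v. hess c c' q u v + N.\<Gamma> ?x' (?D ?x u) (?D ?x v))"
  have O: "open ?O" "?x \<in> ?O" using open_overlap c q by auto
  have x: "?x \<in> crange c" and x': "?x' \<in> crange c'" by (rule cmap_crange[OF q(1)], rule cmap_crange[OF q(2)])
  have \<phi>x: "?\<phi> ?x = ?x'" using cinv_cmap[OF inj[OF c(1)] q(1)] by simp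
  have Esym: "E u v = E v u" for u v
    unfolding E_def using frechet_derivative_commute[OF O smooth_trans[OF c], of v u] N.\<Gamma>_sym[OF x'] by simp
  have dG: "frechet_derivative (\<lambda>y. cm c y a b) (at ?x) h =
      cm c' ?x' (E h a) (?D ?x b) + cm c' ?x' (?D ?x a) (E h b)" for a b h
  proof -
    have d: "((\<lambda>y. ?D y a) has_derivative (\<lambda>h. hess c c' q h a)) (at ?x)" for a
      by (rule smooth_on_has_derivative[OF smooth_on_frechet[OF smooth_trans[OF c]] O(2)])
    have "((\<lambda>y. cm c' (?\<phi> y) (?D y a) (?D y b)) has_derivative
        (\<lambda>h. cm c' ?x' (E h a) (?D ?x b) + cm c' ?x' (?D ?x a) (E h b))) (at ?x)"
      using N.has_derivative_G_along[OF _ trans_has_derivative[OF c q] d[of a] d[of b]] x'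
      unfolding \<phi>x E_def by blast
    then have "((\<lambda>y. cm c y a b) has_derivative
        (\<lambda>h. cm c' ?x' (E h a) (?D ?x b) + cm c' ?x' (?D ?x a) (E h b))) (at ?x)"
    proof (rule has_derivative_transform_within_open[OF _ O])
      fix y assume "y \<in> ?O"
      then obtain r where r: "r \<in> cdom c" "r \<in> cdom c'" "y = cmap c r" by auto
      then show "cm c' (?\<phi> y) (?D y a) (?D y b) = cm c y a b"
        using coord_metric_change[OF c r(1,2)] cinv_cmap[OF inj[OF c(1)] r(1)] by simp
    qed
    from fun_cong[OF frechet_derivative_at[OF this], of h] show ?thesis by simp
  qed
  have "cm c' ?x' (?D ?x (M.\<Gamma> ?x u v)) (?D ?x w) = cm c' ?x' (E u v) (?D ?x w)" for w
  proof -
    have "cm c' ?x' (?D ?x (M.\<Gamma> ?x u v)) (?D ?x w) = cm c ?x (M.\<Gamma> ?x u v) w"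
      by (rule coord_metric_change[OF c q])
    also have "\<dots> = cm c' ?x' (E u v) (?D ?x w)"
      unfolding M.koszul[OF x] dG Esym[of v u] Esym[of w u] Esym[of w v] N.sym[OF x', of "E u w" "?D ?x v"]
      by simp
    finally show ?thesis .
  qed
  then have "cm c' ?x' (?D ?x (M.\<Gamma> ?x u v)) w = cm c' ?x' (E u v) w" for w
    using trans_deriv_inverse[OF c q, of w] by metis
  then show ?thesis using N.vector_eqI[OF x'] unfolding E_def by blast
qed

end


section \<open>Induced charts of the tangent bundle\<close>

context riemannian_manifold
begin

abbreviation TB where "TB \<equiv> tangent_bundle A"

lemma cdom_induced: "cdom (induced_chart A c) = Sigma (cdom c) (tangent_vectors A)"
  and cmap_induced: "cmap (induced_chart A c) = (\<lambda>(q, \<xi>). (cmap c q, \<xi> c))"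
  by (simp_all add: induced_chart_def)

lemma inj_induced: "c \<in> A \<Longrightarrow> inj_on (cmap (induced_chart A c)) (cdom (induced_chart A c))"
proof (rule inj_onI, clarsimp simp: cdom_induced cmap_induced)
  fix q q' :: 'a and \<xi> \<xi>' :: "('a, 'e) tvec"
  assume c: "c \<in> A" and a: "q \<in> cdom c" "q' \<in> cdom c" "\<xi> \<in> tangent_vectors A q" "\<xi>' \<in> tangent_vectors A q'"
    "cmap c q = cmap c q'" "\<xi> c = \<xi>' c"
  have "q = q'" using inj_onD[OF inj[OF c] a(5)] a by blast
  then show "q = q' \<and> \<xi> = \<xi>'"
    using tangent_eq_tvec_of[of q c] a c by (metis chart_at_def)
qed

lemma crange_induced: "c \<in> A \<Longrightarrow> crange (induced_chart A c) = crange c \<times> UNIV"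
proof -
  assume c: "c \<in> A"
  have "(x, \<xi>) \<in> crange (induced_chart A c)" if "x \<in> crange c" for x \<xi>
  proof -
    have "chart_at A (cinv c x) c" using c cinv_cdom[OF that] by (simp add: chart_at_def)
    then have "tvec_of A c (cinv c x) \<xi> \<in> tangent_vectors A (cinv c x)" "tvec_of A c (cinv c x) \<xi> c = \<xi>"
      using tvec_of_tangent tvec_of_self by auto
    then show ?thesis unfolding crange_def[of "induced_chart A c"] cdom_induced cmap_induced
      using that cinv_cdom[OF that] cmap_cinv[OF that] by (intro image_eqI[of _ _ "(cinv c x, tvec_of A c (cinv c x) \<xi>)"]) auto
  qed
  then show ?thesis by (auto simp: crange_def cdom_induced cmap_induced)
qed

lemma cinv_induced:
  assumes c: "c \<in> A" and x: "x \<in> crange c"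
  shows "cinv (induced_chart A c) (x, \<xi>) = (cinv c x, tvec_of A c (cinv c x) \<xi>)"
proof -
  have "chart_at A (cinv c x) c" using c cinv_cdom[OF x] by (simp add: chart_at_def)
  then have "(cinv c x, tvec_of A c (cinv c x) \<xi>) \<in> cdom (induced_chart A c)"
    "cmap (induced_chart A c) (cinv c x, tvec_of A c (cinv c x) \<xi>) = (x, \<xi>)"
    using tvec_of_tangent tvec_of_self cinv_cdom[OF x] cmap_cinv[OF x] by (auto simp: cdom_induced cmap_induced)
  then show ?thesis using cinv_cmap[OF inj_induced[OF c]] by metis
qed

lemma overlap_induced:
  assumes c: "c \<in> A"
  shows "cmap (induced_chart A c) ` (cdom (induced_chart A c) \<inter> cdom (induced_chart A c')) =
    cmap c ` (cdom c \<inter> cdom c') \<times> UNIV"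
proof (intro equalityI subsetI)
  fix P assume "P \<in> cmap c ` (cdom c \<inter> cdom c') \<times> (UNIV :: 'e set)"
  then obtain q \<xi> where q: "q \<in> cdom c" "q \<in> cdom c'" "P = (cmap c q, \<xi>)" by auto
  have "chart_at A q c" using c q by (simp add: chart_at_def)
  then show "P \<in> cmap (induced_chart A c) ` (cdom (induced_chart A c) \<inter> cdom (induced_chart A c'))"
    using q tvec_of_tangent tvec_of_self
    by (intro image_eqI[of _ _ "(q, tvec_of A c q \<xi>)"]) (auto simp: cdom_induced cmap_induced)
qed (auto simp: cdom_induced cmap_induced)

lemma trans_induced_has_derivative:
  assumes c: "c \<in> A" "c' \<in> A" and q: "q \<in> cdom c" "q \<in> cdom c'"
  shows "((cmap (induced_chart A c') \<circ> cinv (induced_chart A c)) has_derivative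
    (\<lambda>X. (trans_deriv c c' q (fst X), hess c c' q (fst X) \<xi> + trans_deriv c c' q (snd X)))) (at (cmap c q, \<xi>))"
proof -
  let ?O = "cmap c ` (cdom c \<inter> cdom c')" and ?\<phi> = "cmap c' \<circ> cinv c"
  have O: "open ?O" "cmap c q \<in> ?O" using open_overlap c q by auto
  have OT: "open (?O \<times> (UNIV :: 'e set))" "(cmap c q, \<xi>) \<in> ?O \<times> UNIV" using O by (auto simp: open_Times)
  have 1: "((\<lambda>P. ?\<phi> (fst P)) has_derivative (\<lambda>X. trans_deriv c c' q (fst X))) (at (cmap c q, \<xi>))"
    by (rule has_derivative_compose[OF bounded_linear_imp_has_derivative[OF bounded_linear_fst]])
      (simp only: fst_conv trans_has_derivative[OF c q])
  have 2: "((\<lambda>P. frechet_derivative ?\<phi> (at (fst P)) (snd P)) has_derivative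
      (\<lambda>h. frechet_derivative (\<lambda>y. frechet_derivative ?\<phi> (at y) (snd (cmap c q, \<xi>))) (at (fst (cmap c q, \<xi>))) (fst h)
        + frechet_derivative ?\<phi> (at (fst (cmap c q, \<xi>))) (snd h))) (at (cmap c q, \<xi>))"
  proof (rule has_derivative_linear_family[of ?O fst "(cmap c q, \<xi>)" "\<lambda>y. frechet_derivative ?\<phi> (at y)" fst snd snd])
    show "linear (frechet_derivative ?\<phi> (at y))" if "y \<in> ?O" for y
      using smooth_on_has_derivative[OF smooth_trans[OF c] that] by (rule has_derivative_linear)
    show "(\<lambda>y. frechet_derivative ?\<phi> (at y) b) differentiable at (fst (cmap c q, \<xi>))" for b
      by (rule smooth_on_differentiable[OF smooth_on_frechet[OF smooth_trans[OF c]]]) (use O in simp)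
  qed (use O in \<open>auto intro!: derivative_eq_intros\<close>)
  have "((\<lambda>P. (?\<phi> (fst P), frechet_derivative ?\<phi> (at (fst P)) (snd P))) has_derivative
    (\<lambda>X. (trans_deriv c c' q (fst X), hess c c' q (fst X) \<xi> + trans_deriv c c' q (snd X)))) (at (cmap c q, \<xi>))"
    using has_derivative_Pair[OF 1 2] by simp
  then show ?thesis
  proof (rule has_derivative_transform_within_open[OF _ OT])
    fix P assume "P \<in> ?O \<times> (UNIV :: 'e set)"
    then obtain r \<eta> where P: "P = (cmap c r, \<eta>)" and r: "r \<in> cdom c" "r \<in> cdom c'" by auto
    have "tvec_of A c r \<eta> c' = trans_deriv c c' r \<eta>" using c r by (simp add: tvec_of_def chart_at_def)
    then show "(?\<phi> (fst P), frechet_derivative ?\<phi> (at (fst P)) (snd P)) =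
        (cmap (induced_chart A c') \<circ> cinv (induced_chart A c)) P"
      using cinv_induced[OF c(1) cmap_crange[OF r(1)]] cinv_cmap[OF inj[OF c(1)] r(1)]
      by (simp add: P cmap_induced)
  qed
qed

sublocale TB: diff_atlas "tangent_bundle A"
proof
  fix c assume "c \<in> TB"
  then obtain d where d: "d \<in> A" "c = induced_chart A d" by (auto simp: tangent_bundle_def)
  show "inj_on (cmap c) (cdom c)" using d inj_induced by simp
  show "open (crange c)" using d crange_induced open_crange by (simp add: open_Times)
  fix c' assume "c' \<in> TB"
  then obtain d' where d': "d' \<in> A" "c' = induced_chart A d'" by (auto simp: tangent_bundle_def)
  show "open (cmap c ` (cdom c \<inter> cdom c'))"
    unfolding d(2) d'(2) overlap_induced[OF d(1)] using open_overlap[OF d(1) d'(1)] by (simp add: open_Times)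
  fix P assume "P \<in> cmap c ` (cdom c \<inter> cdom c')"
  then have "P \<in> cmap d ` (cdom d \<inter> cdom d') \<times> UNIV"
    unfolding d(2) d'(2) overlap_induced[OF d(1)] .
  then obtain q \<xi> where "q \<in> cdom d" "q \<in> cdom d'" "P = (cmap d q, \<xi>)" by auto
  then show "(cmap c' \<circ> cinv c) differentiable at P"
    using trans_induced_has_derivative[OF d(1) d'(1)] d d' unfolding differentiable_def by blast
qed

text \<open>The transformation law of the Christoffel symbols is what makes the connection map independent
  of the chart.\<close>

lemma projections_in_chart:
  fixes \<xi> :: 'e and X :: "'e \<times> 'e"
  assumes c: "c \<in> A" and q: "q \<in> cdom c"
  defines "p \<equiv> (q, tvec_of A c q \<xi>)" and "V \<equiv> tvec_of TB (induced_chart A c) (q, tvec_of A c q \<xi>) X"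
  shows "proj_push A p V = tvec_of A c q (fst X)"
    and "connection_map A g p V =
      tvec_of A c q (snd X + christoffel (cm c) (cmap c q) \<xi> (fst X))"
proof -
  have ch: "chart_at A q c" using c q by (simp add: chart_at_def)
  have fp: "fst p = q" by (simp add: p_def)
  have V: "V (induced_chart A c') = (trans_deriv c c' q (fst X), hess c c' q (fst X) \<xi> + trans_deriv c c' q (snd X))"
    if "chart_at A q c'" for c'
  proof -
    have c': "c' \<in> A" "q \<in> cdom c'" using that by (auto simp: chart_at_def)
    have "chart_at TB p (induced_chart A c')"
      using c' tvec_of_tangent[OF ch] by (auto simp: chart_at_def tangent_bundle_def cdom_induced p_def)
    moreover have "cmap (induced_chart A c) (q, tvec_of A c q \<xi>) = (cmap c q, \<xi>)"
      using tvec_of_self[OF ch] by (simp add: cmap_induced)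
    ultimately show ?thesis
      using fun_cong[OF frechet_derivative_at[OF trans_induced_has_derivative[OF c c'(1) q c'(2)]]]
      by (simp add: V_def tvec_of_def p_def)
  qed
  show "proj_push A p V = tvec_of A c q (fst X)"
    by (rule ext) (auto simp: proj_push_def fp V tvec_of_def)
  show "connection_map A g p V = tvec_of A c q (snd X + christoffel (cm c) (cmap c q) \<xi> (fst X))"
  proof (rule ext)
    fix c'
    show "connection_map A g p V c' = tvec_of A c q (snd X + christoffel (cm c) (cmap c q) \<xi> (fst X)) c'"
    proof (cases "chart_at A q c'")
      case True
      then have c': "c' \<in> A" "q \<in> cdom c'" by (auto simp: chart_at_def)
      interpret M: metric_field "crange c" "cm c" by (rule metric_field[OF c])
      interpret N: metric_field "crange c'" "cm c'" by (rule metric_field[OF c'(1)])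
      have "snd p c' = trans_deriv c c' q \<xi>" using True by (simp add: p_def tvec_of_def)
      moreover have "trans_deriv c c' q (M.\<Gamma> (cmap c q) \<xi> (fst X)) = hess c c' q (fst X) \<xi>
          + N.\<Gamma> (cmap c' q) (trans_deriv c c' q \<xi>) (trans_deriv c c' q (fst X))"
        using christoffel_change[OF c c'(1) q c'(2), of "fst X" \<xi>] M.\<Gamma>_sym[OF cmap_crange[OF q]]
          N.\<Gamma>_sym[OF cmap_crange[OF c'(2)]] by metis
      ultimately show ?thesis
        using True linear_add[OF trans_deriv_linear[OF c c'(1) q c'(2)]]
        by (simp add: connection_map_def fp V tvec_of_def)
    qed (simp add: connection_map_def fp tvec_of_def)
  qed
qed

end

locale riemannian_surface = riemannian_manifold A g
  for A :: "('a, real^2) chart set" and g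
begin

lemma surface_metric: "c \<in> A \<Longrightarrow> surface_metric (crange c) (cm c)"
  using metric_field by (simp add: surface_metric_def)

lemma coord_sasaki:
  assumes c: "c \<in> A" and P: "P \<in> crange c \<times> UNIV"
  shows "coord_metric TB (sasaki A g) (induced_chart A c) P X Y = surface_metric.sas (cm c) P X Y"
proof -
  interpret M: surface_metric "crange c" "cm c" by (rule surface_metric[OF c])
  obtain x \<xi> where P': "P = (x, \<xi>)" "x \<in> crange c" using P by auto
  let ?q = "cinv c x"
  have q: "?q \<in> cdom c" "cmap c ?q = x" using cinv_cdom[OF P'(2)] cmap_cinv[OF P'(2)] by auto
  note pr = projections_in_chart[OF c q(1), of \<xi>]
  show ?thesis
    unfolding coord_metric_def[of TB] P'(1) cinv_induced[OF c P'(2)] sasaki_def pr M.sas_def M.vert_def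
    by (simp add: coord_metric_def q)
qed

lemma christoffel_sasaki:
  assumes c: "c \<in> A" and P: "P \<in> crange c \<times> UNIV"
  shows "christoffel (coord_metric TB (sasaki A g) (induced_chart A c)) P X Y =
    christoffel (surface_metric.sas (cm c)) P X Y"
proof -
  interpret M: surface_metric "crange c" "cm c" by (rule surface_metric[OF c])
  have o: "open (crange c \<times> (UNIV :: (real^2) set))" using open_crange[OF c] by (simp add: open_Times)
  have "frechet_derivative (\<lambda>P. M.sas P U V) (at P) =
    frechet_derivative (\<lambda>P. coord_metric TB (sasaki A g) (induced_chart A c) P U V) (at P)" for U V
  proof (rule frechet_derivative_transform_within_open[OF _ o P])
    show "(\<lambda>P. M.sas P U V) differentiable at P"
      using M.has_derivative_sas[of P U V] P unfolding differentiable_def by auto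
  qed (simp add: coord_sasaki[OF c])
  then show ?thesis unfolding christoffel_def coord_sasaki[OF c P] by simp
qed

end


section \<open>Rank of the projection\<close>

context riemannian_surface
begin

text \<open>In the induced chart the fiber is the coordinate plane \<open>{x} \<times> UNIV\<close>, parametrized by \<open>\<xi>\<close>.\<close>

lemma vertical_tangent_to_fiber:
  assumes c: "c \<in> A" and q: "q \<in> cdom c" and \<xi>: "\<xi> \<in> tangent_vectors A q"
  shows "tvec_of TB (induced_chart A c) (q, \<xi>) (0, \<alpha>) \<in> tangent_space TYPE(real^2) TB (fiber A q) (q, \<xi>)"
proof -
  let ?x = "cmap c q" and ?c = "induced_chart A c"
  define h where "h = (\<lambda>w :: real^2. (?x, w))"
  have ch: "chart_at A q c" using c q by (simp add: chart_at_def)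
  have x: "?x \<in> crange c" and qx: "cinv c ?x = q" using cmap_crange[OF q] cinv_cmap[OF inj[OF c] q] by auto
  have dh: "(h has_derivative (\<lambda>a. (0, a))) (at w)" for w
    unfolding h_def by (auto intro!: derivative_eq_intros)
  have fh: "frechet_derivative h (at w) = (\<lambda>a. (0, a))" for w
    using frechet_derivative_at[OF dh] by simp
  have inv: "cinv ?c (h w) = (q, tvec_of A c q w)" for w
    unfolding h_def using cinv_induced[OF c x] qx by simp
  have "smooth_on UNIV h"
  proof -
    have "smooth_on UNIV (\<lambda>w :: real^2. (?x, 0) + (0, w))"
      by (intro smooth_on_add smooth_on_const smooth_on_linear bounded_linear_Pair bounded_linear_zero
          bounded_linear_ident) auto
    then show ?thesis by (simp add: h_def)
  qed
  moreover have "range h \<subseteq> crange ?c" using x by (auto simp: crange_induced[OF c] h_def)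
  moreover have "homeomorphism UNIV (range h) h snd"
    unfolding homeomorphism_def h_def by (auto simp: image_image intro!: continuous_intros)
  moreover have "openin (atlas_topology TB) (cdom ?c)"
    by (rule TB.openin_cdom) (use c in \<open>simp add: tangent_bundle_def\<close>)
  moreover have "fiber A q \<inter> cdom ?c = cinv ?c ` range h"
  proof -
    have "\<eta> \<in> range (tvec_of A c q)" if "\<eta> \<in> tangent_vectors A q" for \<eta>
      using tangent_eq_tvec_of[OF ch that] by blast
    then show ?thesis using q tvec_of_tangent[OF ch]
      by (auto simp: fiber_def cdom_induced inv image_image)
  qed
  ultimately have "local_param TB (fiber A q) ?c h UNIV"
    using c unfolding local_param_def by (auto simp: tangent_bundle_def fh inj_def)
  moreover have "cinv ?c (h (\<xi> c)) = (q, \<xi>)" using inv tangent_eq_tvec_of[OF ch \<xi>] by simp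
  ultimately show ?thesis unfolding tangent_space_def using fh[of "\<xi> c"]
    by (smt (verit, best) UNIV_I mem_Collect_eq)
qed

text \<open>If the projection were an isomorphism on a tangent plane, this plane and the vertical one would
  span the whole tangent space.\<close>

lemma nontransversal_kernel:
  fixes U :: "(real^2) set"
  assumes nt: "nontransversal_to_fibers TYPE(real^2) A F"
    and f: "local_param TB F (induced_chart A c) f U" and c: "c \<in> A" and y: "y \<in> U"
  shows "\<exists>a. a \<noteq> 0 \<and> fst (frechet_derivative f (at y) a) = 0"
proof (rule ccontr)
  assume contr: "\<not> ?thesis"
  let ?c = "induced_chart A c" and ?Df = "frechet_derivative f (at y)"
  define p where "p = cinv ?c (f y)"
  have fy: "f y \<in> crange ?c" using f y by (auto simp: local_param_def)
  have pF: "p \<in> F" using f y unfolding local_param_def p_def by blast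
  have pc: "p \<in> cdom ?c" "cmap ?c p = f y"
    using cinv_cdom[OF fy] cmap_cinv[OF fy] by (simp_all add: p_def)
  obtain q \<xi> where p: "p = (q, \<xi>)" "q \<in> cdom c" "\<xi> \<in> tangent_vectors A q"
    using pc by (auto simp: cdom_induced)
  have TBc: "?c \<in> TB" using c by (simp add: tangent_bundle_def)
  have ch: "chart_at TB p ?c" using TBc pc by (simp add: chart_at_def)
  have sm: "smooth_on U f" using f by (simp add: local_param_def)
  have lin: "linear (\<lambda>a. fst (?Df a))"
    using has_derivative_linear[OF smooth_on_has_derivative[OF sm y]] linear_compose[OF _ linear_fst]
    by (auto simp: o_def)
  have "inj (\<lambda>a. fst (?Df a))"
    using contr by (subst linear_injective_0[OF lin]) blast
  then have surj: "surj (\<lambda>a. fst (?Df a))" using lin by (rule_tac linear_inj_imp_surj)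
  have tangent: "tangent_space TYPE(real^2) TB N p \<subseteq> tangent_vectors TB p" for N
  proof
    fix v assume "v \<in> tangent_space TYPE(real^2) TB N p"
    then obtain d h and W :: "(real^2) set" and u a where
      v: "v = tvec_of TB d p (frechet_derivative h (at u) a)" and h: "local_param TB N d h W" "u \<in> W" "cinv d (h u) = p"
      unfolding tangent_space_def by blast
    then have "d \<in> TB" "h u \<in> crange d" by (auto simp: local_param_def)
    then have "chart_at TB p d" using cinv_cdom[of "h u" d] h(3) by (simp add: chart_at_def)
    then show "v \<in> tangent_vectors TB p" unfolding v by (rule TB.tvec_of_tangent)
  qed
  have "{tvec_add v w | v w. v \<in> tangent_space TYPE(real^2) TB F p \<and>
      w \<in> tangent_space TYPE(real^2) TB (fiber A (fst p)) p} = tangent_vectors TB p"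
  proof (intro equalityI subsetI)
    fix V assume "V \<in> {tvec_add v w | v w. v \<in> tangent_space TYPE(real^2) TB F p \<and>
      w \<in> tangent_space TYPE(real^2) TB (fiber A (fst p)) p}"
    then show "V \<in> tangent_vectors TB p" using tangent TB.tangent_vectors_add by blast
  next
    fix V assume V: "V \<in> tangent_vectors TB p"
    obtain a where a: "fst (V ?c) = fst (?Df a)" using surj by (metis surjD)
    let ?v = "tvec_of TB ?c p (?Df a)" and ?w = "tvec_of TB ?c p (0, snd (V ?c) - snd (?Df a))"
    have "?Df a + (0, snd (V ?c) - snd (?Df a)) = V ?c" by (simp add: prod_eq_iff a)
    then have "V = tvec_add ?v ?w"
      using TB.tangent_eq_tvec_of[OF ch V] TB.tvec_of_add[OF ch] by simp
    moreover have "?v \<in> tangent_space TYPE(real^2) TB F p"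
      unfolding tangent_space_def using f y p_def by blast
    moreover have "?w \<in> tangent_space TYPE(real^2) TB (fiber A (fst p)) p"
      using vertical_tangent_to_fiber[OF c p(2,3)] by (simp add: p(1))
    ultimately show "V \<in> {tvec_add v w | v w. v \<in> tangent_space TYPE(real^2) TB F p \<and>
      w \<in> tangent_space TYPE(real^2) TB (fiber A (fst p)) p}" by blast
  qed
  then show False using nt pF unfolding nontransversal_to_fibers_def transversal_at_def by blast
qed

end


section \<open>Totally geodesic surfaces tangent to vertical directions\<close>

locale totally_geodesic_patch = surface_metric D G for D :: "(real^2) set" and G +
  fixes f :: "real^2 \<Rightarrow> (real^2) \<times> (real^2)" and U :: "(real^2) set"
  assumes open_U: "open U" and smooth_f: "smooth_on U f"
    and f_D: "y \<in> U \<Longrightarrow> fst (f y) \<in> D"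
    and inj_f: "inj_on f U"
    and immersion: "y \<in> U \<Longrightarrow> inj (frechet_derivative f (at y))"
    and kernel: "y \<in> U \<Longrightarrow> \<exists>a. a \<noteq> 0 \<and> fst (frechet_derivative f (at y) a) = 0"
    and geodesic: "y \<in> U \<Longrightarrow> frechet_derivative (\<lambda>z. frechet_derivative f (at z) a) (at y) b
        + christoffel sas (f y) (frechet_derivative f (at y) a) (frechet_derivative f (at y) b)
        \<in> range (frechet_derivative f (at y))"
    and curved: "x \<in> D \<Longrightarrow> gauss_curvature G x \<noteq> 0"
begin

abbreviation Df where "Df y \<equiv> frechet_derivative f (at y)"
abbreviation D2f where "D2f y a \<equiv> frechet_derivative (\<lambda>z. Df z a) (at y)"
abbreviation X where "X y \<equiv> fst (f y)"
abbreviation \<Xi> where "\<Xi> y \<equiv> snd (f y)"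

lemma f_deriv: "y \<in> U \<Longrightarrow> (f has_derivative Df y) (at y)"
  by (rule smooth_on_has_derivative[OF smooth_f])

lemma X_deriv: "y \<in> U \<Longrightarrow> (X has_derivative (\<lambda>h. fst (Df y h))) (at y)"
  and \<Xi>_deriv: "y \<in> U \<Longrightarrow> (\<Xi> has_derivative (\<lambda>h. snd (Df y h))) (at y)"
  using f_deriv by (auto intro: has_derivative_fst has_derivative_snd)

lemma Df_linear: "y \<in> U \<Longrightarrow> linear (Df y)"
  using f_deriv has_derivative_linear by blast

lemmas Df_simps = linear_add[OF Df_linear] linear_cmul[OF Df_linear] linear_0[OF Df_linear]
  linear_diff[OF Df_linear]

lemma Df_eq_0: "y \<in> U \<Longrightarrow> Df y a = 0 \<Longrightarrow> a = 0"
  using immersion[of y] linear_injective_0[OF Df_linear] by blast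

lemma Df_differentiable: "y \<in> U \<Longrightarrow> (\<lambda>z. Df z a) differentiable (at y)"
  using smooth_on_frechet[OF smooth_f] smooth_on_differentiable by blast

lemma D2f_linear: "y \<in> U \<Longrightarrow> linear (D2f y a)"
  using has_derivative_linear[OF smooth_on_has_derivative[OF smooth_on_frechet[OF smooth_f]]] .

lemma D2f_lin1: "y \<in> U \<Longrightarrow> linear (\<lambda>a. D2f y a b)"
  using linear_frechet_family[OF open_U _ Df_linear Df_differentiable] .

lemma D2f_sym: "y \<in> U \<Longrightarrow> D2f y a b = D2f y b a"
  using frechet_derivative_commute[OF open_U _ smooth_f] .

lemma range_add: "y \<in> U \<Longrightarrow> v \<in> range (Df y) \<Longrightarrow> w \<in> range (Df y) \<Longrightarrow> v + w \<in> range (Df y)"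
  by (auto simp: Df_simps[symmetric])

lemma smooth_X: "smooth_on U X" and smooth_\<Xi>: "smooth_on U \<Xi>"
  by (intro smooth_on_bounded_linear[OF open_U _ smooth_f] bounded_linear_fst bounded_linear_snd)+

end

text \<open>Where the projection has rank one, it has a coordinate with nonzero derivative in a fixed
  direction.\<close>

locale regular_patch = totally_geodesic_patch D G f U
  for D :: "(real^2) set" and G f and U :: "(real^2) set" +
  fixes i :: 2 and m :: "real^2"
  assumes nonzero: "y \<in> U \<Longrightarrow> fst (frechet_derivative f (at y) m) $ i \<noteq> 0"
begin

abbreviation u where "u y \<equiv> fst (Df y m)"

text \<open>The gradient of the coordinate, rotated: a smooth field that spans the kernel of the projection.\<close>

definition k where "k y = (fst (Df y e1) $ i) *\<^sub>R e2 - (fst (Df y e2) $ i) *\<^sub>R e1"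

definition v where "v y = snd (Df y (k y))"

lemma u_nonzero: "y \<in> U \<Longrightarrow> u y \<noteq> 0"
  using nonzero by force

lemma area_k: "y \<in> U \<Longrightarrow> area (k y) a = - (fst (Df y a) $ i)"
proof -
  assume y: "y \<in> U"
  have "fst (Df y a) $ i = fst (Df y (a$1 *\<^sub>R e1 + a$2 *\<^sub>R e2)) $ i" using vec2_expand[of a] by simp
  then show ?thesis by (simp add: Df_simps[OF y] k_def area_def axis_def algebra_simps)
qed

lemma k_nonzero: "y \<in> U \<Longrightarrow> k y \<noteq> 0"
  using area_k[of y m] nonzero[of y] by (auto simp: area_def)

lemma projection_k: assumes y: "y \<in> U" shows "fst (Df y (k y)) = 0"
proof -
  obtain a where a: "a \<noteq> 0" "fst (Df y a) = 0" using kernel[OF y] by blast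
  then have "area (k y) a = 0" using area_k[OF y, of a] by simp
  from area_eq_0D[OF this a(1)] obtain r where "k y = r *\<^sub>R a" by blast
  then show ?thesis using a(2) by (simp add: Df_simps[OF y])
qed

lemma Df_k: "y \<in> U \<Longrightarrow> Df y (k y) = (0, v y)"
  by (simp add: prod_eq_iff projection_k v_def)

lemma v_nonzero: "y \<in> U \<Longrightarrow> v y \<noteq> 0"
  using Df_k[of y] Df_eq_0[of y "k y"] k_nonzero[of y] by (auto simp: zero_prod_def)

lemma frame: assumes y: "y \<in> U" obtains \<beta> \<kappa> where "b = \<beta> *\<^sub>R m + \<kappa> *\<^sub>R k y"
proof -
  define \<beta> where "\<beta> = fst (Df y b) $ i / fst (Df y m) $ i"
  have "area (k y) (b - \<beta> *\<^sub>R m) = 0"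
    using nonzero[OF y] unfolding area_k[OF y] by (simp add: Df_simps[OF y] \<beta>_def)
  then have "area (b - \<beta> *\<^sub>R m) (k y) = 0" using area_swap by (metis neg_0_equal_iff_equal)
  from area_eq_0D[OF this k_nonzero[OF y]] obtain \<kappa> where "b - \<beta> *\<^sub>R m = \<kappa> *\<^sub>R k y" by blast
  then show ?thesis using that[of \<beta> \<kappa>] by (simp add: algebra_simps)
qed

lemma projection_range:
  assumes y: "y \<in> U" and w: "w \<in> range (Df y)" shows "\<exists>\<beta>. fst w = \<beta> *\<^sub>R u y"
proof -
  obtain b where b: "w = Df y b" using w by blast
  obtain \<beta> \<kappa> where "b = \<beta> *\<^sub>R m + \<kappa> *\<^sub>R k y" by (rule frame[OF y])
  then show ?thesis using b by (auto simp: Df_simps[OF y] projection_k[OF y])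
qed

lemma vertical_range:
  assumes y: "y \<in> U" and w: "w \<in> range (Df y)" "fst w = 0" shows "\<exists>\<kappa>. snd w = \<kappa> *\<^sub>R v y"
proof -
  obtain b where b: "w = Df y b" using w by blast
  obtain \<beta> \<kappa> where bb: "b = \<beta> *\<^sub>R m + \<kappa> *\<^sub>R k y" by (rule frame[OF y])
  then have "\<beta> *\<^sub>R u y = 0" using b w(2) by (simp add: Df_simps[OF y] projection_k[OF y])
  then have "\<beta> = 0" using u_nonzero[OF y] by simp
  then show ?thesis using b bb by (auto simp: Df_simps[OF y] v_def)
qed

lemma smooth_k: "smooth_on U k"
proof -
  have "bounded_linear (\<lambda>w :: (real^2) \<times> (real^2). fst w $ i)"
    using bounded_linear_compose[OF bounded_linear_vec_nth bounded_linear_fst] .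
  then have "smooth_on U (\<lambda>y. fst (Df y a) $ i)" for a
    by (rule smooth_on_bounded_linear[OF open_U _ smooth_on_frechet[OF smooth_f]])
  then show ?thesis unfolding k_def[abs_def]
    by (intro smooth_on_minus smooth_on_scaleR smooth_on_const open_U)
qed

lemma smooth_v: "smooth_on U v"
proof -
  have "smooth_on U (\<lambda>y. Df y (k y))"
    by (rule smooth_on_linear_family[of U "\<lambda>y. y"])
      (auto intro: open_U Df_linear smooth_on_frechet smooth_f smooth_k smooth_on_linear)
  then show ?thesis unfolding v_def[abs_def]
    by (rule smooth_on_bounded_linear[OF open_U bounded_linear_snd])
qed

abbreviation Dk where "Dk y \<equiv> frechet_derivative k (at y)"
abbreviation Dv where "Dv y \<equiv> frechet_derivative v (at y)"

lemma v_deriv: "y \<in> U \<Longrightarrow> (v has_derivative Dv y) (at y)"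
  by (rule smooth_on_has_derivative[OF smooth_v])

lemma D2f_k: assumes y: "y \<in> U" shows "D2f y (k y) b + Df y (Dk y b) = (0, Dv y b)"
proof -
  have "((\<lambda>z. Df z (k z)) has_derivative (\<lambda>b. D2f y (k y) b + Df y (Dk y b))) (at y)"
    by (rule has_derivative_linear_family[of U "\<lambda>y. y"])
      (auto intro: open_U y Df_linear Df_differentiable smooth_on_has_derivative[OF smooth_k y])
  moreover have "((\<lambda>z. Df z (k z)) has_derivative (\<lambda>b. (0, Dv y b))) (at y)"
    by (rule has_derivative_transform_within_open[OF has_derivative_Pair[OF has_derivative_const v_deriv[OF y]] open_U y])
      (simp add: Df_k)
  ultimately show ?thesis by (rule fun_cong[OF has_derivative_unique])
qed

text \<open>The hypothesis concerns fields with constant coefficients in the parameters. The vertical field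
  \<open>(0, v)\<close> has the coefficients \<open>k\<close>, whose derivatives contribute tangent vectors only.\<close>

lemma vertical_derivative_tangent:
  assumes y: "y \<in> U"
  shows "(0, Dv y b) + christoffel sas (f y) (Df y b) (0, v y) \<in> range (Df y)"
proof -
  have "D2f y b (k y) + christoffel sas (f y) (Df y b) (0, v y) \<in> range (Df y)"
    using geodesic[OF y, of b "k y"] by (simp add: Df_k[OF y])
  from range_add[OF y this rangeI[of "Df y" "Dk y b"]] show ?thesis
    unfolding D2f_k[OF y, of b, symmetric] D2f_sym[OF y, of b "k y"] by (simp add: algebra_simps)
qed

text \<open>The horizontal part \<open>R(\<xi>, v)u / 2\<close> of the covariant derivative of the vertical field is orthogonal
  to \<open>u\<close>, by skew symmetry, and a multiple of \<open>u\<close>, as the derivative is tangent to the surface. So it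
  vanishes; as the curvature is nonzero, this forces \<open>\<xi>\<close> and \<open>v\<close> to be parallel.\<close>

lemma fiber_direction: assumes y: "y \<in> U" shows "area (\<Xi> y) (v y) = 0"
proof -
  have x: "X y \<in> D" by (rule f_D[OF y])
  let ?Z = "christoffel sas (f y) (Df y m) (0, v y)"
  have Z: "2 * G (X y) (fst ?Z) w = G (X y) (R (X y) (u y) w (\<Xi> y)) (v y)" for w
    using christoffel_sas_vertical(2)[OF x, of "\<Xi> y" "u y" "snd (Df y m)" "v y" w] by simp
  obtain \<beta> where \<beta>: "fst ?Z = \<beta> *\<^sub>R u y"
    using projection_range[OF y vertical_derivative_tangent[OF y, of m]] by auto
  have "\<beta> * G (X y) (u y) (u y) = 0"
    using Z[of "u y"] by (simp add: \<beta> G_simps[OF x] curvature_area[OF x, of "u y" "u y"] area_def)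
  then have "\<beta> = 0" using u_nonzero[OF y] G_eq_0[OF x] by simp
  then have R0: "G (X y) (R (X y) (u y) w (\<Xi> y)) (v y) = 0" for w
    using Z[of w] by (simp add: \<beta> G_simps[OF x])
  \<comment> \<open>A vector independent of \<open>u\<close>: the rotation of \<open>u\<close> by a right angle.\<close>
  let ?w = "(u y $ 1) *\<^sub>R e2 - (u y $ 2) *\<^sub>R e1"
  have "area (u y) ?w = u y \<bullet> u y" by (simp add: area_def axis_def inner_vec_def sum_2)
  then have "area (u y) ?w \<noteq> 0" using u_nonzero[OF y] by simp
  then show ?thesis using curvature_nondegenerate[OF x curved[OF x] _ R0] by blast
qed

text \<open>Consequently the horizontal part vanishes in every direction, and what remains of tangency says
  that the direction of \<open>v\<close> is parallel.\<close>

lemma v_parallel: assumes y: "y \<in> U" shows "\<exists>\<kappa>. Dv y b + \<Gamma> (X y) (fst (Df y b)) (v y) = \<kappa> *\<^sub>R v y"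
proof -
  have x: "X y \<in> D" by (rule f_D[OF y])
  let ?Z = "christoffel sas (f y) (Df y b) (0, v y)"
  note Z = christoffel_sas_vertical[OF x, of "\<Xi> y" "fst (Df y b)" "snd (Df y b)" "v y", unfolded prod.collapse]
  have "fst ?Z = 0"
    by (rule vector_eqI[OF x]) (use Z(2) in \<open>simp add: curvature_area[OF x, of "fst (Df y b)" _ "\<Xi> y" "v y"] fiber_direction[OF y] G_simps[OF x]\<close>)
  moreover from this have "snd ?Z = \<Gamma> (X y) (fst (Df y b)) (v y)"
    using Z(1) by (simp add: vert_def \<Gamma>_simps[OF x])
  ultimately show ?thesis
    using vertical_range[OF y vertical_derivative_tangent[OF y, of b]] by simp
qed

definition ratio where "ratio y = (\<Xi> y \<bullet> v y) / (v y \<bullet> v y)"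

lemma \<Xi>_eq: "y \<in> U \<Longrightarrow> \<Xi> y = ratio y *\<^sub>R v y"
  unfolding ratio_def by (rule area_eq_0D[OF fiber_direction v_nonzero])

lemma vert_tangent: assumes y: "y \<in> U" shows "\<exists>\<kappa>. vert (f y) (Df y b) = \<kappa> *\<^sub>R v y"
proof -
  have x: "X y \<in> D" by (rule f_D[OF y])
  have "(\<lambda>z. (\<Xi> z \<bullet> v z) / (v z \<bullet> v z)) differentiable (at y)"
    by (intro differentiable_divide differentiable_inner smooth_on_differentiable[OF smooth_v y]
        smooth_on_differentiable[OF smooth_\<Xi> y]) (use v_nonzero[OF y] in simp)
  then have "ratio differentiable (at y)" by (simp add: ratio_def[abs_def])
  then have "(ratio has_derivative frechet_derivative ratio (at y)) (at y)" (is "(_ has_derivative ?D) _")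
    using frechet_derivative_works by blast
  then have "((\<lambda>z. ratio z *\<^sub>R v z) has_derivative (\<lambda>h. ratio y *\<^sub>R Dv y h + ?D h *\<^sub>R v y)) (at y)"
    by (rule has_derivative_scaleR[OF _ v_deriv[OF y]])
  then have "(\<Xi> has_derivative (\<lambda>h. ratio y *\<^sub>R Dv y h + ?D h *\<^sub>R v y)) (at y)"
    by (rule has_derivative_transform_within_open[OF _ open_U y]) (simp add: \<Xi>_eq)
  with \<Xi>_deriv[OF y] have "(\<lambda>h. snd (Df y h)) = (\<lambda>h. ratio y *\<^sub>R Dv y h + ?D h *\<^sub>R v y)"
    by (rule has_derivative_unique)
  then have 1: "snd (Df y b) = ratio y *\<^sub>R Dv y b + ?D b *\<^sub>R v y" by (rule fun_cong)
  obtain \<kappa> where \<kappa>: "Dv y b + \<Gamma> (X y) (fst (Df y b)) (v y) = \<kappa> *\<^sub>R v y" using v_parallel[OF y] by blast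
  have "vert (f y) (Df y b) = ratio y *\<^sub>R (Dv y b + \<Gamma> (X y) (fst (Df y b)) (v y)) + ?D b *\<^sub>R v y"
    unfolding vert_def 1 by (simp add: \<Xi>_eq[OF y] \<Gamma>_simps[OF x] \<Gamma>_sym[OF x, of "v y"] algebra_simps)
  also have "\<dots> = (ratio y * \<kappa> + ?D b) *\<^sub>R v y" by (simp add: \<kappa> algebra_simps)
  finally show ?thesis by blast
qed

lemma horizontal_vector:
  assumes y: "y \<in> U" obtains \<kappa> where "vert (f y) (Df y (m - \<kappa> *\<^sub>R k y)) = 0"
    "fst (Df y (m - \<kappa> *\<^sub>R k y)) = u y"
proof -
  have x: "X y \<in> D" by (rule f_D[OF y])
  obtain \<kappa> where \<kappa>: "vert (f y) (Df y m) = \<kappa> *\<^sub>R v y" using vert_tangent[OF y] by blast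
  have p: "fst (Df y (m - \<kappa> *\<^sub>R k y)) = u y" by (simp add: Df_simps[OF y] projection_k[OF y])
  have "vert (f y) (Df y (m - \<kappa> *\<^sub>R k y)) = vert (f y) (Df y m) - \<kappa> *\<^sub>R v y"
    unfolding vert_def p by (simp add: Df_simps[OF y] v_def)
  then show ?thesis using that p \<kappa> by simp
qed

text \<open>In the horizontal direction over \<open>u\<close>, tangency of the covariant derivative projects to the base.
  That direction is \<open>m - \<kappa> k\<close>; replacing it by \<open>m\<close> changes the second derivative of the projection by
  multiples of \<open>u\<close>, as follows from differentiating the equation that \<open>k\<close> projects to zero.\<close>

lemma pregeodesic:
  assumes y: "y \<in> U" shows "\<exists>\<beta>. fst (D2f y m m) + \<Gamma> (X y) (u y) (u y) = \<beta> *\<^sub>R u y"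
proof -
  have x: "X y \<in> D" by (rule f_D[OF y])
  obtain \<kappa> where \<kappa>: "vert (f y) (Df y (m - \<kappa> *\<^sub>R k y)) = 0" "fst (Df y (m - \<kappa> *\<^sub>R k y)) = u y"
    by (rule horizontal_vector[OF y])
  let ?b = "m - \<kappa> *\<^sub>R k y"
  have "fst (christoffel sas (f y) (Df y ?b) (Df y ?b)) = \<Gamma> (X y) (u y) (u y)"
    using christoffel_sas_horizontal[OF x, of "\<Xi> y" "Df y ?b"] \<kappa> by simp
  then obtain \<beta> where \<beta>: "fst (D2f y ?b ?b) + \<Gamma> (X y) (u y) (u y) = \<beta> *\<^sub>R u y"
    using projection_range[OF y geodesic[OF y, of ?b ?b]] by auto
  have k: "\<exists>\<beta>. fst (D2f y (k y) h) = \<beta> *\<^sub>R u y" for h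
  proof -
    obtain r where "fst (Df y (Dk y h)) = r *\<^sub>R u y" using projection_range[OF y] by blast
    moreover have "fst (D2f y (k y) h) + fst (Df y (Dk y h)) = 0"
      using arg_cong[OF D2f_k[OF y, of h], of fst] by simp
    ultimately have "fst (D2f y (k y) h) = (- r) *\<^sub>R u y" by (simp add: eq_neg_iff_add_eq_0)
    then show ?thesis by blast
  qed
  obtain r s where r: "fst (D2f y (k y) m) = r *\<^sub>R u y" and s: "fst (D2f y (k y) (k y)) = s *\<^sub>R u y"
    using k by blast
  have "D2f y ?b ?b = D2f y m m - \<kappa> *\<^sub>R D2f y (k y) m - \<kappa> *\<^sub>R D2f y m (k y) + (\<kappa> * \<kappa>) *\<^sub>R D2f y (k y) (k y)"
    by (simp add: linear_diff[OF D2f_linear[OF y]] linear_cmul[OF D2f_linear[OF y]]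
        linear_diff[OF D2f_lin1[OF y]] linear_cmul[OF D2f_lin1[OF y]] algebra_simps)
  then have "fst (D2f y ?b ?b) = fst (D2f y m m) - \<kappa> *\<^sub>R fst (D2f y (k y) m) - \<kappa> *\<^sub>R fst (D2f y m (k y))
      + (\<kappa> * \<kappa>) *\<^sub>R fst (D2f y (k y) (k y))"
    by simp
  then have "fst (D2f y ?b ?b) = fst (D2f y m m) - (\<kappa> * r + \<kappa> * r - \<kappa> * \<kappa> * s) *\<^sub>R u y"
    unfolding D2f_sym[OF y, of m "k y"] r s by (simp only: scaleR_scaleR scaleR_add_left scaleR_diff_left algebra_simps)
  then have "fst (D2f y m m) + \<Gamma> (X y) (u y) (u y) = (fst (D2f y ?b ?b) + \<Gamma> (X y) (u y) (u y))
      + (\<kappa> * r + \<kappa> * r - \<kappa> * \<kappa> * s) *\<^sub>R u y"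
    by simp
  also have "\<dots> = (\<beta> + (\<kappa> * r + \<kappa> * r - \<kappa> * \<kappa> * s)) *\<^sub>R u y"
    unfolding \<beta> by (simp only: scaleR_add_left)
  finally show ?thesis by blast
qed

definition e where "e y = inverse (sqrt (G (X y) (v y) (v y))) *\<^sub>R v y"

lemma G_v_pos: "y \<in> U \<Longrightarrow> G (X y) (v y) (v y) > 0"
  using pos f_D v_nonzero by blast

lemma e_unit: assumes y: "y \<in> U" shows "G (X y) (e y) (e y) = 1"
  using G_v_pos[OF y] by (simp add: e_def G_simps[OF f_D[OF y]] divide_simps flip: power2_eq_square)

lemma smooth_e: "smooth_on U e"
  unfolding e_def[abs_def]
  by (intro smooth_on_scaleR smooth_on_inverse smooth_on_sqrt smooth_on_bilinear_family[OF open_D _ open_U bil smooth]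
      smooth_X smooth_v open_U G_v_pos) (use f_D G_v_pos in force)+

lemma \<Xi>_e: assumes y: "y \<in> U" shows "\<Xi> y = G (X y) (\<Xi> y) (e y) *\<^sub>R e y"
proof -
  have "\<Xi> y = (ratio y * sqrt (G (X y) (v y) (v y))) *\<^sub>R e y"
    using G_v_pos[OF y] \<Xi>_eq[OF y] by (simp add: e_def)
  then obtain r where r: "\<Xi> y = r *\<^sub>R e y" by blast
  then have "G (X y) (\<Xi> y) (e y) = r" by (simp add: G_simps[OF f_D[OF y]] e_unit[OF y])
  then show ?thesis using r by simp
qed

lemma e_parallel: assumes y: "y \<in> U"
  shows "frechet_derivative e (at y) b + \<Gamma> (X y) (fst (Df y b)) (e y) = 0"
proof -
  have x: "X y \<in> D" by (rule f_D[OF y])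
  have de: "(e has_derivative frechet_derivative e (at y)) (at y)"
    by (rule smooth_on_has_derivative[OF smooth_e y])
  let ?n = "\<lambda>z. inverse (sqrt (G (X z) (v z) (v z)))"
  have "smooth_on U ?n"
    by (intro smooth_on_inverse smooth_on_sqrt smooth_on_bilinear_family[OF open_D _ open_U bil smooth]
      smooth_X smooth_v open_U G_v_pos) (use f_D G_v_pos in force)+
  from smooth_on_has_derivative[OF this y] obtain n' where "(?n has_derivative n') (at y)" by blast
  then have "((\<lambda>z. ?n z *\<^sub>R v z) has_derivative (\<lambda>h. ?n y *\<^sub>R Dv y h + n' h *\<^sub>R v y)) (at y)"
    by (rule has_derivative_scaleR[OF _ v_deriv[OF y]])
  then have "(e has_derivative (\<lambda>h. ?n y *\<^sub>R Dv y h + n' h *\<^sub>R v y)) (at y)" by (simp add: e_def[abs_def])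
  from fun_cong[OF has_derivative_unique[OF de this], of b]
  have 1: "frechet_derivative e (at y) b = ?n y *\<^sub>R Dv y b + n' b *\<^sub>R v y" .
  obtain \<kappa> where \<kappa>: "Dv y b + \<Gamma> (X y) (fst (Df y b)) (v y) = \<kappa> *\<^sub>R v y" using v_parallel[OF y] by blast
  have "frechet_derivative e (at y) b + \<Gamma> (X y) (fst (Df y b)) (e y) =
      ?n y *\<^sub>R (Dv y b + \<Gamma> (X y) (fst (Df y b)) (v y)) + n' b *\<^sub>R v y"
    unfolding 1 by (simp add: e_def \<Gamma>_simps[OF x] algebra_simps)
  also have "\<dots> = (?n y * \<kappa> + n' b) *\<^sub>R v y" by (simp add: \<kappa> algebra_simps)
  also have "\<dots> = ((?n y * \<kappa> + n' b) * sqrt (G (X y) (v y) (v y))) *\<^sub>R e y"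
    using G_v_pos[OF y] by (simp add: e_def)
  finally obtain r where r: "frechet_derivative e (at y) b + \<Gamma> (X y) (fst (Df y b)) (e y) = r *\<^sub>R e y" by blast
  show ?thesis by (rule unit_field_parallel[OF open_U y e_unit x X_deriv[OF y] de r])
qed

end


section \<open>The fibration by level curves\<close>

text \<open>Where the derivative of \<open>\<phi>\<close> in the direction \<open>m\<close> does not vanish, level curves of \<open>\<phi>\<close> cross the line
  in the direction \<open>m\<close> transversally; \<open>\<tau> y\<close> is the parameter at which the one through \<open>y\<close> does. A map
  \<open>\<psi>\<close> whose derivative vanishes on the kernel of that of \<open>\<phi>\<close> is constant on level curves. The proof
  straightens them by the inverse function theorem, applied to \<open>\<phi>\<close> and the linear coordinate
  \<open>area m\<close>, which is constant on the line.\<close>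

lemma level_curves:
  fixes \<phi> :: "real^2 \<Rightarrow> real" and m y0 :: "real^2"
  assumes U: "open U" "y0 \<in> U" and \<phi>: "smooth_on U \<phi>"
    and m: "frechet_derivative \<phi> (at y0) m \<noteq> 0"
  obtains N \<tau> where "open N" "y0 \<in> N" "N \<subseteq> U" "continuous_on N \<tau>" "\<tau> y0 = 0"
    "\<And>(\<psi> :: real^2 \<Rightarrow> real^2) \<psi>' y. (\<And>y. y \<in> U \<Longrightarrow> (\<psi> has_derivative \<psi>' y) (at y)) \<Longrightarrow>
       (\<And>y a. y \<in> U \<Longrightarrow> frechet_derivative \<phi> (at y) a = 0 \<Longrightarrow> \<psi>' y a = 0) \<Longrightarrow>
       y \<in> N \<Longrightarrow> \<psi> y = \<psi> (y0 + \<tau> y *\<^sub>R m)"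
proof -
  let ?D = "\<lambda>y. frechet_derivative \<phi> (at y)"
  have D: "(\<phi> has_derivative ?D y) (at y)" if "y \<in> U" for y
    by (rule smooth_on_has_derivative[OF \<phi> that])
  have m0: "m \<noteq> 0" using m linear_0[OF has_derivative_linear[OF D[OF U(2)]]] by auto
  define H where "H y = \<phi> y *\<^sub>R e1 + area m y *\<^sub>R e2" for y
  define H' where "H' y a = ?D y a *\<^sub>R e1 + area m a *\<^sub>R e2" for y a
  have H1: "H y $ 1 = \<phi> y" "H y $ 2 = area m y" "H' y a $ 1 = ?D y a" "H' y a $ 2 = area m a" for y a
    by (simp_all add: H_def H'_def axis_def)
  have area_lin: "bounded_linear (area m)"
    by (rule linear_conv_bounded_linear[THEN iffD1], rule linearI) (simp_all add: area_def algebra_simps)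
  have derH: "(H has_derivative H' y) (at y)" if "y \<in> U" for y
    unfolding H_def[abs_def] H'_def[abs_def]
    by (intro has_derivative_add has_derivative_scaleR_left D that bounded_linear_imp_has_derivative area_lin)
  have blH: "bounded_linear (H' y)" if "y \<in> U" for y using derH[OF that] has_derivative_bounded_linear by blast
  define B where "B y = Blinfun (H' y)" for y
  have B: "blinfun_apply (B y) = H' y" if "y \<in> U" for y
    unfolding B_def by (rule bounded_linear_Blinfun_apply[OF blH[OF that]])
  have contB: "continuous_on U B"
  proof (rule continuous_on_blinfun_componentwise)
    fix i :: "real^2" 
    have "continuous_on U (\<lambda>y. H' y i)" unfolding H'_def
      by (intro continuous_intros smooth_on_continuous smooth_on_frechet \<phi>)
    then show "continuous_on U (\<lambda>y. blinfun_apply (B y) i)"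
      by (rule continuous_on_eq) (simp add: B)
  qed
  have "inj (H' y0)"
  proof (subst linear_injective_0[OF bounded_linear.linear[OF blH[OF U(2)]]], intro allI impI)
    fix a assume a: "H' y0 a = 0"
    then have "area a m = 0" "?D y0 a = 0" using H1(3,4)[of y0 a] by (simp_all add: area_def algebra_simps)
    from area_eq_0D[OF this(1) m0] obtain r where r: "a = r *\<^sub>R m" by blast
    then have "r * ?D y0 m = 0"
      using \<open>?D y0 a = 0\<close> linear_cmul[OF has_derivative_linear[OF D[OF U(2)]]] by simp
    then show "a = 0" using m r by simp
  qed
  then obtain K where K: "linear K" "K \<circ> H' y0 = id"
    using linear_injective_left_inverse[OF bounded_linear.linear[OF blH[OF U(2)]]] by blast
  have KB: "Blinfun K o\<^sub>L B y0 = id_blinfun"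
    by (rule blinfun_eqI) (use K in \<open>simp add: B[OF U(2)] bounded_linear_Blinfun_apply linear_conv_bounded_linear pointfree_idE\<close>)
  obtain U' V h h' where U': "open U'" "U' \<subseteq> U" "y0 \<in> U'" "open V" "H y0 \<in> V" "homeomorphism U' V H h"
    and h: "\<And>w. w \<in> V \<Longrightarrow> (h has_derivative (h' w)) (at w)"
    and h': "\<And>w. w \<in> V \<Longrightarrow> h' w = inv (blinfun_apply (B (h w)))"
    and bij: "\<And>w. w \<in> V \<Longrightarrow> bij (blinfun_apply (B (h w)))"
    using inverse_function_theorem[of U H B y0 "Blinfun K"] U derH B contB KB by metis
  have hV: "h w \<in> U'" "H (h w) = w" if "w \<in> V" for w
    using homeomorphism_apply2[OF U'(6) that] homeomorphism_image2[OF U'(6)] that by auto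
  have hH: "h (H y) = y" if "y \<in> U'" for y by (rule homeomorphism_apply1[OF U'(6) that])
  have hder: "H' (h w) (h' w a) = a" if "w \<in> V" for w a
    using surj_f_inv_f[OF bij_is_surj[OF bij[OF that]]] hV(1)[OF that] U'(2) by (simp add: h'[OF that] B subsetD)
  obtain \<rho> where \<rho>: "\<rho> > 0" "ball (H y0) \<rho> \<subseteq> V" using U'(4,5) openE by blast
  define N where "N = U' \<inter> H -` ball (H y0) \<rho>"
  \<comment> \<open>In straightened coordinates, the projection along level curves to the line.\<close>
  define q where "q w = (w $ 1) *\<^sub>R e1 + (area m y0) *\<^sub>R e2" for w :: "real^2"
  have q1: "q w $ 1 = w $ 1" "q w $ 2 = area m y0" for w by (simp_all add: q_def axis_def)
  have qball: "q w \<in> ball (H y0) \<rho>" if "w \<in> ball (H y0) \<rho>" for w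
  proof -
    have "q w - H y0 = (w - H y0) $ 1 *\<^sub>R e1" by (simp add: vec_eq_iff forall_2 q1 H1 axis_def)
    then have "norm (q w - H y0) = \<bar>(w - H y0) $ 1\<bar>" by simp
    also have "\<dots> \<le> norm (w - H y0)" by (rule component_le_norm_cart)
    finally show ?thesis using that by (simp add: dist_norm norm_minus_commute)
  qed
  define \<tau> where "\<tau> y = ((h (q (H y)) - y0) \<bullet> m) / (m \<bullet> m)" for y
  have \<tau>: "y0 + \<tau> y *\<^sub>R m = h (q (H y))" if "y \<in> N" for y
  proof -
    have V: "q (H y) \<in> V" using qball[of "H y"] that \<rho>(2) by (auto simp: N_def)
    have "area m (h (q (H y))) = area m y0" using arg_cong[OF hV(2)[OF V], of "\<lambda>w. w $ 2"] by (simp add: H1 q1)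
    then have "area (h (q (H y)) - y0) m = 0" by (simp add: area_def algebra_simps)
    from area_eq_0D[OF this m0] show ?thesis by (simp add: \<tau>_def algebra_simps)
  qed
  have contH: "continuous_on U' H"
    using U'(6) by (simp add: homeomorphism_def)
  have N: "open N" unfolding N_def by (rule continuous_open_preimage[OF contH U'(1) open_ball])
  have y0N: "y0 \<in> N" using U' \<rho> by (simp add: N_def)
  have "continuous_on N (\<lambda>y. h (q (H y)))"
  proof (rule continuous_on_compose2[of V h])
    show "continuous_on V h" using U'(6) by (simp add: homeomorphism_def)
    show "continuous_on N (\<lambda>y. q (H y))" unfolding q_def
      by (intro continuous_intros continuous_on_subset[OF contH]) (auto simp: N_def)
    show "(\<lambda>y. q (H y)) ` N \<subseteq> V" using qball \<rho>(2) by (auto simp: N_def)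
  qed
  then have cont\<tau>: "continuous_on N \<tau>" unfolding \<tau>_def[abs_def] using m0 by (intro continuous_intros) auto
  have \<tau>0: "\<tau> y0 = 0"
  proof -
    have "q (H y0) = H y0" by (simp add: vec_eq_iff forall_2 q1 H1)
    then show ?thesis using hH[OF U'(3)] by (simp add: \<tau>_def)
  qed
  have level: "\<psi> y = \<psi> (y0 + \<tau> y *\<^sub>R m)"
    if \<psi>: "\<And>y. y \<in> U \<Longrightarrow> (\<psi> has_derivative \<psi>' y) (at y)"
      and ker: "\<And>y a. y \<in> U \<Longrightarrow> ?D y a = 0 \<Longrightarrow> \<psi>' y a = 0" and y: "y \<in> N"
    for \<psi> :: "real^2 \<Rightarrow> real^2" and \<psi>' y
  proof -
    \<comment> \<open>The segment from \<open>q (H y)\<close> to \<open>H y\<close> is a straightened level curve.\<close>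
    define d where "d = H y - q (H y)"
    have d1: "d $ 1 = 0" by (simp add: d_def q1)
    let ?w = "\<lambda>t. q (H y) + t *\<^sub>R d"
    have Hy: "H y \<in> ball (H y0) \<rho>" using y by (simp add: N_def)
    have w: "?w t \<in> V" if "t \<in> {0..1}" for t
    proof -
      have "?w t = (1 - t) *\<^sub>R q (H y) + t *\<^sub>R H y" by (simp add: d_def algebra_simps)
      also have "\<dots> \<in> ball (H y0) \<rho>"
        using that by (intro convexD[OF convex_ball qball[OF Hy] Hy]) auto
      finally show ?thesis using \<rho>(2) by blast
    qed
    have const: "((\<lambda>t. \<psi> (h (?w t))) has_vector_derivative 0) (at t within {0..1})" if t: "t \<in> {0..1}" for t
    proof -
      have hU: "h (?w t) \<in> U" using hV(1)[OF w[OF t]] U'(2) by blast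
      have "(?w has_derivative (\<lambda>r. r *\<^sub>R d)) (at t within {0..1})" by (auto intro!: derivative_eq_intros)
      from has_derivative_compose[OF has_derivative_compose[OF this h[OF w[OF t]]] \<psi>[OF hU]]
      have D1: "((\<lambda>t. \<psi> (h (?w t))) has_derivative (\<lambda>r. \<psi>' (h (?w t)) (h' (?w t) (r *\<^sub>R d)))) (at t within {0..1})" .
      have "?D (h (?w t)) (h' (?w t) (r *\<^sub>R d)) = 0" for r
        using arg_cong[OF hder[OF w[OF t], of "r *\<^sub>R d"], of "\<lambda>w. w $ 1"] by (simp add: H1 d1)
      then show ?thesis using D1 ker[OF hU] by (simp add: has_vector_derivative_def)
    qed
    obtain c where "\<And>t. t \<in> {0..1} \<Longrightarrow> \<psi> (h (?w t)) = c"
      by (rule has_vector_derivative_zero_constant[OF convex_real_interval(5) const]) blast+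
    from this[of 0] this[of 1] have "\<psi> (h (q (H y))) = \<psi> (h (H y))" by (simp add: d_def)
    then show ?thesis using \<tau>[OF y] hH[of y] y by (simp add: N_def)
  qed
  have "N \<subseteq> U" using U'(2) by (auto simp: N_def)
  show thesis by (rule that[OF N y0N \<open>N \<subseteq> U\<close> cont\<tau> \<tau>0 level])
qed


section \<open>Regularity of the projection\<close>

context totally_geodesic_patch
begin

lemma restrict:
  assumes V: "open V" "V \<subseteq> U" shows "totally_geodesic_patch D G f V"
proof (rule totally_geodesic_patch.intro[OF surface_metric_axioms])
  have VU: "y \<in> U" if "y \<in> V" for y using that V(2) by (rule rev_subsetD)
  show "totally_geodesic_patch_axioms D G f V"
    by (rule totally_geodesic_patch_axioms.intro[OF V(1) smooth_on_subset[OF smooth_f V(2)] f_D[OF VU]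
        inj_on_subset[OF inj_f V(2)] immersion[OF VU] kernel[OF VU] geodesic[OF VU] curved])
qed

lemma regular_neighbourhood:
  assumes y: "y \<in> U" and m: "fst (Df y m) \<noteq> 0"
  obtains V i where "y \<in> V" "V \<subseteq> U" "regular_patch D G f V i m"
proof -
  obtain i where i: "fst (Df y m) $ i \<noteq> 0" using m by (auto simp: vec_eq_iff)
  let ?V = "U \<inter> (\<lambda>z. fst (Df z m) $ i) -` {r. r \<noteq> 0}"
  have "continuous_on U (\<lambda>z. fst (Df z m) $ i)"
    by (intro continuous_intros smooth_on_continuous[OF smooth_on_frechet[OF smooth_f]])
  moreover have "open {r :: real. r \<noteq> 0}" by (rule open_Collect_neq) (auto intro: continuous_intros)
  ultimately have "open ?V" using open_U by (intro continuous_open_preimage)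
  then have "totally_geodesic_patch D G f ?V" by (rule restrict) auto
  then have "regular_patch D G f ?V i m"
    by (auto simp: regular_patch_def regular_patch_axioms_def)
  then show thesis by (rule that[rotated 2]) (use i y in auto)
qed

lemma continuous_vert: "continuous_on (U \<times> UNIV) (\<lambda>P. vert (f (fst P)) (Df (fst P) (snd P)))"
proof -
  have o: "open (U \<times> (UNIV :: (real^2) set))" using open_U by (simp add: open_Times)
  have s: "smooth_on (U \<times> (UNIV :: (real^2) set)) (\<lambda>P. Df (fst P) (snd P))"
    by (rule smooth_on_linear_family[of U])
      (auto intro: open_U o Df_linear smooth_on_frechet smooth_f smooth_on_linear bounded_linear_fst bounded_linear_snd)
  have p: "smooth_on (U \<times> (UNIV :: (real^2) set)) (\<lambda>P. X (fst P))" "smooth_on (U \<times> (UNIV :: (real^2) set)) (\<lambda>P. \<Xi> (fst P))"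
    by (rule smooth_on_compose[OF o open_U _ smooth_X smooth_on_linear[OF o bounded_linear_fst]], force)
      (rule smooth_on_compose[OF o open_U _ smooth_\<Xi> smooth_on_linear[OF o bounded_linear_fst]], force)
  have "smooth_on (U \<times> (UNIV :: (real^2) set)) (\<lambda>P. \<Gamma> (X (fst P)) (\<Xi> (fst P)) (fst (Df (fst P) (snd P))))"
    by (rule smooth_on_bilinear_family[OF open_D _ o bilinear_\<Gamma> smooth_\<Gamma> p
          smooth_on_bounded_linear[OF o bounded_linear_fst s]]) (use f_D in force)
  from smooth_on_add[OF o smooth_on_bounded_linear[OF o bounded_linear_snd s] this]
  show ?thesis unfolding vert_def by (rule smooth_on_continuous)
qed

text \<open>A tangent plane at a point where the projection has rank zero would be vertical. It would also be
  a limit of tangent planes at regular points, all of which contain a horizontal direction; by compactness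
  of the unit circle it would contain a horizontal direction itself.\<close>

lemma projection_nonzero:
  assumes dense: "\<And>N. open N \<Longrightarrow> N \<subseteq> U \<Longrightarrow> N \<noteq> {} \<Longrightarrow> \<exists>y\<in>N. \<exists>a. fst (Df y a) \<noteq> 0"
    and y: "y \<in> U"
  shows "\<exists>m. fst (Df y m) \<noteq> 0"
proof -
  have "\<exists>z b. z \<in> U \<and> dist z y < inverse (Suc n) \<and> norm b = 1 \<and> vert (f z) (Df z b) = 0" for n
  proof -
    have "U \<inter> ball y (inverse (Suc n)) \<noteq> {}" using y by (auto intro!: exI[of _ y])
    then have "\<exists>z\<in>U \<inter> ball y (inverse (Suc n)). \<exists>a. fst (Df z a) \<noteq> 0"
      using open_U by (intro dense) auto
    then obtain z a where z: "z \<in> U" "z \<in> ball y (inverse (Suc n))" "fst (Df z a) \<noteq> 0" by blast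
    obtain V i where V: "z \<in> V" "V \<subseteq> U" "regular_patch D G f V i a"
      by (rule regular_neighbourhood[OF z(1,3)])
    interpret V: regular_patch D G f V i a by (rule V(3))
    obtain \<kappa> where \<kappa>: "vert (f z) (Df z (a - \<kappa> *\<^sub>R V.k z)) = 0" "fst (Df z (a - \<kappa> *\<^sub>R V.k z)) = fst (Df z a)"
      by (rule V.horizontal_vector[OF V(1)])
    let ?b = "a - \<kappa> *\<^sub>R V.k z"
    have b: "?b \<noteq> 0" using \<kappa>(2) z(3) by (auto simp: Df_simps[OF z(1)])
    have "vert (f z) (Df z (inverse (norm ?b) *\<^sub>R ?b)) = inverse (norm ?b) *\<^sub>R vert (f z) (Df z ?b)"
      by (simp only: linear_cmul[OF Df_linear[OF z(1)]])
        (simp add: vert_def \<Gamma>_simps[OF f_D[OF z(1)]] scaleR_add_right)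
    then have "vert (f z) (Df z (inverse (norm ?b) *\<^sub>R ?b)) = 0" by (simp only: \<kappa> scaleR_zero_right)
    moreover have "norm (inverse (norm ?b) *\<^sub>R ?b) = 1" using b by simp
    ultimately show ?thesis using z by (metis dist_commute mem_ball)
  qed
  then obtain z b where z: "\<And>n. z n \<in> U" "\<And>n. dist (z n) y < inverse (Suc n)"
    and b: "\<And>n. norm (b n) = 1" "\<And>n. vert (f (z n)) (Df (z n) (b n)) = 0" by metis
  have "z \<longlonglongrightarrow> y"
  proof (rule tendstoI)
    fix \<epsilon> :: real assume "\<epsilon> > 0"
    then have "\<forall>\<^sub>F n in sequentially. inverse (real (Suc n)) < \<epsilon>"
      using LIMSEQ_inverse_real_of_nat order_tendstoD(2) by blast
    then show "\<forall>\<^sub>F n in sequentially. dist (z n) y < \<epsilon>"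
      by (rule eventually_mono) (use z(2) order_less_trans in blast)
  qed
  obtain l r where l: "l \<in> sphere 0 1" "strict_mono r" "(b \<circ> r) \<longlonglongrightarrow> l"
    using compact_sphere[of "0 :: real^2" 1] b(1) unfolding compact_def by (metis mem_sphere_0)
  have "(\<lambda>n. (z (r n), b (r n))) \<longlonglongrightarrow> (y, l)"
    using LIMSEQ_subseq_LIMSEQ[OF \<open>z \<longlonglongrightarrow> y\<close> l(2)] l(3) by (intro tendsto_Pair) (simp_all add: o_def)
  then have "((\<lambda>P. vert (f (fst P)) (Df (fst P) (snd P))) \<circ> (\<lambda>n. (z (r n), b (r n)))) \<longlonglongrightarrow> vert (f y) (Df y l)"
    using continuous_vert[unfolded continuous_on_sequentially, rule_format, of "(y, l)" "\<lambda>n. (z (r n), b (r n))"] y z(1)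
    by simp
  then have "vert (f y) (Df y l) = 0" using b(2) by (simp add: o_def LIMSEQ_const_iff)
  moreover have "l \<noteq> 0" using l(1) by auto
  ultimately show ?thesis
    using Df_eq_0[OF y, of l] \<Gamma>_simps[OF f_D[OF y]] by (auto simp: vert_def prod_eq_iff intro!: exI[of _ l])
qed

end


section \<open>The cylinder in coordinates\<close>

context regular_patch
begin

lemma kernel_of_coordinate:
  assumes y: "y \<in> U" and a: "fst (Df y a) $ i = 0"
  shows "fst (Df y a) = 0"
proof -
  obtain \<beta> \<kappa> where b: "a = \<beta> *\<^sub>R m + \<kappa> *\<^sub>R k y" by (rule frame[OF y])
  then have *: "fst (Df y a) = \<beta> *\<^sub>R u y" by (simp add: Df_simps[OF y] projection_k[OF y])
  then show ?thesis using a nonzero[OF y] by simp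
qed

text \<open>The projection and the unit field \<open>e\<close> are constant along the curves tangent to the kernel, hence are
  functions of the arc length \<open>s\<close> of the projection of a transversal line; together with the coordinate
  \<open>t\<close> of \<open>\<xi> = t e\<close> it parametrizes the surface. The map to \<open>(s, t)\<close> is continuous and injective, so by
  invariance of domain its image contains a rectangle.\<close>

lemma cylinder:
  assumes y0: "y0 \<in> U"
  obtains N \<gamma> \<eta> a b c d \<gamma>' \<gamma>'' \<eta>' where "open N" "y0 \<in> N" "N \<subseteq> U" "a < (b::real)" "c < (d::real)"
    "smooth_on {a<..<b} \<gamma>" "smooth_on {a<..<b} \<eta>"
    "\<And>s. s \<in> {a<..<b} \<Longrightarrow> \<gamma> s \<in> D"
    "\<And>s. s \<in> {a<..<b} \<Longrightarrow> (\<gamma> has_vector_derivative \<gamma>' s) (at s)"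
    "\<And>s. s \<in> {a<..<b} \<Longrightarrow> (\<gamma>' has_vector_derivative \<gamma>'' s) (at s)"
    "\<And>s. s \<in> {a<..<b} \<Longrightarrow> G (\<gamma> s) (\<gamma>' s) (\<gamma>' s) = 1"
    "\<And>s. s \<in> {a<..<b} \<Longrightarrow> \<gamma>'' s + \<Gamma> (\<gamma> s) (\<gamma>' s) (\<gamma>' s) = 0"
    "\<And>s. s \<in> {a<..<b} \<Longrightarrow> (\<eta> has_vector_derivative \<eta>' s) (at s)"
    "\<And>s. s \<in> {a<..<b} \<Longrightarrow> G (\<gamma> s) (\<eta> s) (\<eta> s) = 1"
    "\<And>s. s \<in> {a<..<b} \<Longrightarrow> \<eta>' s + \<Gamma> (\<gamma> s) (\<gamma>' s) (\<eta> s) = 0"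
    "f ` N = {(\<gamma> s, t *\<^sub>R \<eta> s) | s t. s \<in> {a<..<b} \<and> t \<in> {c<..<d}}"
proof -
  define \<phi> where "\<phi> y = X y $ i" for y
  have \<phi>: "smooth_on U \<phi>" unfolding \<phi>_def[abs_def]
    by (rule smooth_on_bounded_linear[OF open_U bounded_linear_vec_nth smooth_X])
  have D\<phi>: "frechet_derivative \<phi> (at y) a = fst (Df y a) $ i" if "y \<in> U" for y a
  proof -
    have "(\<phi> has_derivative (\<lambda>a. fst (Df y a) $ i)) (at y)" unfolding \<phi>_def[abs_def]
      by (rule bounded_linear.has_derivative[OF bounded_linear_vec_nth X_deriv[OF that]])
    from fun_cong[OF frechet_derivative_at[OF this], of a] show ?thesis by simp
  qed
  have "frechet_derivative \<phi> (at y0) m \<noteq> 0" using nonzero[OF y0] by (simp add: D\<phi>[OF y0])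
  then obtain N0 \<tau> where N0: "open N0" "y0 \<in> N0" "N0 \<subseteq> U" and \<tau>: "continuous_on N0 \<tau>" "\<tau> y0 = 0"
    and level: "\<And>(\<psi> :: real^2 \<Rightarrow> real^2) \<psi>' y. (\<And>y. y \<in> U \<Longrightarrow> (\<psi> has_derivative \<psi>' y) (at y)) \<Longrightarrow>
       (\<And>y a. y \<in> U \<Longrightarrow> frechet_derivative \<phi> (at y) a = 0 \<Longrightarrow> \<psi>' y a = 0) \<Longrightarrow>
       y \<in> N0 \<Longrightarrow> \<psi> y = \<psi> (y0 + \<tau> y *\<^sub>R m)"
    apply (rule level_curves[OF open_U y0 \<phi>])
    subgoal premises p for N \<tau> by (rule p(1)[OF p(2-)])
    done
  let ?L = "\<lambda>t. y0 + t *\<^sub>R m"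
  have XL: "X y = X (?L (\<tau> y))" if "y \<in> N0" for y
    by (rule level[OF X_deriv _ that]) (use kernel_of_coordinate D\<phi> in auto)
  have eL: "e y = e (?L (\<tau> y))" if "y \<in> N0" for y
  proof (rule level[OF smooth_on_has_derivative[OF smooth_e] _ that])
    fix y a assume y: "y \<in> U" and "frechet_derivative \<phi> (at y) a = 0"
    then have "fst (Df y a) = 0" using kernel_of_coordinate D\<phi> by auto
    then show "frechet_derivative e (at y) a = 0" using e_parallel[OF y, of a] \<Gamma>_simps[OF f_D[OF y]] by simp
  qed

  \<comment> \<open>The arc length \<open>\<Lambda>\<close> along the projected line, and its inverse \<open>T\<close>.\<close>
  have "open (?L -` U)" by (intro open_vimage open_U continuous_intros)
  moreover have "0 \<in> ?L -` U" using y0 by simp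
  ultimately obtain \<delta>0 where \<delta>0: "\<delta>0 > 0" "ball 0 \<delta>0 \<subseteq> ?L -` U" by (rule openE)
  define \<delta> where "\<delta> = \<delta>0 / 2"
  have LU: "?L t \<in> U" if "t \<in> {-\<delta>..\<delta>}" for t
  proof -
    have "t \<in> ball 0 \<delta>0" using that \<delta>0(1) by (simp add: \<delta>_def abs_less_iff)
    then show ?thesis using \<delta>0(2) by blast
  qed
  have \<delta>: "\<delta> > 0" using \<delta>0 by (simp add: \<delta>_def)
  define I where "I = {-\<delta><..<\<delta>}"
  have I: "open I" "0 \<in> I" and LI: "?L ` I \<subseteq> U" using \<delta> LU by (auto simp: I_def)
  have smL: "smooth_on I ?L"
    by (intro smooth_on_add smooth_on_const smooth_on_linear bounded_linear_scaleR_left I)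
  have dL: "(?L has_derivative (\<lambda>r. r *\<^sub>R m)) (at t)" for t by (auto intro!: derivative_eq_intros)
  define \<sigma> where "\<sigma> t = sqrt (G (X (?L t)) (u (?L t)) (u (?L t)))" for t
  have G_u_pos: "G (X y) (u y) (u y) > 0" if "y \<in> U" for y using pos f_D u_nonzero that by blast
  have smu: "smooth_on U u" by (rule smooth_on_bounded_linear[OF open_U bounded_linear_fst smooth_on_frechet[OF smooth_f]])
  have sm_speed: "smooth_on U (\<lambda>y. sqrt (G (X y) (u y) (u y)))"
    by (rule smooth_on_sqrt[OF open_U smooth_on_bilinear_family[OF open_D _ open_U bil smooth smooth_X smu smu] G_u_pos])
      (use f_D in auto)
  have sm\<sigma>: "smooth_on I \<sigma>" unfolding \<sigma>_def[abs_def]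
    by (rule smooth_on_compose[OF I(1) open_U LI sm_speed smL])
  have \<sigma>pos: "\<sigma> t > 0" if "t \<in> I" for t using G_u_pos[of "?L t"] LI that by (auto simp: \<sigma>_def)
  have "continuous_on {-\<delta>..\<delta>} \<sigma>" unfolding \<sigma>_def[abs_def]
    by (rule continuous_on_compose2[OF smooth_on_continuous[OF sm_speed]]) (use LU in \<open>auto intro!: continuous_intros\<close>)
  then obtain \<Lambda> where \<Lambda>0: "\<And>t. t \<in> {-\<delta>..\<delta>} \<Longrightarrow> (\<Lambda> has_vector_derivative \<sigma> t) (at t within {-\<delta>..\<delta>})"
    using antiderivative_continuous by blast
  have \<Lambda>: "(\<Lambda> has_real_derivative \<sigma> t) (at t)" if "t \<in> I" for t
    using \<Lambda>0[of t] that at_within_interior[of t "{-\<delta>..\<delta>}"]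
    by (simp add: I_def has_real_derivative_iff_has_vector_derivative interior_atLeastAtMost_real)
  have cont\<Lambda>: "continuous_on I \<Lambda>"
    using \<Lambda> by (intro continuous_at_imp_continuous_on ballI DERIV_isCont) blast
  have mono: "\<Lambda> t < \<Lambda> t'" if "t \<in> I" "t' \<in> I" "t < t'" for t t'
  proof (rule DERIV_pos_imp_increasing[OF that(3)])
    fix x assume "t \<le> x" "x \<le> t'"
    then have "x \<in> I" using that by (auto simp: I_def)
    then show "\<exists>y. DERIV \<Lambda> x :> y \<and> 0 < y" using \<Lambda> \<sigma>pos by blast
  qed
  have inj\<Lambda>: "inj_on \<Lambda> I"
  proof (rule inj_onI)
    fix t t' assume "t \<in> I" "t' \<in> I" "\<Lambda> t = \<Lambda> t'"
    then show "t = t'" using mono[of t t'] mono[of t' t] by (cases t t' rule: linorder_cases) auto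
  qed
  obtain T where T: "homeomorphism I (\<Lambda> ` I) \<Lambda> T"
    using invariance_of_domain_homeomorphism[OF I(1) cont\<Lambda> _ inj\<Lambda>] by auto
  have J: "open (\<Lambda> ` I)" by (rule invariance_of_domain[OF cont\<Lambda> I(1) inj\<Lambda>])
  have TI: "T s \<in> I" "\<Lambda> (T s) = s" if "s \<in> \<Lambda> ` I" for s
    using T that by (auto simp: homeomorphism_def)
  have T\<Lambda>: "T (\<Lambda> t) = t" if "t \<in> I" for t using T that by (auto simp: homeomorphism_def)
  have contT: "continuous_on (\<Lambda> ` I) T" using T by (simp add: homeomorphism_def)
  have dT: "(T has_real_derivative inverse (\<sigma> (T s))) (at s)" if "s \<in> \<Lambda> ` I" for s
    by (rule Ck_on_inverse_function(1)[OF I(1) J _ contT \<Lambda> _ _ TI(2) that])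
      (use TI \<sigma>pos sm\<sigma> in \<open>force simp: smooth_on_def\<close>)+
  have smT: "smooth_on (\<Lambda> ` I) T" unfolding smooth_on_def
  proof
    fix k show "Ck_on k (\<Lambda> ` I) T"
      by (rule Ck_on_inverse_function(2)[OF I(1) J _ contT \<Lambda> _ _ TI(2)])
        (use TI \<sigma>pos sm\<sigma> in \<open>force simp: smooth_on_def\<close>)+
  qed

  \<comment> \<open>The projected line and the field along it, parametrized by arc length.\<close>
  define w where "w s = inverse (\<sigma> (T s))" for s
  let ?p = "\<lambda>s. ?L (T s)"
  define \<gamma> where "\<gamma> s = X (?p s)" for s
  define \<eta> where "\<eta> s = e (?p s)" for s
  define \<gamma>' where "\<gamma>' s = w s *\<^sub>R u (?p s)" for s
  have TJ: "T ` \<Lambda> ` I \<subseteq> I" using TI by auto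
  have smp: "smooth_on (\<Lambda> ` I) ?p" by (rule smooth_on_compose[OF J I(1) TJ smL smT])
  have pJ: "?p ` \<Lambda> ` I \<subseteq> U" using LI TI by blast
  have pU: "?p s \<in> U" if "s \<in> \<Lambda> ` I" for s using pJ that by blast
  have sm\<gamma>: "smooth_on (\<Lambda> ` I) \<gamma>" "smooth_on (\<Lambda> ` I) \<eta>" unfolding \<gamma>_def[abs_def] \<eta>_def[abs_def]
    by (rule smooth_on_compose[OF J open_U pJ smooth_X smp], rule smooth_on_compose[OF J open_U pJ smooth_e smp])
  have smw: "smooth_on (\<Lambda> ` I) w" unfolding w_def[abs_def]
    by (rule smooth_on_inverse[OF J smooth_on_compose[OF J I(1) TJ sm\<sigma> smT]]) (use TI \<sigma>pos in force)
  have dp: "(?p has_derivative (\<lambda>r. (r * w s) *\<^sub>R m)) (at s)" if "s \<in> \<Lambda> ` I" for s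
    using has_derivative_compose[OF dT[OF that, unfolded has_field_derivative_def] dL[of "T s"]]
    by (simp add: w_def mult.commute)
  have d\<gamma>: "(\<gamma> has_vector_derivative \<gamma>' s) (at s)" if s: "s \<in> \<Lambda> ` I" for s
    using has_derivative_compose[OF dp[OF s] X_deriv[OF pU[OF s]]]
    by (simp add: has_vector_derivative_def \<gamma>_def[abs_def] \<gamma>'_def Df_simps[OF pU[OF s]])
  have du: "((\<lambda>s. u (?p s)) has_vector_derivative w s *\<^sub>R fst (D2f (?p s) m m)) (at s)" if s: "s \<in> \<Lambda> ` I" for s
    using has_derivative_compose[OF dp[OF s] has_derivative_fst[OF
          smooth_on_has_derivative[OF smooth_on_frechet[OF smooth_f] pU[OF s]], of m]]
    by (simp add: has_vector_derivative_def linear_cmul[OF D2f_linear[OF pU[OF s]]])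
  define w' where "w' s = frechet_derivative w (at s) 1" for s
  have dw: "(w has_vector_derivative w' s) (at s)" if "s \<in> \<Lambda> ` I" for s
  proof -
    note d = smooth_on_has_derivative[OF smw that]
    have "frechet_derivative w (at s) r = r *\<^sub>R w' s" for r
      using linear_cmul[OF has_derivative_linear[OF d], of r 1] by (simp add: w'_def)
    then have "frechet_derivative w (at s) = (\<lambda>r. r *\<^sub>R w' s)" by (rule ext)
    then show ?thesis using d by (simp only: has_vector_derivative_def)
  qed
  define \<gamma>'' where "\<gamma>'' s = w s *\<^sub>R (w s *\<^sub>R fst (D2f (?p s) m m)) + w' s *\<^sub>R u (?p s)" for s
  have d\<gamma>': "(\<gamma>' has_vector_derivative \<gamma>'' s) (at s)" if s: "s \<in> \<Lambda> ` I" for s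
    unfolding \<gamma>'_def[abs_def] \<gamma>''_def
    by (rule has_vector_derivative_scaleR[OF _ du[OF s]])
      (use dw[OF s] in \<open>simp add: has_real_derivative_iff_has_vector_derivative\<close>)
  have \<gamma>D: "\<gamma> s \<in> D" if "s \<in> \<Lambda> ` I" for s using f_D[OF pU[OF that]] by (simp add: \<gamma>_def)
  have unit: "G (\<gamma> s) (\<gamma>' s) (\<gamma>' s) = 1" if s: "s \<in> \<Lambda> ` I" for s
  proof -
    have "\<sigma> (T s) * \<sigma> (T s) = G (\<gamma> s) (u (?p s)) (u (?p s))"
      using G_u_pos[OF pU[OF s]] by (simp add: \<sigma>_def \<gamma>_def)
    then have "G (\<gamma> s) (\<gamma>' s) (\<gamma>' s) = (w s * \<sigma> (T s)) * (w s * \<sigma> (T s))"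
      by (simp add: \<gamma>'_def G_simps[OF \<gamma>D[OF s]] ac_simps)
    then show ?thesis using \<sigma>pos[OF TI(1)[OF s]] by (simp add: w_def)
  qed
  have geo: "\<gamma>'' s + \<Gamma> (\<gamma> s) (\<gamma>' s) (\<gamma>' s) = 0" if s: "s \<in> \<Lambda> ` I" for s
  proof -
    obtain \<beta> where \<beta>: "fst (D2f (?p s) m m) + \<Gamma> (\<gamma> s) (u (?p s)) (u (?p s)) = \<beta> *\<^sub>R u (?p s)"
      using pregeodesic[OF pU[OF s]] by (auto simp: \<gamma>_def)
    have w0: "w s \<noteq> 0" using \<sigma>pos[OF TI(1)[OF s]] by (simp add: w_def)
    have "\<gamma>'' s + \<Gamma> (\<gamma> s) (\<gamma>' s) (\<gamma>' s) =
        (w s * w s) *\<^sub>R (fst (D2f (?p s) m m) + \<Gamma> (\<gamma> s) (u (?p s)) (u (?p s))) + w' s *\<^sub>R u (?p s)"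
      by (simp add: \<gamma>''_def \<gamma>'_def \<Gamma>_simps[OF \<gamma>D[OF s]] scaleR_add_right)
    also have "\<dots> = (w s * w s * \<beta> + w' s) *\<^sub>R u (?p s)" unfolding \<beta> by (simp add: scaleR_add_left)
    also have "\<dots> = ((w s * w s * \<beta> + w' s) / w s) *\<^sub>R \<gamma>' s" using w0 by (simp add: \<gamma>'_def)
    finally have r: "\<gamma>'' s + \<Gamma> (\<gamma> s) (\<gamma>' s) (\<gamma>' s) = ((w s * w s * \<beta> + w' s) / w s) *\<^sub>R \<gamma>' s" .
    have "1 *\<^sub>R \<gamma>'' s + \<Gamma> (\<gamma> s) (1 *\<^sub>R \<gamma>' s) (\<gamma>' s) = 0"
      by (rule unit_field_parallel[where r = "(w s * w s * \<beta> + w' s) / w s", OF J s unit \<gamma>D[OF s] d\<gamma>[OF s, unfolded has_vector_derivative_def]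
          d\<gamma>'[OF s, unfolded has_vector_derivative_def]]) (use r in simp_all)
    then show ?thesis by simp
  qed
  define \<eta>' where "\<eta>' s = w s *\<^sub>R frechet_derivative e (at (?p s)) m" for s
  have d\<eta>: "(\<eta> has_vector_derivative \<eta>' s) (at s)" if s: "s \<in> \<Lambda> ` I" for s
    using has_derivative_compose[OF dp[OF s] smooth_on_has_derivative[OF smooth_e pU[OF s]]]
      linear_cmul[OF has_derivative_linear[OF smooth_on_has_derivative[OF smooth_e pU[OF s]]]]
    by (simp add: has_vector_derivative_def \<eta>_def[abs_def] \<eta>'_def)
  have unit\<eta>: "G (\<gamma> s) (\<eta> s) (\<eta> s) = 1" if "s \<in> \<Lambda> ` I" for s
    using e_unit[OF pU[OF that]] by (simp add: \<gamma>_def \<eta>_def)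
  have par: "\<eta>' s + \<Gamma> (\<gamma> s) (\<gamma>' s) (\<eta> s) = 0" if s: "s \<in> \<Lambda> ` I" for s
  proof -
    have "\<eta>' s + \<Gamma> (\<gamma> s) (\<gamma>' s) (\<eta> s) =
        w s *\<^sub>R (frechet_derivative e (at (?p s)) m + \<Gamma> (X (?p s)) (u (?p s)) (e (?p s)))"
      using \<Gamma>_simps[OF \<gamma>D[OF s]] by (simp add: \<eta>'_def \<gamma>'_def \<gamma>_def \<eta>_def scaleR_add_right)
    then show ?thesis using e_parallel[OF pU[OF s], of m] by simp
  qed

  \<comment> \<open>The coordinates \<open>(s, t)\<close> on the surface.\<close>
  define N1 where "N1 = N0 \<inter> \<tau> -` I"
  have N1: "open N1" unfolding N1_def by (rule continuous_open_preimage[OF \<tau>(1) N0(1) I(1)])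
  have y0N1: "y0 \<in> N1" using N0 \<tau> I by (simp add: N1_def)
  have N1U: "N1 \<subseteq> U" using N0 by (auto simp: N1_def)
  define H where "H y = (\<Lambda> (\<tau> y), G (X y) (\<Xi> y) (e y))" for y
  have f_H: "f y = (\<gamma> (fst (H y)), snd (H y) *\<^sub>R \<eta> (fst (H y)))" and HJ: "fst (H y) \<in> \<Lambda> ` I" if y: "y \<in> N1" for y
  proof -
    have y': "y \<in> N0" "\<tau> y \<in> I" "y \<in> U" using y N1U by (auto simp: N1_def)
    then show "fst (H y) \<in> \<Lambda> ` I" by (simp add: H_def)
    have "\<Xi> y = snd (H y) *\<^sub>R e y" unfolding H_def snd_conv by (rule \<Xi>_e[OF y'(3)])
    moreover have "X y = \<gamma> (fst (H y))" "e y = \<eta> (fst (H y))"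
      using XL[OF y'(1)] eL[OF y'(1)] T\<Lambda>[OF y'(2)] by (simp_all add: H_def \<gamma>_def \<eta>_def)
    ultimately show "f y = (\<gamma> (fst (H y)), snd (H y) *\<^sub>R \<eta> (fst (H y)))"
      by (intro prod_eqI) (simp_all only: fst_conv snd_conv)
  qed
  have "smooth_on U (\<lambda>y. G (X y) (\<Xi> y) (e y))"
    by (rule smooth_on_bilinear_family[OF open_D _ open_U bil smooth smooth_X smooth_\<Xi> smooth_e]) (use f_D in auto)
  then have contH: "continuous_on N1 H" unfolding H_def[abs_def]
    by (intro continuous_on_Pair continuous_on_compose2[OF cont\<Lambda>] continuous_on_subset[OF \<tau>(1)]
        continuous_on_subset[OF smooth_on_continuous N1U]) (auto simp: N1_def)
  have injH: "inj_on H N1"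
  proof (rule inj_onI)
    fix y z assume "y \<in> N1" "z \<in> N1" "H y = H z"
    then have "f y = f z" using f_H by metis
    then show "y = z" using inj_onD[OF inj_f] \<open>y \<in> N1\<close> \<open>z \<in> N1\<close> N1U by blast
  qed
  have "open (H ` N1)" by (rule invariance_of_domain_gen[OF N1 contH injH]) simp
  then obtain S1 S2 where S: "open S1" "open S2" "H y0 \<in> S1 \<times> S2" "S1 \<times> S2 \<subseteq> H ` N1"
    using open_prod_elim[of "H ` N1" "H y0"] y0N1 by blast
  obtain s0 t0 where H0: "H y0 = (s0, t0)" by (cases "H y0")
  obtain \<epsilon>1 where \<epsilon>1: "\<epsilon>1 > 0" "{s0-\<epsilon>1<..<s0+\<epsilon>1} \<subseteq> S1"
    using openE[OF S(1)] S(3) H0 by (metis ball_eq_greaterThanLessThan mem_Sigma_iff)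
  obtain \<epsilon>2 where \<epsilon>2: "\<epsilon>2 > 0" "{t0-\<epsilon>2<..<t0+\<epsilon>2} \<subseteq> S2"
    using openE[OF S(2)] S(3) H0 by (metis ball_eq_greaterThanLessThan mem_Sigma_iff)
  let ?A = "{s0-\<epsilon>1<..<s0+\<epsilon>1}" and ?B = "{t0-\<epsilon>2<..<t0+\<epsilon>2}"
  have box: "?A \<times> ?B \<subseteq> H ` N1" using \<epsilon>1 \<epsilon>2 S(4) by blast
  have AJ: "?A \<subseteq> \<Lambda> ` I"
  proof
    fix s assume "s \<in> ?A"
    then have "(s, t0) \<in> ?A \<times> ?B" using \<epsilon>2(1) by auto
    then obtain y where "y \<in> N1" "(s, t0) = H y" using box by blast
    then show "s \<in> \<Lambda> ` I" using HJ by (metis fst_conv)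
  qed
  define N where "N = N1 \<inter> H -` (?A \<times> ?B)"
  have oN: "open N" unfolding N_def by (rule continuous_open_preimage[OF contH N1 open_Times]) auto
  have yN: "y0 \<in> N" using y0N1 H0 \<epsilon>1 \<epsilon>2 by (simp add: N_def)
  have NU: "N \<subseteq> U" using N1U by (auto simp: N_def)
  have fN: "f ` N = {(\<gamma> s, t *\<^sub>R \<eta> s) | s t. s \<in> ?A \<and> t \<in> ?B}"
  proof (intro equalityI subsetI)
    fix P assume "P \<in> f ` N"
    then obtain y where y: "y \<in> N1" "H y \<in> ?A \<times> ?B" "P = f y" by (auto simp: N_def)
    then show "P \<in> {(\<gamma> s, t *\<^sub>R \<eta> s) | s t. s \<in> ?A \<and> t \<in> ?B}" using f_H[OF y(1)] by (auto simp: mem_Times_iff)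
  next
    fix P assume "P \<in> {(\<gamma> s, t *\<^sub>R \<eta> s) | s t. s \<in> ?A \<and> t \<in> ?B}"
    then obtain s t where st: "P = (\<gamma> s, t *\<^sub>R \<eta> s)" "(s, t) \<in> ?A \<times> ?B" by blast
    then obtain y where y: "y \<in> N1" "H y = (s, t)" using box by (metis imageE subsetD)
    then have "P = f y" using f_H[OF y(1)] st(1) by simp
    then show "P \<in> f ` N" using y st(2) by (auto simp: N_def)
  qed
  have ab: "s0 - \<epsilon>1 < s0 + \<epsilon>1" and cd: "t0 - \<epsilon>2 < t0 + \<epsilon>2" using \<epsilon>1 \<epsilon>2 by auto
  have sJ: "s \<in> \<Lambda> ` I" if "s \<in> ?A" for s using AJ that by (rule subsetD)
  show thesis
    by (rule that[OF oN yN NU ab cd smooth_on_subset[OF sm\<gamma>(1) AJ] smooth_on_subset[OF sm\<gamma>(2) AJ] \<gamma>D[OF sJ]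
        d\<gamma>[OF sJ] d\<gamma>'[OF sJ] unit[OF sJ] geo[OF sJ] d\<eta>[OF sJ] unit\<eta>[OF sJ] par[OF sJ] fN])
qed

end


section \<open>Curves in a chart\<close>

context riemannian_manifold
begin

lemma trans_along_curve:
  fixes I :: "real set"
  assumes c: "c \<in> A" "c' \<in> A" and I: "open I" and \<gamma>: "smooth_on I \<gamma>" "\<gamma> ` I \<subseteq> crange c"
  shows "{s \<in> I. cinv c (\<gamma> s) \<in> cdom c'} = I \<inter> \<gamma> -` (cmap c ` (cdom c \<inter> cdom c'))"
    and "open {s \<in> I. cinv c (\<gamma> s) \<in> cdom c'}"
proof -
  show eq: "{s \<in> I. cinv c (\<gamma> s) \<in> cdom c'} = I \<inter> \<gamma> -` (cmap c ` (cdom c \<inter> cdom c'))"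
  proof (intro equalityI subsetI)
    fix s assume s: "s \<in> {s \<in> I. cinv c (\<gamma> s) \<in> cdom c'}"
    then have "\<gamma> s \<in> crange c" using \<gamma>(2) by blast
    then show "s \<in> I \<inter> \<gamma> -` (cmap c ` (cdom c \<inter> cdom c'))"
      using s cinv_cdom[of "\<gamma> s" c] cmap_cinv[of "\<gamma> s" c] by (auto intro!: image_eqI[of _ _ "cinv c (\<gamma> s)"])
  next
    fix s assume "s \<in> I \<inter> \<gamma> -` (cmap c ` (cdom c \<inter> cdom c'))"
    then obtain q where "s \<in> I" "\<gamma> s = cmap c q" "q \<in> cdom c" "q \<in> cdom c'" by blast
    then show "s \<in> {s \<in> I. cinv c (\<gamma> s) \<in> cdom c'}" using cinv_cmap[OF inj[OF c(1)]] by simp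
  qed
  show "open {s \<in> I. cinv c (\<gamma> s) \<in> cdom c'}"
    unfolding eq by (rule continuous_open_preimage[OF smooth_on_continuous[OF \<gamma>(1)] I open_overlap[OF c]])
qed

lemma smooth_curve_chart:
  assumes c: "c \<in> A" and I: "open I" and \<gamma>: "smooth_on I \<gamma>" "\<gamma> ` I \<subseteq> crange c"
  shows "smooth_curve A I (\<lambda>s. cinv c (\<gamma> s))"
  unfolding smooth_curve_def
proof (intro conjI ballI)
  show "(\<lambda>s. cinv c (\<gamma> s)) ` I \<subseteq> points A"
  proof clarify
    fix s assume "s \<in> I"
    then have "cinv c (\<gamma> s) \<in> cdom c" using \<gamma>(2) by (intro cinv_cdom) blast
    then show "cinv c (\<gamma> s) \<in> points A" using c unfolding points_def by blast
  qed
  fix c' assume c': "c' \<in> A"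
  note t = trans_along_curve[OF c c' I \<gamma>]
  show "open {s \<in> I. cinv c (\<gamma> s) \<in> cdom c'}" by (rule t(2))
  have "smooth_on (I \<inter> \<gamma> -` (cmap c ` (cdom c \<inter> cdom c'))) (\<lambda>s. (cmap c' \<circ> cinv c) (\<gamma> s))"
    by (rule smooth_on_compose[OF _ open_overlap[OF c c'] _ smooth_trans[OF c c'] smooth_on_subset[OF \<gamma>(1)]])
      (use t in auto)
  then show "smooth_on {s \<in> I. cinv c (\<gamma> s) \<in> cdom c'} (cmap c' \<circ> (\<lambda>s. cinv c (\<gamma> s)))"
    unfolding t(1) by (simp add: o_def)
qed

lemma velocity_chart:
  assumes c: "c \<in> A" and x: "\<gamma> s \<in> crange c" and d: "(\<gamma> has_vector_derivative \<gamma>') (at s)"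
  shows "velocity A (\<lambda>s. cinv c (\<gamma> s)) s = tvec_of A c (cinv c (\<gamma> s)) \<gamma>'"
proof (rule ext)
  fix c'
  let ?q = "cinv c (\<gamma> s)"
  have q: "?q \<in> cdom c" "cmap c ?q = \<gamma> s" by (rule cinv_cdom[OF x], rule cmap_cinv[OF x])
  show "velocity A (\<lambda>s. cinv c (\<gamma> s)) s c' = tvec_of A c ?q \<gamma>' c'"
  proof (cases "chart_at A ?q c'")
    case True
    then have c': "c' \<in> A" "?q \<in> cdom c'" by (auto simp: chart_at_def)
    have "((cmap c' \<circ> cinv c) has_derivative trans_deriv c c' ?q) (at (\<gamma> s))"
      using trans_has_derivative[OF c c'(1) q(1) c'(2)] by (simp add: q(2))
    note D = has_derivative_compose[OF d[unfolded has_vector_derivative_def] this]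
    have "(\<lambda>s. (cmap c' \<circ> cinv c) (\<gamma> s)) = cmap c' \<circ> (\<lambda>s. cinv c (\<gamma> s))" by (simp add: fun_eq_iff)
    then have "((cmap c' \<circ> (\<lambda>s. cinv c (\<gamma> s))) has_vector_derivative trans_deriv c c' ?q \<gamma>') (at s)"
      using D unfolding has_vector_derivative_def
      by (simp only: linear_cmul[OF trans_deriv_linear[OF c c'(1) q(1) c'(2)]])
    then show ?thesis using True by (simp add: velocity_def tvec_of_def vector_derivative_at)
  qed (simp add: velocity_def tvec_of_def)
qed

lemma smooth_field_along_chart:
  assumes c: "c \<in> A" and I: "open I" and \<gamma>: "smooth_on I \<gamma>" "\<gamma> ` I \<subseteq> crange c" and \<eta>: "smooth_on I \<eta>"
  shows "smooth_field_along A I (\<lambda>s. cinv c (\<gamma> s)) (\<lambda>s. tvec_of A c (cinv c (\<gamma> s)) (\<eta> s))"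
  unfolding smooth_field_along_def
proof (intro conjI ballI)
  fix s assume "s \<in> I"
  then have "cinv c (\<gamma> s) \<in> cdom c" using \<gamma>(2) by (intro cinv_cdom) blast
  then show "tvec_of A c (cinv c (\<gamma> s)) (\<eta> s) \<in> tangent_vectors A (cinv c (\<gamma> s))"
    using c by (intro tvec_of_tangent) (simp add: chart_at_def)
next
  fix c' assume c': "c' \<in> A"
  note t = trans_along_curve[OF c c' I \<gamma>]
  let ?J = "{s \<in> I. cinv c (\<gamma> s) \<in> cdom c'}" and ?O = "cmap c ` (cdom c \<inter> cdom c')"
  have "smooth_on ?J (\<lambda>s. frechet_derivative (cmap c' \<circ> cinv c) (at (\<gamma> s)) (\<eta> s))"
  proof (rule smooth_on_linear_family[where p = \<gamma> and w = \<eta> and L = "\<lambda>y. frechet_derivative (cmap c' \<circ> cinv c) (at y)",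
        OF open_overlap[OF c c'] _ t(2)])
    show "\<gamma> ` ?J \<subseteq> ?O" unfolding t(1) by auto
    show "linear (frechet_derivative (cmap c' \<circ> cinv c) (at y))" if "y \<in> ?O" for y
      using smooth_on_has_derivative[OF smooth_trans[OF c c'] that] by (rule has_derivative_linear)
    show "smooth_on ?O (\<lambda>y. frechet_derivative (cmap c' \<circ> cinv c) (at y) b)" for b
      by (rule smooth_on_frechet[OF smooth_trans[OF c c']])
  qed (use \<gamma> \<eta> in \<open>auto intro: smooth_on_subset\<close>)
  then show "smooth_on ?J (\<lambda>s. tvec_of A c (cinv c (\<gamma> s)) (\<eta> s) c')"
  proof (rule smooth_on_cong[OF t(2), rotated])
    fix s assume s: "s \<in> ?J"
    then have "\<gamma> s \<in> crange c" using \<gamma>(2) by blast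
    then show "frechet_derivative (cmap c' \<circ> cinv c) (at (\<gamma> s)) (\<eta> s) = tvec_of A c (cinv c (\<gamma> s)) (\<eta> s) c'"
      using s c' cmap_cinv[of "\<gamma> s" c] by (simp add: tvec_of_def chart_at_def)
  qed
qed

text \<open>By the transformation law, the covariant derivative along a curve may be computed in one chart.\<close>

lemma cov_deriv_along_chart:
  assumes c: "c \<in> A" and I: "open I" "s \<in> I" and \<gamma>: "smooth_on I \<gamma>" "\<gamma> ` I \<subseteq> crange c"
    and d: "(\<gamma> has_vector_derivative \<gamma>') (at s)" and d\<eta>: "(\<eta> has_vector_derivative \<eta>') (at s)"
    and E: "\<And>r. r \<in> I \<Longrightarrow> E r = tvec_of A c (cinv c (\<gamma> r)) (\<eta> r)"
  shows "cov_deriv_along A g (\<lambda>s. cinv c (\<gamma> s)) E s =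
    tvec_of A c (cinv c (\<gamma> s)) (\<eta>' + christoffel (cm c) (\<gamma> s) \<gamma>' (\<eta> s))"
proof (rule ext)
  fix c'
  let ?q = "cinv c (\<gamma> s)"
  have x: "\<gamma> s \<in> crange c" using \<gamma>(2) I by blast
  have q: "?q \<in> cdom c" "cmap c ?q = \<gamma> s" by (rule cinv_cdom[OF x], rule cmap_cinv[OF x])
  show "cov_deriv_along A g (\<lambda>s. cinv c (\<gamma> s)) E s c' =
      tvec_of A c ?q (\<eta>' + christoffel (cm c) (\<gamma> s) \<gamma>' (\<eta> s)) c'"
  proof (cases "chart_at A ?q c'")
    case True
    then have c': "c' \<in> A" "?q \<in> cdom c'" by (auto simp: chart_at_def)
    let ?D = "\<lambda>y. frechet_derivative (cmap c' \<circ> cinv c) (at y)" and ?O = "cmap c ` (cdom c \<inter> cdom c')"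
    note t = trans_along_curve[OF c c'(1) I(1) \<gamma>]
    have sJ: "s \<in> {s \<in> I. cinv c (\<gamma> s) \<in> cdom c'}" using I(2) c'(2) by simp
    have sO: "\<gamma> s \<in> ?O" using sJ unfolding t(1) by blast
    have "((\<lambda>r. ?D (\<gamma> r) (\<eta> r)) has_derivative
      (\<lambda>h. frechet_derivative (\<lambda>y. ?D y (\<eta> s)) (at (\<gamma> s)) (h *\<^sub>R \<gamma>') + ?D (\<gamma> s) (h *\<^sub>R \<eta>'))) (at s)"
    proof (rule has_derivative_linear_family[where p = \<gamma> and w = \<eta> and L = ?D, OF open_overlap[OF c c'(1)]])
      show "linear (?D y)" if "y \<in> ?O" for y
        using smooth_on_has_derivative[OF smooth_trans[OF c c'(1)] that] by (rule has_derivative_linear)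
      show "(\<lambda>y. ?D y b) differentiable at (\<gamma> s)" for b
        by (rule smooth_on_differentiable[OF smooth_on_frechet[OF smooth_trans[OF c c'(1)]] sO])
    qed (use sO d d\<eta> in \<open>auto simp: has_vector_derivative_def\<close>)
    then have D1: "((\<lambda>r. E r c') has_derivative
      (\<lambda>h. frechet_derivative (\<lambda>y. ?D y (\<eta> s)) (at (\<gamma> s)) (h *\<^sub>R \<gamma>') + ?D (\<gamma> s) (h *\<^sub>R \<eta>'))) (at s)"
    proof (rule has_derivative_transform_within_open[OF _ t(2) sJ])
      fix r assume r: "r \<in> {s \<in> I. cinv c (\<gamma> s) \<in> cdom c'}"
      then have "\<gamma> r \<in> crange c" using \<gamma>(2) by blast
      then show "?D (\<gamma> r) (\<eta> r) = E r c'"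
        using r c' cmap_cinv[of "\<gamma> r" c] by (simp add: E tvec_of_def chart_at_def)
    qed
    have l: "linear (frechet_derivative (\<lambda>y. ?D y (\<eta> s)) (at (\<gamma> s)))"
      by (rule has_derivative_linear[OF smooth_on_has_derivative[OF smooth_on_frechet[OF smooth_trans[OF c c'(1)]] sO]])
    have l': "linear (trans_deriv c c' ?q)" by (rule trans_deriv_linear[OF c c'(1) q(1) c'(2)])
    have "((\<lambda>r. E r c') has_vector_derivative hess c c' ?q \<gamma>' (\<eta> s) + trans_deriv c c' ?q \<eta>') (at s)"
      using D1 unfolding has_vector_derivative_def q(2)
      by (simp add: linear_cmul[OF l] linear_cmul[OF l'[unfolded q(2)]] scaleR_add_right)
    then have vd: "vector_derivative (\<lambda>r. E r c') (at s) = hess c c' ?q \<gamma>' (\<eta> s) + trans_deriv c c' ?q \<eta>'"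
      by (rule vector_derivative_at)
    have vel: "velocity A (\<lambda>s. cinv c (\<gamma> s)) s c' = trans_deriv c c' ?q \<gamma>'"
      using velocity_chart[OF c x d] True by (simp add: tvec_of_def)
    have Ec: "E s c' = trans_deriv c c' ?q (\<eta> s)" using True by (simp add: E[OF I(2)] tvec_of_def)
    have "tvec_of A c ?q (\<eta>' + christoffel (cm c) (\<gamma> s) \<gamma>' (\<eta> s)) c' =
        trans_deriv c c' ?q \<eta>' + trans_deriv c c' ?q (christoffel (cm c) (cmap c ?q) \<gamma>' (\<eta> s))"
      using True by (simp only: tvec_of_def if_True q(2) linear_add[OF l'[unfolded q(2)]])
    also have "\<dots> = vector_derivative (\<lambda>r. E r c') (at s) +
        christoffel (cm c') (cmap c' ?q) (velocity A (\<lambda>s. cinv c (\<gamma> s)) s c') (E s c')"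
      unfolding christoffel_change[OF c c'(1) q(1) c'(2)] vd vel Ec by (simp only: ac_simps)
    finally show ?thesis using True by (simp add: cov_deriv_along_def)
  qed (simp add: cov_deriv_along_def tvec_of_def)
qed

end


section \<open>Totally geodesic surfaces of the tangent bundle\<close>

context riemannian_surface
begin

lemma totally_geodesic_patch:
  fixes U :: "(real^2) set"
  assumes curved: "sign_preserving_curvature A g"
    and tg: "totally_geodesic TYPE(real^2) TB (sasaki A g) F"
    and nt: "nontransversal_to_fibers TYPE(real^2) A F"
    and c: "c \<in> A" and f: "local_param TB F (induced_chart A c) f U"
  shows "totally_geodesic_patch (crange c) (cm c) f U"
proof -
  interpret M: surface_metric "crange c" "cm c" by (rule surface_metric[OF c])
  have fU: "f y \<in> crange c \<times> UNIV" if "y \<in> U" for y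
    using f that unfolding local_param_def crange_induced[OF c] by blast
  show ?thesis
  proof (rule totally_geodesic_patch.intro[OF M.surface_metric_axioms], unfold_locales)
    show "open U" "smooth_on U f" using f by (auto simp: local_param_def)
    show "inj_on f U" using f unfolding local_param_def homeomorphism_def by (metis inj_on_inverseI)
    fix y assume y: "y \<in> U"
    show "fst (f y) \<in> crange c" using fU[OF y] by auto
    show "inj (frechet_derivative f (at y))" using f y by (simp add: local_param_def)
    show "\<exists>a. a \<noteq> 0 \<and> fst (frechet_derivative f (at y) a) = 0"
      by (rule nontransversal_kernel[OF nt f c y])
    show "frechet_derivative (\<lambda>z. frechet_derivative f (at z) a) (at y) b
        + christoffel M.sas (f y) (frechet_derivative f (at y) a) (frechet_derivative f (at y) b)
        \<in> range (frechet_derivative f (at y))" for a b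
      using tg f y christoffel_sasaki[OF c fU[OF y]] unfolding totally_geodesic_def by metis
  next
    fix x assume "x \<in> crange c"
    then show "gauss_curvature (cm c) x \<noteq> 0"
      using curved c unfolding sign_preserving_curvature_def by (metis less_irrefl)
  qed
qed

text \<open>A parameter domain on which the projection has zero derivative would parametrize a piece of a
  single fiber.\<close>

lemma projection_not_locally_constant:
  fixes N :: "(real^2) set"
  assumes no_fiber_piece: "\<And>q W. openin (atlas_topology TB) W \<Longrightarrow> F \<inter> W \<noteq> {} \<Longrightarrow> \<not> F \<inter> W \<subseteq> fiber A q"
    and c: "c \<in> A" and f: "local_param TB F (induced_chart A c) f N" and N: "N \<noteq> {}"
  shows "\<exists>y\<in>N. \<exists>a. fst (frechet_derivative f (at y) a) \<noteq> 0"
proof (rule ccontr)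
  assume "\<not> ?thesis"
  then have zero: "(\<lambda>a. fst (frechet_derivative f (at y) a)) = (\<lambda>a. 0)" if "y \<in> N" for y using that by auto
  obtain y0 r where r: "r > 0" "ball y0 r \<subseteq> N" "y0 \<in> N"
    using f N unfolding local_param_def by (metis openE ex_in_conv)
  have fb: "local_param TB F (induced_chart A c) f (ball y0 r)"
    by (rule TB.local_param_restrict[OF f open_ball r(2)])
  have "((\<lambda>y. fst (f y)) has_derivative (\<lambda>a. 0)) (at y within ball y0 r)" if "y \<in> ball y0 r" for y
  proof -
    have "y \<in> N" using that r(2) by blast
    moreover have "smooth_on N f" using f by (simp add: local_param_def)
    ultimately have "((\<lambda>y. fst (f y)) has_derivative (\<lambda>a. fst (frechet_derivative f (at y) a))) (at y)"
      by (intro has_derivative_fst smooth_on_has_derivative)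
    then show ?thesis unfolding zero[OF \<open>y \<in> N\<close>] by (rule has_derivative_at_withinI)
  qed
  then obtain x where x: "\<And>y. y \<in> ball y0 r \<Longrightarrow> fst (f y) = x"
    using has_derivative_zero_constant[OF convex_ball] by metis
  obtain W where W: "openin (atlas_topology TB) W" "F \<inter> W = cinv (induced_chart A c) ` f ` ball y0 r"
    using fb by (auto simp: local_param_def)
  have "F \<inter> W \<subseteq> fiber A (cinv c x)"
  proof
    fix p assume "p \<in> F \<inter> W"
    then obtain y where y: "y \<in> ball y0 r" "p = cinv (induced_chart A c) (f y)" using W(2) by blast
    have "f y \<in> crange (induced_chart A c)" using fb y(1) by (auto simp: local_param_def)
    then have fy: "f y = (x, snd (f y))" "x \<in> crange c"
      using x[OF y(1)] by (auto simp: crange_induced[OF c] prod_eq_iff)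
    have "p = (cinv c x, tvec_of A c (cinv c x) (snd (f y)))"
      using y(2) fy cinv_induced[OF c fy(2)] by metis
    moreover have "chart_at A (cinv c x) c" using c cinv_cdom[OF fy(2)] by (simp add: chart_at_def)
    ultimately show "p \<in> fiber A (cinv c x)" using tvec_of_tangent by (simp add: fiber_def)
  qed
  moreover have "F \<inter> W \<noteq> {}" using r(1) unfolding W(2) by auto
  ultimately show False using no_fiber_piece[OF W(1)] by blast
qed

end

theorem theorem2:
  fixes A :: "('a, real^2) chart set"
    and g :: "('a, real^2) metric"
    and F :: "('a, real^2) tb set"
  assumes "smooth_manifold A"
    and "riemannian_metric A g"
    and "sign_preserving_curvature A g"
    and "totally_geodesic TYPE(real^2) (tangent_bundle A) (sasaki A g) F"
    and "nontransversal_to_fibers TYPE(real^2) A F"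
    and no_fiber_piece: "\<And>q W. openin (atlas_topology (tangent_bundle A)) W \<Longrightarrow>
           F \<inter> W \<noteq> {} \<Longrightarrow> \<not> F \<inter> W \<subseteq> fiber A q"
    and "p \<in> F"
  shows "\<exists>W \<gamma> e a b c d. openin (atlas_topology (tangent_bundle A)) W \<and> p \<in> W \<and>
           a < b \<and> c < d \<and>
           unit_speed_geodesic A g {a<..<b} \<gamma> \<and>
           parallel_unit_field A g {a<..<b} \<gamma> e \<and>
           F \<inter> W = cylinder_type_surface \<gamma> e {a<..<b} {c<..<d}"
proof -
  interpret riemannian_surface A g
    using assms(1,2) by (simp add: riemannian_surface_def riemannian_manifold_def)
  obtain ch f and U :: "(real^2) set" where "local_param TB F ch f U" "p \<in> cinv ch ` f ` U"
    using assms(4,7) unfolding totally_geodesic_def submanifold_def by blast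
  moreover from this obtain c where c: "c \<in> A" "ch = induced_chart A c"
    by (auto simp: local_param_def tangent_bundle_def)
  ultimately obtain y0 where f: "local_param TB F (induced_chart A c) f U" and y0: "y0 \<in> U"
    and p: "p = cinv (induced_chart A c) (f y0)" by blast
  interpret P: totally_geodesic_patch "crange c" "cm c" f U
    by (rule totally_geodesic_patch[OF assms(3-5) c(1) f])
  have dense: "\<exists>y\<in>N. \<exists>a. fst (P.Df y a) \<noteq> 0" if "open N" "N \<subseteq> U" "N \<noteq> {}" for N
    using projection_not_locally_constant[OF no_fiber_piece c(1) TB.local_param_restrict[OF f that(1,2)] that(3)] .
  obtain m where m: "fst (P.Df y0 m) \<noteq> 0" using P.projection_nonzero[OF dense y0] by blast
  obtain V i where V: "y0 \<in> V" "V \<subseteq> U" "regular_patch (crange c) (cm c) f V i m"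
    by (rule P.regular_neighbourhood[OF y0 m])
  interpret V: regular_patch "crange c" "cm c" f V i m by (rule V(3))
  obtain N \<gamma> \<eta> a b r d \<gamma>' \<gamma>'' \<eta>' where N: "open N" "y0 \<in> N" "N \<subseteq> V" and ab: "a < (b::real)" "r < (d::real)"
    and sm: "smooth_on {a<..<b} \<gamma>" "smooth_on {a<..<b} \<eta>"
    and \<gamma>D: "\<And>s. s \<in> {a<..<b} \<Longrightarrow> \<gamma> s \<in> crange c"
    and d\<gamma>: "\<And>s. s \<in> {a<..<b} \<Longrightarrow> (\<gamma> has_vector_derivative \<gamma>' s) (at s)"
    and d\<gamma>': "\<And>s. s \<in> {a<..<b} \<Longrightarrow> (\<gamma>' has_vector_derivative \<gamma>'' s) (at s)"
    and unit: "\<And>s. s \<in> {a<..<b} \<Longrightarrow> cm c (\<gamma> s) (\<gamma>' s) (\<gamma>' s) = 1"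
    and geo: "\<And>s. s \<in> {a<..<b} \<Longrightarrow> \<gamma>'' s + christoffel (cm c) (\<gamma> s) (\<gamma>' s) (\<gamma>' s) = 0"
    and d\<eta>: "\<And>s. s \<in> {a<..<b} \<Longrightarrow> (\<eta> has_vector_derivative \<eta>' s) (at s)"
    and unit\<eta>: "\<And>s. s \<in> {a<..<b} \<Longrightarrow> cm c (\<gamma> s) (\<eta> s) (\<eta> s) = 1"
    and par: "\<And>s. s \<in> {a<..<b} \<Longrightarrow> \<eta>' s + christoffel (cm c) (\<gamma> s) (\<gamma>' s) (\<eta> s) = 0"
    and fN: "f ` N = {(\<gamma> s, t *\<^sub>R \<eta> s) | s t. s \<in> {a<..<b} \<and> t \<in> {r<..<d}}"
    apply (rule V.cylinder[OF V(1)])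
    subgoal premises prem by (rule prem(1)[OF prem(2-)])
    done
  let ?I = "{a<..<b}"
  define \<Gamma>c where "\<Gamma>c s = cinv c (\<gamma> s)" for s
  define E where "E s = tvec_of A c (\<Gamma>c s) (\<eta> s)" for s
  have I: "open ?I" and \<gamma>I: "\<gamma> ` ?I \<subseteq> crange c" using \<gamma>D by auto
  have ch: "chart_at A (\<Gamma>c s) c" if "s \<in> ?I" for s
    using c(1) cinv_cdom[OF \<gamma>D[OF that]] by (simp add: chart_at_def \<Gamma>c_def)
  have vel: "velocity A \<Gamma>c s = tvec_of A c (\<Gamma>c s) (\<gamma>' s)" if "s \<in> ?I" for s
    unfolding \<Gamma>c_def[abs_def] by (rule velocity_chart[OF c(1) \<gamma>D[OF that] d\<gamma>[OF that]])
  have norm: "g (\<Gamma>c s) (tvec_of A c (\<Gamma>c s) u) (tvec_of A c (\<Gamma>c s) v) = cm c (\<gamma> s) u v" for s u v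
    by (simp add: coord_metric_def \<Gamma>c_def)
  have geodesic: "unit_speed_geodesic A g ?I \<Gamma>c"
    unfolding unit_speed_geodesic_def
  proof (intro conjI ballI)
    show "smooth_curve A ?I \<Gamma>c" unfolding \<Gamma>c_def[abs_def] by (rule smooth_curve_chart[OF c(1) I sm(1) \<gamma>I])
    fix s assume s: "s \<in> ?I"
    show "g (\<Gamma>c s) (velocity A \<Gamma>c s) (velocity A \<Gamma>c s) = 1" by (simp add: vel[OF s] norm unit[OF s])
    have "cov_deriv_along A g \<Gamma>c (velocity A \<Gamma>c) s =
        tvec_of A c (\<Gamma>c s) (\<gamma>'' s + christoffel (cm c) (\<gamma> s) (\<gamma>' s) (\<gamma>' s))"
      using cov_deriv_along_chart[OF c(1) I s sm(1) \<gamma>I d\<gamma>[OF s] d\<gamma>'[OF s], of "velocity A \<Gamma>c"] vel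
      unfolding \<Gamma>c_def[abs_def] by blast
    then show "cov_deriv_along A g \<Gamma>c (velocity A \<Gamma>c) s = tvec_zero"
      by (simp add: geo[OF s] tvec_of_zero[OF ch[OF s]])
  qed
  have parallel: "parallel_unit_field A g ?I \<Gamma>c E"
    unfolding parallel_unit_field_def
  proof (intro conjI ballI)
    show "smooth_field_along A ?I \<Gamma>c E" unfolding \<Gamma>c_def[abs_def] E_def[abs_def]
      by (rule smooth_field_along_chart[OF c(1) I sm(1) \<gamma>I sm(2)])
    fix s assume s: "s \<in> ?I"
    show "g (\<Gamma>c s) (E s) (E s) = 1" by (simp add: E_def norm unit\<eta>[OF s])
    have "cov_deriv_along A g \<Gamma>c E s =
        tvec_of A c (\<Gamma>c s) (\<eta>' s + christoffel (cm c) (\<gamma> s) (\<gamma>' s) (\<eta> s))"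
      using cov_deriv_along_chart[OF c(1) I s sm(1) \<gamma>I d\<gamma>[OF s] d\<eta>[OF s], of E]
      unfolding \<Gamma>c_def[abs_def] E_def by blast
    then show "cov_deriv_along A g \<Gamma>c E s = tvec_zero"
      by (simp add: par[OF s] tvec_of_zero[OF ch[OF s]])
  qed
  have "local_param TB F (induced_chart A c) f N"
    by (rule TB.local_param_restrict[OF f N(1)]) (use N V in blast)
  then obtain W where W: "openin (atlas_topology TB) W" "F \<inter> W = cinv (induced_chart A c) ` f ` N"
    by (auto simp: local_param_def)
  have pt: "cinv (induced_chart A c) (\<gamma> s, t *\<^sub>R \<eta> s) = (\<Gamma>c s, tvec_scale t (E s))" if "s \<in> ?I" for s t
    using cinv_induced[OF c(1) \<gamma>D[OF that]] tvec_of_scale[OF ch[OF that]] by (simp add: \<Gamma>c_def E_def)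
  have "F \<inter> W = cylinder_type_surface \<Gamma>c E ?I {r<..<d}"
    unfolding W(2) fN cylinder_type_surface_def
  proof (intro equalityI subsetI)
    fix P assume "P \<in> cinv (induced_chart A c) ` {(\<gamma> s, t *\<^sub>R \<eta> s) | s t. s \<in> ?I \<and> t \<in> {r<..<d}}"
    then show "P \<in> {(\<Gamma>c s, tvec_scale t (E s)) | s t. s \<in> ?I \<and> t \<in> {r<..<d}}" using pt by blast
  next
    fix P assume "P \<in> {(\<Gamma>c s, tvec_scale t (E s)) | s t. s \<in> ?I \<and> t \<in> {r<..<d}}"
    then obtain s t where "P = (\<Gamma>c s, tvec_scale t (E s))" "s \<in> ?I" "t \<in> {r<..<d}" by blast
    then show "P \<in> cinv (induced_chart A c) ` {(\<gamma> s, t *\<^sub>R \<eta> s) | s t. s \<in> ?I \<and> t \<in> {r<..<d}}"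
      using pt[of s t, symmetric] by blast
  qed
  moreover have "p \<in> W" using W(2) p N(2) by blast
  ultimately show ?thesis using W(1) ab geodesic parallel by blast
qed

end
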